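(* Let $1\leq p<2$, let $\Psi$ be a nonconstant holomorphic function defined on a connected open set $O\subseteq\mathbb{C}$ containing $\gamma(S_{p})$, and let $\Psi(\mathcal{L})$ be the multiplier on $\mathcal{S}_{p}(\mathcal{X})$ with symbol $\Psi\circ\gamma$. Suppose that $\{f_{k}\}_{k\in\mathbb{Z}}$ is a bi-infinite sequence of functions on $\mathcal{X}$ satisfying for all $k\in\mathbb{Z}$: (i) $\Psi(\mathcal{L}) f_{k}=A\,f_{k+1}$ for some $A\in\mathbb{C}\setminus\{0\}$ (independent of $k$). (ii) $\|f_{k}\|_{L^{p^{\prime},\infty}(\mathcal{X})}\leq M$ for some constant $M>0$ (independent of $k$). If $|A|=\max\{|\Psi\circ\gamma(z)|:z\in S_{p}\}$ and if the range $\Psi\circ\gamma(S_p)$ intersects $\{w\in\mathbb{C}:|w|=|A|\}$ at finitely many distinct points, then $f_{0}$ can be uniquely written as $f_{0}=g_{1}+\cdots+g_{m}$ for some $g_{l}\in L^{p^{\prime},\infty}(\mathcal{X})$, $l=1,\ldots,m$, satisfying $\mathcal{L}g_{l}=\gamma(\alpha_{l}+i\delta_{p^{\prime}})g_{l}$, where $-\tau/2< \alpha_{l}\leq\tau/2$ are distinct and $|\Psi\circ\gamma(\alpha_{l}+i\delta_{p^{\prime}})|=|A|$. In particular, for all $l=1,\ldots,m$, $g_{l}=\mathcal{P}_{\alpha_{l}+i\delta_{p^{\prime}}}F_{l}$ for some $F_{l}\in L^{p^{\prime}}(\Omega)$.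
   Context: Let $q\geq 2$ be an integer and let $\mathcal{X}$ be the homogeneous tree of degree $q+1$ (the connected graph without cycles in which every vertex has $q+1$ neighbours), identified with its set of vertices, with graph distance $d$, counting measure, a fixed reference vertex $o$, and $|x|=d(o,x)$. A function on $\mathcal{X}$ is radial if its value at $x$ depends only on $|x|$; for radial $k$ we write $k(n)$ for its value at vertices with $|x|=n$. For $k$ radial, $f\ast k(x)=\sum_{y\in\mathcal{X}}f(y)k(d(x,y))$. $p'$ is the conjugate exponent of $p$ ($p'=\infty$ if $p=1$). For $p\in(1,\infty)$ put $\delta_p=\frac1p-\frac12$; $\delta_1=\frac12=-\delta_\infty$. $S_p=\{z\in\mathbb{C}:|\Im z|\le|\delta_p|\}$ and $\tau=2\pi/\log q$. The Laplacian is $\mathcal{L}f(x)=f(x)-\frac{1}{q+1}\sum_{y:d(x,y)=1}f(y)$, and $\gamma(z)=1-\frac{q^{1/2+iz}+q^{1/2-iz}}{q+1}$ for $z\in\mathbb{C}$. For $r\in[1,\infty)$, $L^{r,\infty}(\mathcal{X})$ is the space of functions $f$ on $\mathcal X$ with $\|f\|_{L^{r,\infty}(\mathcal{X})}=\sup_{t>0}t\,(\#\{x:|f(x)|>t\})^{1/r}<\infty$; $L^{\infty,\infty}(\mathcal{X})=L^\infty(\mathcal{X})$. $\Omega$ is the set of infinite geodesic rays $\omega=\{\omega_0,\omega_1,\dots\}$ starting at $\omega_0=o$; $c(x,\omega)$ is the last vertex of the geodesic path from $o$ to $x$ that lies on $\omega$. $\nu$ is the Borel probability measure on $\Omega$ giving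 mass $(q+1)^{-1}q^{-n+1}$ to each set $\{\omega:|c(x,\omega)|=|x|\}$ with $|x|=n\ge1$ (these sets, for $x\in\mathcal X$, form a basis of the topology); $L^r(\Omega)=L^r(\Omega,\nu)$. With $p(x,\omega)=q^{2|c(x,\omega)|-|x|}$, the Poisson transform of $F$ is $\mathcal{P}_zF(x)=\int_\Omega p^{1/2+iz}(x,\omega)F(\omega)\,d\nu(\omega)$, and $\phi_z=\mathcal{P}_z\mathbf{1}$ is the elementary spherical function. For radial $k$, $\widehat{k}(z)=\sum_{x\in\mathcal{X}}k(x)\phi_z(x)$. For $1\le p<2$, $\mathcal{S}_p(\mathcal{X})$ is the space of functions $\phi$ on $\mathcal{X}$ with $\nu_{p,m}(\phi)=\sup_{x}(1+|x|)^m q^{|x|/p}|\phi(x)|<\infty$ for all integers $m\ge0$. For $\Psi$ holomorphic on a connected open set containing $\gamma(S_p)$ there is a unique radial $k\in\mathcal{S}_p(\mathcal{X})$ with $\widehat{k}(z)=\Psi(\gamma(z))$ for $z\in S_p$; the multiplier $\Psi(\mathcal{L})$ with symbol $\Psi\circ\gamma$ is the operator $f\mapsto f\ast k$, which is defined on $\mathcal{S}_p(\mathcal{X})$ and also on $L^{p',\infty}(\mathcal{X})$. *)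

theory Defs
  imports "HOL-Complex_Analysis.Complex_Analysis" "HOL-Probability.Probability"
begin

section \<open>Homogeneous trees\<close>

text \<open>
  A graph is given by its adjacency relation \<open>E\<close>; the vertices are all elements of the type \<open>'a\<close>.
\<close>

definition graph_cycle :: "('a \<Rightarrow> 'a \<Rightarrow> bool) \<Rightarrow> 'a list \<Rightarrow> bool" where
  "graph_cycle E xs \<longleftrightarrow>
     3 \<le> length xs \<and> distinct xs \<and> successively E xs \<and> E (last xs) (hd xs)"

definition homogeneous_tree :: "nat \<Rightarrow> ('a \<Rightarrow> 'a \<Rightarrow> bool) \<Rightarrow> bool" where
  "homogeneous_tree q E \<longleftrightarrow>
     (\<forall>x. \<not> E x x) \<and> (\<forall>x y. E x y \<longrightarrow> E y x) \<and>
     (\<forall>x y. E\<^sup>*\<^sup>* x y) \<and> (\<nexists>xs. graph_cycle E xs) \<and>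
     (\<forall>x. finite {y. E x y} \<and> card {y. E x y} = q + 1)"

definition gdist :: "('a \<Rightarrow> 'a \<Rightarrow> bool) \<Rightarrow> 'a \<Rightarrow> 'a \<Rightarrow> nat" where
  "gdist E x y = (LEAST n. (E ^^ n) x y)"

section \<open>Functions on the tree\<close>

definition laplacian :: "nat \<Rightarrow> ('a \<Rightarrow> 'a \<Rightarrow> bool) \<Rightarrow> ('a \<Rightarrow> complex) \<Rightarrow> 'a \<Rightarrow> complex" where
  "laplacian q E f x = f x - (\<Sum>y | gdist E x y = 1. f y) / of_nat (q + 1)"

text \<open>
  A radial function with respect to the reference vertex \<open>b\<close> is represented by its profile
  \<open>k :: nat \<Rightarrow> complex\<close>, i.e. it is the function \<open>\<lambda>x. k (gdist E b x)\<close>.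
\<close>

definition radial_conv ::
    "('a \<Rightarrow> 'a \<Rightarrow> bool) \<Rightarrow> ('a \<Rightarrow> complex) \<Rightarrow> (nat \<Rightarrow> complex) \<Rightarrow> 'a \<Rightarrow> complex" where
  "radial_conv E f k x = (\<Sum>\<^sub>\<infinity>y. f y * k (gdist E x y))"

definition schwartz ::
    "nat \<Rightarrow> ('a \<Rightarrow> 'a \<Rightarrow> bool) \<Rightarrow> 'a \<Rightarrow> real \<Rightarrow> ('a \<Rightarrow> complex) set" where
  "schwartz q E b p =
     {\<phi>. \<forall>m::nat. bdd_above (range (\<lambda>x.
        (1 + real (gdist E b x)) ^ m * real q powr (real (gdist E b x) / p) * cmod (\<phi> x)))}"

definition weak_norm :: "ereal \<Rightarrow> ('a \<Rightarrow> complex) \<Rightarrow> ennreal" where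
  "weak_norm r f =
     (if r = \<infinity> then (SUP x. ennreal (cmod (f x)))
      else (SUP t\<in>{0<..}. ennreal t *
              (if finite {x. t < cmod (f x)}
               then ennreal (real (card {x. t < cmod (f x)}) powr (1 / real_of_ereal r))
               else \<infinity>)))"

definition weak_L :: "ereal \<Rightarrow> ('a \<Rightarrow> complex) set" where
  "weak_L r = {f. weak_norm r f < \<infinity>}"

section \<open>Exponents, the strip and the spectral parameter\<close>

definition conj_exponent :: "real \<Rightarrow> ereal" where
  "conj_exponent p = (if p = 1 then \<infinity> else ereal (p / (p - 1)))"

definition delta :: "ereal \<Rightarrow> real" where
  "delta r = (if r = \<infinity> then - 1 / 2 else 1 / real_of_ereal r - 1 / 2)"

definition strip :: "real \<Rightarrow> complex set" where
  "strip p = {z. \<bar>Im z\<bar> \<le> \<bar>delta (ereal p)\<bar>}"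

definition tau :: "nat \<Rightarrow> real" where
  "tau q = 2 * pi / ln (real q)"

definition gamma_sym :: "nat \<Rightarrow> complex \<Rightarrow> complex" where
  "gamma_sym q z =
     1 - (of_nat q powr (1 / 2 + \<i> * z) + of_nat q powr (1 / 2 - \<i> * z)) / of_nat (q + 1)"

section \<open>The boundary and the Poisson transform\<close>

definition rays :: "('a \<Rightarrow> 'a \<Rightarrow> bool) \<Rightarrow> 'a \<Rightarrow> (nat \<Rightarrow> 'a) set" where
  "rays E b = {\<omega>. \<omega> 0 = b \<and> (\<forall>m n. m \<le> n \<longrightarrow> gdist E (\<omega> m) (\<omega> n) = n - m)}"

text \<open>
  The vertices of the geodesic path from \<open>b\<close> to \<open>x\<close> are the \<open>y\<close> with \<open>d b y + d y x = d b x\<close>;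
  among those lying on the ray, the last one is the one farthest from \<open>b\<close>.
\<close>

definition confluence :: "('a \<Rightarrow> 'a \<Rightarrow> bool) \<Rightarrow> 'a \<Rightarrow> 'a \<Rightarrow> (nat \<Rightarrow> 'a) \<Rightarrow> 'a" where
  "confluence E b x \<omega> =
     (ARG_MAX (gdist E b) y. y \<in> range \<omega> \<and> gdist E b y + gdist E y x = gdist E b x)"

definition sector :: "('a \<Rightarrow> 'a \<Rightarrow> bool) \<Rightarrow> 'a \<Rightarrow> 'a \<Rightarrow> (nat \<Rightarrow> 'a) set" where
  "sector E b x = {\<omega> \<in> rays E b. gdist E b (confluence E b x \<omega>) = gdist E b x}"

definition boundary_topology :: "('a \<Rightarrow> 'a \<Rightarrow> bool) \<Rightarrow> 'a \<Rightarrow> (nat \<Rightarrow> 'a) topology" where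
  "boundary_topology E b = topology_generated_by (range (sector E b))"

text \<open>These conditions determine \<open>\<nu>\<close> uniquely.\<close>

definition boundary_measure ::
    "nat \<Rightarrow> ('a \<Rightarrow> 'a \<Rightarrow> bool) \<Rightarrow> 'a \<Rightarrow> (nat \<Rightarrow> 'a) measure \<Rightarrow> bool" where
  "boundary_measure q E b \<nu> \<longleftrightarrow>
     prob_space \<nu> \<and> space \<nu> = rays E b \<and>
     sets \<nu> = sigma_sets (rays E b) {U. openin (boundary_topology E b) U} \<and>
     (\<forall>x. 1 \<le> gdist E b x \<longrightarrow>
        measure \<nu> (sector E b x) = 1 / (real (q + 1) * real q ^ (gdist E b x - 1)))"

definition boundary_L :: "(nat \<Rightarrow> 'a) measure \<Rightarrow> ereal \<Rightarrow> ((nat \<Rightarrow> 'a) \<Rightarrow> complex) set" where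
  "boundary_L \<nu> r =
     {F \<in> borel_measurable \<nu>.
        if r = \<infinity> then \<exists>C. AE \<omega> in \<nu>. cmod (F \<omega>) \<le> C
        else integrable \<nu> (\<lambda>\<omega>. cmod (F \<omega>) powr real_of_ereal r)}"

definition poisson_kernel ::
    "nat \<Rightarrow> ('a \<Rightarrow> 'a \<Rightarrow> bool) \<Rightarrow> 'a \<Rightarrow> 'a \<Rightarrow> (nat \<Rightarrow> 'a) \<Rightarrow> real" where
  "poisson_kernel q E b x \<omega> =
     real q powi (2 * int (gdist E b (confluence E b x \<omega>)) - int (gdist E b x))"

definition poisson_transform ::
    "nat \<Rightarrow> ('a \<Rightarrow> 'a \<Rightarrow> bool) \<Rightarrow> 'a \<Rightarrow> (nat \<Rightarrow> 'a) measure \<Rightarrow> complex \<Rightarrow>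
     ((nat \<Rightarrow> 'a) \<Rightarrow> complex) \<Rightarrow> 'a \<Rightarrow> complex" where
  "poisson_transform q E b \<nu> z F x =
     (LINT \<omega>|\<nu>. of_real (poisson_kernel q E b x \<omega>) powr (1 / 2 + \<i> * z) * F \<omega>)"

definition spherical ::
    "nat \<Rightarrow> ('a \<Rightarrow> 'a \<Rightarrow> bool) \<Rightarrow> 'a \<Rightarrow> (nat \<Rightarrow> 'a) measure \<Rightarrow> complex \<Rightarrow> 'a \<Rightarrow> complex" where
  "spherical q E b \<nu> z = poisson_transform q E b \<nu> z (\<lambda>\<omega>. 1)"

definition spherical_transform ::
    "nat \<Rightarrow> ('a \<Rightarrow> 'a \<Rightarrow> bool) \<Rightarrow> 'a \<Rightarrow> (nat \<Rightarrow> 'a) measure \<Rightarrow> (nat \<Rightarrow> complex) \<Rightarrow>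
     complex \<Rightarrow> complex" where
  "spherical_transform q E b \<nu> k z =
     (\<Sum>\<^sub>\<infinity>x. k (gdist E b x) * spherical q E b \<nu> z x)"

section \<open>Multipliers and decompositions into eigenfunctions\<close>

text \<open>
  For \<open>\<Psi>\<close> holomorphic on a connected open neighbourhood of \<open>\<gamma>(S\<^sub>p)\<close> exactly one \<open>k\<close> satisfies the
  following, and the multiplier \<open>\<Psi>(\<L>)\<close> is the operator \<open>\<lambda>f. radial_conv E f k\<close>.
\<close>

definition multiplier_kernel ::
    "nat \<Rightarrow> ('a \<Rightarrow> 'a \<Rightarrow> bool) \<Rightarrow> 'a \<Rightarrow> (nat \<Rightarrow> 'a) measure \<Rightarrow> real \<Rightarrow>
     (complex \<Rightarrow> complex) \<Rightarrow> (nat \<Rightarrow> complex) \<Rightarrow> bool" where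
  "multiplier_kernel q E b \<nu> p \<Psi> k \<longleftrightarrow>
     (\<lambda>x. k (gdist E b x)) \<in> schwartz q E b p \<and>
     (\<forall>z\<in>strip p. spherical_transform q E b \<nu> k z = \<Psi> (gamma_sym q z))"

definition spec_param :: "real \<Rightarrow> real \<Rightarrow> complex" where
  "spec_param p a = of_real a + \<i> * of_real (delta (conj_exponent p))"

definition eigen_decomposition ::
    "nat \<Rightarrow> ('a \<Rightarrow> 'a \<Rightarrow> bool) \<Rightarrow> real \<Rightarrow> (complex \<Rightarrow> complex) \<Rightarrow> complex \<Rightarrow> ('a \<Rightarrow> complex) \<Rightarrow>
     nat \<Rightarrow> (nat \<Rightarrow> real) \<Rightarrow> (nat \<Rightarrow> 'a \<Rightarrow> complex) \<Rightarrow> bool" where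
  "eigen_decomposition q E p \<Psi> A f m \<alpha> g \<longleftrightarrow>
     1 \<le> m \<and> f = (\<lambda>x. \<Sum>l = 1..m. g l x) \<and> inj_on \<alpha> {1..m} \<and>
     (\<forall>l\<in>{1..m}.
        - tau q / 2 < \<alpha> l \<and> \<alpha> l \<le> tau q / 2 \<and>
        cmod (\<Psi> (gamma_sym q (spec_param p (\<alpha> l)))) = cmod A \<and>
        g l \<in> weak_L (conj_exponent p) \<and>
        laplacian q E (g l) = (\<lambda>x. gamma_sym q (spec_param p (\<alpha> l)) * g l x))"

text \<open>
  Summands are allowed to vanish (which is unavoidable for \<open>f = 0\<close>), so uniqueness of a
  decomposition means that the set of its nonzero summands, each paired with its parameter, is
  determined.
\<close>

definition nonzero_summands ::
    "nat \<Rightarrow> (nat \<Rightarrow> real) \<Rightarrow> (nat \<Rightarrow> 'a \<Rightarrow> complex) \<Rightarrow> (real \<times> ('a \<Rightarrow> complex)) set" where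
  "nonzero_summands m \<alpha> g = {(\<alpha> l, g l) | l. l \<in> {1..m} \<and> g l \<noteq> (\<lambda>x. 0)}"

end

theory Submission
  imports Defs "HOL-Library.Transitive_Closure_Table"
begin

text \<open>
  Put \<open>t = q\<^bsup>iz\<^esup>\<close>. Then \<open>\<gamma>(z)\<close> becomes \<open>1 - \<surd>q (t + 1/t) / (q + 1)\<close>, here called \<open>lap_value t\<close>,
  and the strip becomes the annulus \<open>R \<le> |t| \<le> 1/R\<close> with \<open>R = q\<^bsup>1/2 - 1/p\<^esup> < 1\<close>. The symmetry
  \<open>t \<mapsto> 1/t\<close> identifies the two boundary circles, so the boundary of \<open>\<gamma>(S\<^sub>p)\<close> is the
  one-to-one image of the circle \<open>|t| = R\<close>.

  The proof rests on a resolvent. For a function of weak type \<open>p'\<close> the sum of its absolute values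
  over a sphere of radius \<open>n\<close> is at most a constant times \<open>(\<surd>q / R)\<^sup>n\<close>, uniformly in the centre,
  because a set of \<open>N\<close> vertices carries at most the mass \<open>C N\<^bsup>1/p\<^esup>\<close>. Hence the generating function of
  its spherical sums (\<open>green\<close>) converges on \<open>|t| < R\<close>, where it is bounded by a multiple of
  \<open>1/(1 - |t|/R)\<close>. Up to explicit factors it is the resolvent of the Laplacian at the value
  \<open>lap_value t\<close> (\<open>green_resolvent\<close>). Integrating it over a circle \<open>|t| = r\<close> with \<open>r < R\<close>
  against symmetric holomorphic functions gives a functional calculus (\<open>cauchy\<close>), in which
  polynomials in the Laplacian and convolution operators act as multiplication by their symbols
  (\<open>cauchy_ssum\<close>, \<open>cauchy_conv\<close>). Convolution by the kernel of \<open>\<Psi>(\<L>)\<close> fits in: its spherical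
  transform extends holomorphically past the closed annulus, so shifting a contour in the inversion
  formula gives it more exponential decay than the weak space requires (\<open>kernel_inversion\<close>),
  and its symbol is \<open>\<Psi> \<circ> lap_value\<close> (\<open>multiplier_kernel_symbol\<close>).

  Let \<open>u = \<Psi> \<circ> lap_value / A\<close>, so that \<open>|u| \<le> 1\<close> on \<open>|t| = R\<close>. As \<open>\<Psi>\<close> is not constant and
  takes finitely many values of maximal modulus, equality holds at finitely many points, and there are such
  points because the maximum over \<open>\<gamma>(S\<^sub>p)\<close> is attained on its boundary. Let \<open>P\<close> be the
  polynomial with simple zeros at the corresponding eigenvalues. Since
  \<open>f\<^sub>0 = (\<Psi>(\<L>)/A)\<^sup>k f\<^bsub>-k\<^esub>\<close>, the function \<open>P(\<L>)\<^sup>N f\<^sub>0\<close> is the value of the calculus at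
  \<open>P\<^sup>N u\<^sup>k\<close> applied to the uniformly bounded \<open>f\<^bsub>-k\<^esub>\<close>. On the circle of radius \<open>R (1 - 1/k)\<close> the
  resolvent costs a factor \<open>k\<close>, whereas \<open>P\<^sup>N u\<^sup>k\<close> is of order \<open>1/k\<^sup>2\<close> for large \<open>N\<close>: by a
  Lojasiewicz inequality \<open>1 - |u|\<^sup>2\<close> is at least a multiple of a power of \<open>|P|\<close>
  (\<open>lojasiewicz_circle\<close>). Letting \<open>k\<close> tend to infinity gives \<open>P(\<L>)\<^sup>N f\<^sub>0 = 0\<close>
  (\<open>bounded_orbit_annihilated\<close>). The multiplicity \<open>N\<close> can be removed, since the resolvent of a
  genuine generalised eigenfunction would have a double pole on \<open>|t| = R\<close>, against its
  growth of first order (\<open>no_generalized_eigenfunctions\<close>). So \<open>P(\<L>) f\<^sub>0 = 0\<close>, and the Lagrange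
  interpolation polynomials of the eigenvalues, evaluated at \<open>\<L>\<close>, split \<open>f\<^sub>0\<close> into
  eigenfunctions and recover the summands of any other such splitting.

  It remains to represent an eigenfunction \<open>g\<close> of weak type \<open>p'\<close> with a boundary parameter as a Poisson transform.
  From \<open>g\<close> at a vertex and at its parent one reads off a finitely additive complex measure on
  the sectors, whose densities form a martingale (\<open>eigen_mass_children\<close>). The \<open>p'\<close>-th powers of
  their norms increase, while the weak-type bound makes their sum over the first \<open>n\<close> levels
  grow only linearly in \<open>n\<close>. So for finite \<open>p'\<close> they are bounded; for \<open>p' = \<infinity>\<close> the densities themselves are. As
  \<open>p' > 2\<close>, the martingale is bounded in \<open>L\<^sup>2\<close> and converges in \<open>L\<^sup>1\<close>, and by Fatou's
  lemma its limit, which lies in \<open>L\<^bsup>p'\<^esup>\<close>, represents \<open>g\<close> (\<open>eigenfunction_poisson\<close>).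
\<close>


section \<open>Geometry of a homogeneous tree\<close>

locale hom_tree =
  fixes q :: nat and E :: "'a \<Rightarrow> 'a \<Rightarrow> bool"
  assumes q_ge_2: "2 \<le> q" and tree: "homogeneous_tree q E"
begin

abbreviation d :: "'a \<Rightarrow> 'a \<Rightarrow> nat" where "d \<equiv> gdist E"

definition tsphere :: "'a \<Rightarrow> nat \<Rightarrow> 'a set" where "tsphere x n = {y. d x y = n}"

lemma E_sym: "E x y \<Longrightarrow> E y x"
  and E_irrefl: "\<not> E x x"
  and E_connected: "E\<^sup>*\<^sup>* x y"
  and no_cycle: "\<not> graph_cycle E xs"
  and finite_nbrs: "finite {y. E x y}"
  and card_nbrs: "card {y. E x y} = q + 1"
  using tree unfolding homogeneous_tree_def by blast+

lemma relpowp_d: "(E ^^ d x y) x y"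
proof -
  have "\<exists>n. (E ^^ n) x y" using E_connected by (simp add: rtranclp_power)
  then show ?thesis unfolding gdist_def by (rule LeastI_ex)
qed

lemma d_le: "(E ^^ n) x y \<Longrightarrow> d x y \<le> n"
  unfolding gdist_def by (rule Least_le)

lemma d_self [simp]: "d x x = 0"
  using d_le[of 0 x x] by simp

lemma d_eq_0 [simp]: "d x y = 0 \<longleftrightarrow> x = y"
  using relpowp_d[of x y] by fastforce

lemma d_pos [simp]: "0 < d x y \<longleftrightarrow> x \<noteq> y"
  using d_eq_0[of x y] by linarith

lemma relpowp_sym: "(E ^^ n) x y \<Longrightarrow> (E ^^ n) y x"
proof (induction n arbitrary: x y)
  case (Suc n)
  then obtain z where "(E ^^ n) x z" "E z y" by auto
  then show ?case using Suc.IH E_sym relpowp_Suc_I2 by metis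
qed auto

lemma d_commute: "d x y = d y x"
  by (meson antisym d_le relpowp_d relpowp_sym)

lemma d_triangle: "d x z \<le> d x y + d y z"
proof -
  have "(E ^^ (d x y + d y z)) x z"
    unfolding relpowp_add using relpowp_d by blast
  then show ?thesis by (rule d_le)
qed

lemma d_eq_1: "d x y = 1 \<longleftrightarrow> E x y"
proof
  assume "d x y = 1" then show "E x y" using relpowp_d[of x y] by auto
next
  assume e: "E x y"
  then have "d x y \<le> 1" by (intro d_le) auto
  moreover have "d x y \<noteq> 0" using e E_irrefl by auto
  ultimately show "d x y = 1" by linarith
qed

lemma sphere_1: "tsphere x 1 = {y. E x y}"
  by (simp add: tsphere_def d_eq_1[simplified])

lemma sphere_0: "tsphere x 0 = {x}"
  by (auto simp: tsphere_def)

lemma d_nbr: "E y z \<Longrightarrow> d x z \<le> Suc (d x y)" "E y z \<Longrightarrow> d x y \<le> Suc (d x z)"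
  using d_triangle[of x z y] d_triangle[of x y z] d_eq_1[of y z] d_commute[of y z] by auto

lemma d_Suc_obtain:
  assumes "d x y = Suc n"
  obtains z where "d x z = n" "E z y"
proof -
  obtain z where z: "(E ^^ n) x z" "E z y"
    using relpowp_d[of x y] assms by auto
  moreover have "d x z = n"
    using d_le[OF z(1)] d_nbr(1)[OF z(2), of x] assms by simp
  ultimately show ?thesis using that by blast
qed

text \<open>A geodesic from \<open>r\<close> to \<open>y\<close> stays strictly closer to \<open>r\<close> than \<open>y\<close> before its end, so it
  cannot meet another vertex that is at least as far from \<open>r\<close> as \<open>y\<close>.\<close>

lemma avoiding_path:
  assumes "d r y \<le> d r x" "y \<noteq> x"
  shows "(\<lambda>u v. E u v \<and> u \<noteq> x \<and> v \<noteq> x)\<^sup>*\<^sup>* r y"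
  using assms
proof (induction "d r y" arbitrary: y)
  case 0
  then show ?case by simp
next
  case (Suc n)
  obtain z where z: "d r z = n" "E z y" using d_Suc_obtain Suc.hyps(2) by metis
  have "z \<noteq> x" using z Suc by auto
  with Suc z have "(\<lambda>u v. E u v \<and> u \<noteq> x \<and> v \<noteq> x)\<^sup>*\<^sup>* r z" by auto
  then show ?case using z \<open>z \<noteq> x\<close> Suc.prems by (simp add: rtranclp.rtrancl_into_rtrancl)
qed

lemma rtrancl_path_successively:
  "rtrancl_path r x xs y \<Longrightarrow> successively r (x # xs) \<and> last (x # xs) = y"
  by (induction rule: rtrancl_path.induct) auto

text \<open>This is where the absence of cycles enters: two different neighbours of \<open>x\<close>, both no farther
  from \<open>r\<close> than \<open>x\<close>, could be joined through \<open>r\<close> by a path that avoids \<open>x\<close>, and \<open>x\<close> would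
  close it to a cycle. As a consequence no two neighbours are equidistant from \<open>r\<close>, and \<open>x\<close> has
  one parent.\<close>

lemma parent_unique:
  assumes "E y x" "E z x" "d r y \<le> d r x" "d r z \<le> d r x"
  shows "y = z"
proof (rule ccontr)
  assume ne: "y \<noteq> z"
  let ?R = "\<lambda>u v. E u v \<and> u \<noteq> x \<and> v \<noteq> x"
  have yx: "y \<noteq> x" "z \<noteq> x" using assms E_irrefl by auto
  have sym: "?R\<inverse>\<inverse> = ?R" using E_sym by (auto simp: fun_eq_iff)
  have "?R\<^sup>*\<^sup>* r y" "?R\<^sup>*\<^sup>* r z" using avoiding_path assms yx by auto
  moreover have "?R\<^sup>*\<^sup>* y r"
    using rtranclp_converseI[OF \<open>?R\<^sup>*\<^sup>* r y\<close>] unfolding sym .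
  ultimately have "?R\<^sup>*\<^sup>* y z" by (meson rtranclp_trans)
  then obtain vs where "rtrancl_path ?R y vs z" by (auto simp: rtranclp_eq_rtrancl_path)
  from rtrancl_path_distinct[OF this]
  obtain ws where ws: "rtrancl_path ?R y ws z" "distinct (y # ws)" .
  have s: "successively ?R (y # ws)" "last (y # ws) = z"
    using rtrancl_path_successively[OF ws(1)] by auto
  have nonempty: "ws \<noteq> []" using s(2) ne by auto
  have "x \<notin> set (y # ws)"
    using s(1) yx by (induction ws arbitrary: y) auto
  moreover have "successively E (y # ws)"
    using s(1) by (rule successively_mono) auto
  ultimately have "graph_cycle E (x # y # ws)"
    using ws(2) s(2) nonempty assms E_sym
    by (cases ws) (auto simp: graph_cycle_def)
  then show False using no_cycle by blast
qed

definition parent :: "'a \<Rightarrow> 'a \<Rightarrow> 'a" where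
  "parent r x = (SOME y. E y x \<and> Suc (d r y) = d r x)"

lemma parent:
  assumes "x \<noteq> r"
  shows E_parent: "E (parent r x) x" and d_parent: "Suc (d r (parent r x)) = d r x"
proof -
  obtain n where n: "d r x = Suc n" using assms d_eq_0[of r x] by (cases "d r x") auto
  have "\<exists>y. E y x \<and> Suc (d r y) = d r x" using d_Suc_obtain[OF n] n by metis
  then have "E (parent r x) x \<and> Suc (d r (parent r x)) = d r x"
    unfolding parent_def by (rule someI_ex)
  then show "E (parent r x) x" "Suc (d r (parent r x)) = d r x" by auto
qed

lemma parentI:
  assumes "E y x" "d r y \<le> d r x" shows "y = parent r x"
proof -
  have "x \<noteq> r" using assms E_irrefl by (metis d_eq_0 d_self le_zero_eq)
  then show ?thesis
    using parent_unique[OF assms(1) E_parent[OF \<open>x \<noteq> r\<close>] assms(2)] d_parent[OF \<open>x \<noteq> r\<close>]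
    by simp
qed

definition children :: "'a \<Rightarrow> 'a \<Rightarrow> 'a set" where
  "children r x = {y. E x y \<and> d r y = Suc (d r x)}"

lemma nbrs_eq: "x \<noteq> r \<Longrightarrow> {y. E x y} = insert (parent r x) (children r x)"
proof (intro subset_antisym subsetI)
  fix y assume x: "x \<noteq> r" and "y \<in> {y. E x y}"
  then have y: "E x y" "E y x" using E_sym by auto
  show "y \<in> insert (parent r x) (children r x)"
  proof (cases "d r y \<le> d r x")
    case True then show ?thesis using parentI y by auto
  next
    case False then show ?thesis using d_nbr(1)[OF y(1), of r] y by (auto simp: children_def)
  qed
qed (use E_parent E_sym in \<open>auto simp: children_def\<close>)

lemma nbrs_root: "{y. E r y} = children r r"
  by (auto simp: children_def d_eq_1[simplified])

lemma parent_notin_children: "x \<noteq> r \<Longrightarrow> parent r x \<notin> children r x"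
  using d_parent by (fastforce simp: children_def)

lemma finite_children [simp]: "finite (children r x)"
  by (rule finite_subset[OF _ finite_nbrs[of x]]) (auto simp: children_def)

lemma card_children: "card (children r x) = (if x = r then q + 1 else q)"
proof (cases "x = r")
  case True then show ?thesis using card_nbrs[of r] by (simp add: nbrs_root)
next
  case False
  then show ?thesis
    using card_nbrs[of x] nbrs_eq[OF False] parent_notin_children[OF False] by simp
qed

lemma children_ne: "y \<in> children r x \<Longrightarrow> y \<noteq> r"
  by (auto simp: children_def)

lemma parent_child: "y \<in> children r x \<Longrightarrow> parent r y = x"
  using parentI[of x y r] by (auto simp: children_def)

lemma child_parent: "y \<noteq> r \<Longrightarrow> y \<in> children r (parent r y)"
  using parent[of y r] by (auto simp: children_def)

text \<open>Spheres are partitioned into families of siblings; all sums over spheres are computed by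
  induction along this partition.\<close>

lemma sphere_Suc: "tsphere r (Suc n) = (\<Union>x\<in>tsphere r n. children r x)"
proof (intro subset_antisym subsetI)
  fix y assume "y \<in> tsphere r (Suc n)"
  then have y: "d r y = Suc n" "y \<noteq> r" by (auto simp: tsphere_def)
  then show "y \<in> (\<Union>x\<in>tsphere r n. children r x)"
    using child_parent[of y r] d_parent[of y r] by (auto simp: tsphere_def)
qed (auto simp: tsphere_def children_def)

lemma disjoint_children: "x \<noteq> y \<Longrightarrow> children r x \<inter> children r y = {}"
  using parent_child by blast

lemma finite_sphere [simp]: "finite (tsphere r n)"
  by (induction n) (auto simp: sphere_0 sphere_Suc)

lemma sum_sphere_Suc:
  "(\<Sum>y\<in>tsphere r (Suc n). f y) = (\<Sum>x\<in>tsphere r n. \<Sum>y\<in>children r x. f y)"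
  unfolding sphere_Suc using disjoint_children by (intro sum.UNION_disjoint) auto

lemma sum_nbrs:
  "x \<noteq> r \<Longrightarrow> (\<Sum>y | E x y. f y) = f (parent r x) + (\<Sum>y\<in>children r x. f y)"
  by (simp add: nbrs_eq parent_notin_children)

lemma card_sphere: "card (tsphere r (Suc n)) = (q + 1) * q ^ n"
proof (induction n)
  case 0
  then show ?case using sphere_1[of r] card_nbrs[of r] by simp
next
  case (Suc n)
  have "card (tsphere r (Suc (Suc n))) = (\<Sum>y\<in>tsphere r (Suc (Suc n)). 1)" by simp
  also have "\<dots> = (\<Sum>x\<in>tsphere r (Suc n). q)"
    unfolding sum_sphere_Suc[of _ r "Suc n"]
    by (intro sum.cong) (auto simp: card_children tsphere_def)
  finally show ?case using Suc by (simp add: algebra_simps)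
qed

lemma sphere_nonempty: "tsphere r n \<noteq> {}"
proof (cases n)
  case (Suc m)
  have "card (tsphere r n) > 0" using card_sphere[of r m] Suc q_ge_2 by simp
  then show ?thesis by auto
qed (simp add: sphere_0)

end

section \<open>Sums over spheres\<close>

context hom_tree begin

definition ssum :: "nat \<Rightarrow> ('a \<Rightarrow> 'b::comm_ring_1) \<Rightarrow> 'a \<Rightarrow> 'b" where
  "ssum n f x = (\<Sum>y\<in>tsphere x n. f y)"

text \<open>The number of neighbours of a vertex at distance \<open>n\<close> from a base point that lie farther away.\<close>

definition branching :: "nat \<Rightarrow> nat" where
  "branching n = (if n = 0 then q + 1 else q)"

lemma ssum_0 [simp]: "ssum 0 f = f"
  by (simp add: ssum_def sphere_0 fun_eq_iff)

lemma ssum_1: "ssum (Suc 0) f x = (\<Sum>y | E x y. f y)"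
  by (simp add: ssum_def sphere_1[simplified])

lemma ssum_add: "ssum n (\<lambda>x. f x + g x) x = ssum n f x + ssum n g x"
  and ssum_diff: "ssum n (\<lambda>x. f x - g x) x = ssum n f x - ssum n g x"
  and ssum_cmult: "ssum n (\<lambda>x. c * f x) x = c * ssum n f x"
  by (simp_all add: ssum_def sum.distrib sum_subtractf sum_distrib_left)

text \<open>A vertex at distance \<open>n + 1\<close> from \<open>x\<close> has one neighbour towards \<open>x\<close> and all others away
  from it; each vertex at distance \<open>n\<close> is reached once from each of its children.\<close>

lemma ssum_Suc_ssum_1:
  "ssum (Suc n) (ssum (Suc 0) f) x = ssum (Suc (Suc n)) f x + of_nat (branching n) * ssum n f x"
proof -
  have "ssum (Suc n) (ssum (Suc 0) f) x =
      (\<Sum>y\<in>tsphere x (Suc n). f (parent x y) + (\<Sum>z\<in>children x y. f z))"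
    unfolding ssum_def[of "Suc n"] ssum_1
    by (intro sum.cong refl sum_nbrs) (auto simp: tsphere_def)
  also have "\<dots> = (\<Sum>y\<in>tsphere x (Suc n). f (parent x y)) + ssum (Suc (Suc n)) f x"
    by (simp add: sum.distrib ssum_def sum_sphere_Suc[of _ x "Suc n"])
  also have "(\<Sum>y\<in>tsphere x (Suc n). f (parent x y)) = (\<Sum>w\<in>tsphere x n. of_nat (branching n) * f w)"
    unfolding sum_sphere_Suc
  proof (intro sum.cong refl)
    fix w assume "w \<in> tsphere x n"
    then have "card (children x w) = branching n"
      using d_pos[of x w] by (auto simp: card_children tsphere_def branching_def)
    moreover have "(\<Sum>y\<in>children x w. f (parent x y)) = (\<Sum>y\<in>children x w. f w)"
      by (intro sum.cong refl) (simp add: parent_child)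
    ultimately show "(\<Sum>y\<in>children x w. f (parent x y)) = of_nat (branching n) * f w" by simp
  qed
  finally show ?thesis by (simp add: ssum_def sum_distrib_left)
qed

lemma ssum_recurrence:
  "ssum (Suc (Suc n)) f x = ssum (Suc n) (ssum (Suc 0) f) x - of_nat (branching n) * ssum n f x"
  by (simp add: ssum_Suc_ssum_1)

lemma ssum_commute: "ssum n (ssum (Suc 0) f) = ssum (Suc 0) (ssum n f)"
proof (induction n arbitrary: f rule: induct_nat_012)
  case (ge2 n)
  have "ssum (Suc (Suc n)) (ssum (Suc 0) f) x = ssum (Suc 0) (ssum (Suc (Suc n)) f) x" for x
  proof -
    have "ssum (Suc 0) (ssum (Suc (Suc n)) f) x =
        ssum (Suc 0) (\<lambda>x. ssum (Suc n) (ssum (Suc 0) f) x - of_nat (branching n) * ssum n f x) x"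
      by (simp add: ssum_recurrence[abs_def])
    also have "\<dots> = ssum (Suc 0) (ssum (Suc n) (ssum (Suc 0) f)) x - of_nat (branching n) * ssum (Suc 0) (ssum n f) x"
      by (simp add: ssum_diff ssum_cmult)
    finally show ?thesis
      by (simp only: ge2.IH[symmetric] ssum_recurrence[of n "ssum (Suc 0) f"])
  qed
  then show ?case by (rule ext)
qed auto

text \<open>All the spherical sums are polynomials in the sum over neighbours.\<close>

lemma ssum_ssum_commute: "ssum n (ssum m f) = ssum m (ssum n f)"
proof (induction n arbitrary: m f rule: induct_nat_012)
  case 1 then show ?case by (simp add: ssum_commute)
next
  case (ge2 n)
  have "ssum (Suc (Suc n)) (ssum m f) x = ssum m (ssum (Suc (Suc n)) f) x" for x
  proof -
    have "ssum m (ssum (Suc (Suc n)) f) x =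
      ssum m (\<lambda>x. ssum (Suc n) (ssum (Suc 0) f) x - of_nat (branching n) * ssum n f x) x"
      by (simp add: ssum_recurrence[abs_def])
    also have "\<dots> = ssum m (ssum (Suc n) (ssum (Suc 0) f)) x - of_nat (branching n) * ssum m (ssum n f) x"
      by (simp add: ssum_diff ssum_cmult)
    finally show ?thesis
      unfolding ssum_recurrence[of n "ssum m f"] ssum_commute[of m f, symmetric]
        ge2.IH(1)[of m f] ge2.IH(2)[of m "ssum (Suc 0) f"] by simp
  qed
  then show ?case by (rule ext)
qed auto

text \<open>The sum over the sphere of radius \<open>n\<close> is this polynomial in the sum over neighbours.
  It differs from the rescaled Chebyshev polynomial of the second kind below only through the one
  additional child of the base point.\<close>

fun sph_poly :: "nat \<Rightarrow> 'b \<Rightarrow> 'b::comm_ring_1" where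
  "sph_poly 0 c = 1"
| "sph_poly (Suc 0) c = c"
| "sph_poly (Suc (Suc n)) c = c * sph_poly (Suc n) c - of_nat (branching n) * sph_poly n c"

fun cheb_poly :: "nat \<Rightarrow> 'b \<Rightarrow> 'b::comm_ring_1" where
  "cheb_poly 0 c = 1"
| "cheb_poly (Suc 0) c = c"
| "cheb_poly (Suc (Suc n)) c = c * cheb_poly (Suc n) c - of_nat q * cheb_poly n c"

text \<open>Variation of constants for the recurrence of the spherical sums. With a nonnegative
  inhomogeneity \<open>F\<close> it turns a supersolution into an upper bound for the spherical sums,
  which is how dominated convergence is obtained for convolutions.\<close>

lemma ssum_perturbed_eigenfunction:
  assumes "\<And>x. ssum (Suc 0) G x = c * G x - F x"
  shows "ssum n G x = sph_poly n c * G x - (\<Sum>k<n. cheb_poly (n - 1 - k) c * ssum k F x)"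
proof (induction n rule: induct_nat_012)
  case 1 then show ?case using assms by simp
next
  case (ge2 n)
  have ssum_G: "ssum (Suc 0) G = (\<lambda>x. c * G x - F x)" using assms by (rule ext)
  have "ssum (Suc (Suc n)) G x = ssum (Suc n) (\<lambda>x. c * G x - F x) x - of_nat (branching n) * ssum n G x"
    unfolding ssum_recurrence ssum_G ..
  also have "\<dots> = c * ssum (Suc n) G x - ssum (Suc n) F x - of_nat (branching n) * ssum n G x"
    by (simp add: ssum_diff ssum_cmult)
  also have "\<dots> = sph_poly (Suc (Suc n)) c * G x - (ssum (Suc n) F x +
      c * (\<Sum>k<Suc n. cheb_poly (n - k) c * ssum k F x) -
      of_nat (branching n) * (\<Sum>k<n. cheb_poly (n - 1 - k) c * ssum k F x))"
    unfolding ge2.IH by (simp add: algebra_simps)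
  also have "of_nat (branching n) * (\<Sum>k<n. cheb_poly (n - 1 - k) c * ssum k F x) =
      of_nat q * (\<Sum>k<n. cheb_poly (n - 1 - k) c * ssum k F x)"
    by (cases n) (auto simp: branching_def)
  also have "ssum (Suc n) F x + c * (\<Sum>k<Suc n. cheb_poly (n - k) c * ssum k F x) -
      of_nat q * (\<Sum>k<n. cheb_poly (n - 1 - k) c * ssum k F x) =
      ssum (Suc n) F x + c * ssum n F x + (\<Sum>k<n. cheb_poly (Suc n - k) c * ssum k F x)"
  proof -
    have "(\<Sum>k<n. cheb_poly (Suc n - k) c * ssum k F x) =
        (\<Sum>k<n. c * (cheb_poly (n - k) c * ssum k F x) - of_nat q * (cheb_poly (n - 1 - k) c * ssum k F x))"
    proof (intro sum.cong refl)
      fix k assume "k \<in> {..<n}"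
      then have *: "Suc n - k = Suc (Suc (n - 1 - k))" "n - k = Suc (n - 1 - k)" by auto
      show "cheb_poly (Suc n - k) c * ssum k F x =
        c * (cheb_poly (n - k) c * ssum k F x) - of_nat q * (cheb_poly (n - 1 - k) c * ssum k F x)"
        unfolding *(1) unfolding * by (simp add: algebra_simps)
    qed
    then show ?thesis by (simp add: sum_subtractf sum_distrib_left algebra_simps)
  qed
  finally show ?case by (simp add: algebra_simps)
qed simp

lemma ssum_eigenfunction:
  assumes "\<And>x. ssum (Suc 0) G x = c * G x"
  shows "ssum n G x = sph_poly n c * G x"
  using ssum_perturbed_eigenfunction[of G c "\<lambda>_. 0" n x] assms by (simp add: ssum_def)

lemma sph_poly_cheb: "sph_poly (Suc (Suc n)) c = cheb_poly (Suc (Suc n)) c - cheb_poly n c"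
proof (induction n rule: induct_nat_012)
  case (ge2 n)
  have "sph_poly (Suc (Suc (Suc (Suc n)))) c =
      c * sph_poly (Suc (Suc (Suc n))) c - of_nat q * sph_poly (Suc (Suc n)) c"
    by (simp add: branching_def)
  also have "\<dots> = c * (cheb_poly (Suc (Suc (Suc n))) c - cheb_poly (Suc n) c) -
      of_nat q * (cheb_poly (Suc (Suc n)) c - cheb_poly n c)"
    by (simp only: ge2.IH)
  also have "\<dots> = cheb_poly (Suc (Suc (Suc (Suc n)))) c - cheb_poly (Suc (Suc n)) c"
    by (simp add: algebra_simps)
  finally show ?case .
qed (auto simp: branching_def algebra_simps)

text \<open>The eigenvalue of the sum over neighbours in the uniformising parameter \<open>t\<close>: the powers
  of \<open>t\<close> and \<open>1/t\<close> solve the recurrence of the spherical sums with this value.\<close>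

definition joukowski :: "'b \<Rightarrow> 'b::real_normed_field" where
  "joukowski t = of_real (sqrt q) * (t + inverse t)"

lemma cheb_poly_joukowski:
  assumes "t \<noteq> 0"
  shows "cheb_poly n (joukowski t) = of_real (sqrt q) ^ n * (\<Sum>j\<le>n. t ^ j * inverse t ^ (n - j))"
proof (induction n rule: induct_nat_012)
  case 1 then show ?case by (simp add: joukowski_def algebra_simps)
next
  case (ge2 n)
  define U where "U = (\<lambda>n. \<Sum>j\<le>n. t ^ j * inverse t ^ (n - j))"
  have shift: "U (Suc n) = inverse t * U n + t ^ Suc n" for n
  proof -
    have "(\<Sum>j\<le>n. t ^ j * inverse t ^ (Suc n - j)) = inverse t * U n"
      unfolding U_def sum_distrib_left by (intro sum.cong refl) (simp add: Suc_diff_le mult_ac)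
    then show ?thesis by (simp add: U_def)
  qed
  have sq: "of_real (sqrt q) ^ 2 = (of_nat q :: 'b)"
    by (simp flip: of_real_power)
  have rec: "U (Suc (Suc n)) = (t + inverse t) * U (Suc n) - U n"
    unfolding shift[of "Suc n"] shift[of n] using assms by (simp add: field_simps)
  have "of_real (sqrt q) ^ (Suc (Suc n)) * U (Suc (Suc n)) =
      joukowski t * (of_real (sqrt q) ^ Suc n * U (Suc n)) -
      of_real (sqrt q) ^ 2 * (of_real (sqrt q) ^ n * U n)"
    unfolding rec joukowski_def by (simp add: algebra_simps power2_eq_square)
  then show ?case unfolding sq cheb_poly.simps ge2.IH by (simp add: U_def)
qed simp

lemma norm_cheb_poly_le:
  assumes "t \<noteq> 0" "norm t \<le> B" "norm (inverse t) \<le> B"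
  shows "norm (cheb_poly n (joukowski t)) \<le> (real n + 1) * (sqrt q * B) ^ n"
proof -
  have B: "0 \<le> B" using assms(2) norm_ge_zero order_trans by blast
  have "norm (\<Sum>j\<le>n. t ^ j * inverse t ^ (n - j)) \<le> (\<Sum>j\<le>n. B ^ n)"
  proof (rule sum_norm_le)
    fix j assume "j \<in> {..n}"
    then have "B ^ n = B ^ j * B ^ (n - j)" by (simp flip: power_add)
    moreover have "norm (t ^ j) \<le> B ^ j" "norm (inverse t ^ (n - j)) \<le> B ^ (n - j)"
      unfolding norm_power using assms by (auto intro: power_mono)
    ultimately show "norm (t ^ j * inverse t ^ (n - j)) \<le> B ^ n"
      unfolding norm_mult using B by (metis mult_mono norm_ge_zero zero_le_power)
  qed
  then have "norm (\<Sum>j\<le>n. t ^ j * inverse t ^ (n - j)) \<le> (real n + 1) * B ^ n" by (simp add: add.commute)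
  from mult_left_mono[OF this, of "sqrt q ^ n"] show ?thesis
    unfolding cheb_poly_joukowski[OF assms(1)] norm_mult norm_power
    by (simp add: power_mult_distrib mult_ac)
qed

lemma cheb_poly_joukowski_nonneg:
  "0 < t \<Longrightarrow> 0 \<le> cheb_poly n (joukowski (t::real))"
  by (auto simp: cheb_poly_joukowski intro!: sum_nonneg mult_nonneg_nonneg)

lemma norm_sph_poly_le:
  assumes "t \<noteq> 0" "norm t \<le> B" "norm (inverse t) \<le> B"
  shows "norm (sph_poly n (joukowski t)) \<le> 2 * (real n + 1) * (sqrt q * B) ^ n"
proof -
  have "1 = norm t * norm (inverse t)" using assms(1) by (simp flip: norm_mult)
  also have "\<dots> \<le> B * B" using assms by (intro mult_mono) (auto intro: order_trans[OF norm_ge_zero])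
  finally have "1 \<le> B ^ 2" by (simp add: power2_eq_square)
  moreover have "0 \<le> B" using assms(2) norm_ge_zero order_trans by blast
  ultimately have "1 \<le> B" using power2_le_imp_le[of 1 B] by simp
  then have qB: "1 \<le> sqrt q * B" using mult_mono[of 1 "sqrt q" 1 B] q_ge_2 by simp
  note U = norm_cheb_poly_le[OF assms]
  consider "n = 0" | "n = 1" | m where "n = Suc (Suc m)" by (metis One_nat_def not0_implies_Suc)
  then show ?thesis
  proof cases
    case 2 then show ?thesis using U[of 1] qB by simp
  next
    case 3
    have "norm (cheb_poly m (joukowski t)) \<le> (real m + 1) * (sqrt q * B) ^ m" by (rule U)
    also have "\<dots> \<le> (real n + 1) * (sqrt q * B) ^ n"
      using qB 3 by (intro mult_mono power_increasing) auto
    finally show ?thesis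
      using U[of n] norm_triangle_ineq4[of "cheb_poly n (joukowski t)" "cheb_poly m (joukowski t)"]
      unfolding 3 sph_poly_cheb by linarith
  qed auto
qed

end

section \<open>Contour integrals and the resolvent of the Laplacian\<close>

definition annulus :: "real \<Rightarrow> real \<Rightarrow> complex set" where
  "annulus s S = {t. s < norm t \<and> norm t < S}"

lemma annulus_eq: "annulus s S = {t. s < norm (t - 0) \<and> norm (t - 0) < S}"
  by (simp add: annulus_def)

lemma open_annulus [simp]: "open (annulus s S)"
  unfolding annulus_def by (intro open_Collect_conj open_Collect_less continuous_intros)

lemma connected_annulus0: "connected (annulus s S)"
  unfolding annulus_eq by (intro connected_annulus) simp

lemma contour_integral_circlepath_shift:
  assumes "G holomorphic_on annulus s S" "0 < r1" "0 < r2"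
    and r: "s < r1" "r1 < S" "s < r2" "r2 < S"
  shows "contour_integral (circlepath 0 r1) G = contour_integral (circlepath 0 r2) G"
proof (rule Cauchy_theorem_homotopic_loops[OF _ open_annulus assms(1)])
  show "homotopic_loops (annulus s S) (circlepath 0 r1) (circlepath 0 r2)"
  proof (rule homotopic_loops_linear)
    fix t :: real
    show "closed_segment (circlepath 0 r1 t) (circlepath 0 r2 t) \<subseteq> annulus s S"
    proof
      fix z assume "z \<in> closed_segment (circlepath 0 r1 t) (circlepath 0 r2 t)"
      then obtain u where u: "0 \<le> u" "u \<le> 1"
        "z = (1 - u) *\<^sub>R circlepath 0 r1 t + u *\<^sub>R circlepath 0 r2 t"
        by (auto simp: closed_segment_def)
      define c where "c = (1 - u) * r1 + u * r2"
      have "z = of_real c * exp (2 * of_real pi * \<i> * of_real t)"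
        using u(3) by (simp add: circlepath c_def scaleR_conv_of_real algebra_simps)
      then have "norm z = \<bar>c\<bar>" by (simp add: norm_mult norm_exp_eq_Re)
      moreover have "c \<ge> min r1 r2" "c \<le> max r1 r2"
      proof -
        have "(1 - u) * min r1 r2 + u * min r1 r2 \<le> c" "c \<le> (1 - u) * max r1 r2 + u * max r1 r2"
          unfolding c_def using u by (intro add_mono mult_left_mono; simp)+
        then show "c \<ge> min r1 r2" "c \<le> max r1 r2" by (simp_all add: algebra_simps)
      qed
      ultimately show "z \<in> annulus s S" using assms by (auto simp: annulus_def)
    qed
  qed auto
qed auto

lemma contour_integral_suminf_circlepath:
  assumes "\<And>n t. norm t = r \<Longrightarrow> norm (g n t) \<le> M n" "summable M" "0 < r"
    and cont: "\<And>n. continuous_on (path_image (circlepath 0 r)) (g n)"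
  shows "(\<lambda>n. contour_integral (circlepath 0 r) (g n)) sums
    contour_integral (circlepath 0 r) (\<lambda>t. \<Sum>n. g n t)"
proof -
  have "uniform_limit (sphere 0 r) (\<lambda>n t. \<Sum>i<n. g i t) (\<lambda>t. \<Sum>n. g n t) sequentially"
    using assms(1) by (intro Weierstrass_m_test[OF _ assms(2)]) auto
  moreover have int: "g n contour_integrable_on circlepath 0 r" for n
    using cont by (rule contour_integrable_continuous_circlepath)
  ultimately have "(\<lambda>n. contour_integral (circlepath 0 r) (\<lambda>t. \<Sum>i<n. g i t)) \<longlonglongrightarrow>
    contour_integral (circlepath 0 r) (\<lambda>t. \<Sum>n. g n t)"
    using assms(3) by (intro contour_integral_uniform_limit_circlepath)
      (auto intro!: always_eventually contour_integrable_sum)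
  then show ?thesis by (simp add: sums_def contour_integral_sum int)
qed

text \<open>The form \<open>(1 - t\<^sup>2) / t\<^sup>2 dt\<close> is the differential of \<open>-(t + 1/t)\<close>, hence invariant under
  \<open>t \<mapsto> 1/t\<close>. This substitution reverses the unit circle, so the integral equals its own negative.\<close>

lemma contour_integral_symmetric_eq_0:
  assumes "\<And>t. norm t = 1 \<Longrightarrow> H (inverse t) = H t"
  shows "contour_integral (circlepath 0 1) (\<lambda>t. H t * ((1 - t^2) / t^2)) = 0"
proof -
  let ?G = "\<lambda>t. H t * ((1 - t^2) / t^2)"
  let ?c = "circlepath 0 1"
  have rev: "reversepath ?c = part_circlepath 0 1 (2*pi) 0" by (simp add: circlepath_def)
  have "- contour_integral ?c ?G = contour_integral (reversepath ?c) ?G"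
    by (simp add: contour_integral_reversepath)
  also have "\<dots> = contour_integral ?c ?G"
    unfolding contour_integral_integral
  proof (rule integral_cong)
    fix x :: real
    define e where "e = exp (2 * of_real pi * \<i> * of_real x)"
    have e0: "e \<noteq> 0" and n: "norm e = 1" by (simp_all add: e_def norm_exp_eq_Re)
    have r: "reversepath ?c x = inverse e"
    proof -
      have "reversepath ?c x = exp (2 * of_real pi * \<i> - 2 * of_real pi * \<i> * of_real x)"
        by (simp add: reversepath_def circlepath algebra_simps)
      also have "\<dots> = inverse e" unfolding exp_diff e_def by (simp add: exp_minus field_simps)
      finally show ?thesis .
    qed
    have l: "linepath (2*pi) 0 x = 2 * pi * (1 - x)" by (simp add: linepath_def algebra_simps)
    have "vector_derivative (reversepath ?c) (at x) =
        - (2 * of_real pi * \<i> * exp (2 * of_real pi * \<i> - 2 * of_real pi * \<i> * of_real x))"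
      unfolding rev vector_derivative_part_circlepath l by (simp add: algebra_simps)
    also have "\<dots> = - (2 * of_real pi * \<i> * inverse e)"
      unfolding exp_diff e_def by (simp add: exp_minus field_simps)
    finally have v: "vector_derivative (reversepath ?c) (at x) = - (2 * of_real pi * \<i> * inverse e)" .
    have c: "?c x = e" "vector_derivative ?c (at x) = 2 * of_real pi * \<i> * e"
      by (simp add: circlepath e_def, subst vector_derivative_circlepath, simp add: e_def)
    show "?G (reversepath ?c x) * vector_derivative (reversepath ?c) (at x) =
        ?G (?c x) * vector_derivative ?c (at x)"
    proof -
      have "(1 - (inverse e)^2) / (inverse e)^2 * - inverse e = (1 - e^2) / e^2 * e"
        using e0 by (simp add: divide_simps) (simp add: power2_eq_square algebra_simps)
      then have "H e * (2 * of_real pi * \<i>) * ((1 - (inverse e)^2) / (inverse e)^2 * - inverse e) =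
        H e * (2 * of_real pi * \<i>) * ((1 - e^2) / e^2 * e)" by (rule arg_cong)
      then show ?thesis unfolding r v c assms[OF n] by (simp only: mult_ac mult_minus_right mult_minus_left)
    qed
  qed
  finally have eq: "- contour_integral ?c ?G = contour_integral ?c ?G" .
  have "contour_integral ?c ?G + contour_integral ?c ?G = 0"
    by (subst eq[symmetric]) (rule ab_left_minus)
  then show ?thesis by simp
qed

text \<open>The number \<open>R\<close> encodes the admissible growth of functions. In the application
  \<open>R = q\<^bsup>1/2 - 1/p\<^esup>\<close>, but the functional calculus needs only \<open>0 < R < 1\<close>.\<close>

locale growth = hom_tree +
  fixes R :: real
  assumes R_pos: "0 < R" and R_less_1: "R < 1"
begin

text \<open>The bound is uniform in the centre, so this class is stable under the Laplacian and
  all members of a bounded orbit share one constant.\<close>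

definition sphere_bound :: "real \<Rightarrow> ('a \<Rightarrow> 'b::real_normed_field) \<Rightarrow> bool" where
  "sphere_bound C f \<longleftrightarrow> (\<forall>x n. ssum n (\<lambda>y. norm (f y)) x \<le> C * (sqrt q / R) ^ n)"

definition tempered :: "('a \<Rightarrow> 'b::real_normed_field) \<Rightarrow> bool" where
  "tempered f \<longleftrightarrow> (\<exists>C. sphere_bound C f)"

lemma sqrt_q: "1 < sqrt q"
  using q_ge_2 by simp

lemma sphere_bound_nonneg: "sphere_bound C f \<Longrightarrow> 0 \<le> C"
proof -
  assume "sphere_bound C f"
  then have "norm (f undefined) \<le> C * (sqrt q / R) ^ 0"
    unfolding sphere_bound_def by (metis ssum_0)
  then have "norm (f undefined) \<le> C" by simp
  then show "0 \<le> C" by (rule order_trans[OF norm_ge_zero])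
qed

lemma ssum_mono: "(\<And>x. f x \<le> g x) \<Longrightarrow> ssum n f x \<le> (ssum n g x :: real)"
  unfolding ssum_def by (rule sum_mono)

lemma ssum_nonneg: "(\<And>x. 0 \<le> f x) \<Longrightarrow> 0 \<le> (ssum n f x :: real)"
  unfolding ssum_def by (rule sum_nonneg)

lemma norm_ssum_le: "norm (ssum n f x) \<le> ssum n (\<lambda>y. norm (f y)) x"
  unfolding ssum_def by (rule norm_sum)

lemma norm_ssum_bound:
  "sphere_bound C f \<Longrightarrow> norm (ssum n f x) \<le> C * (sqrt q / R) ^ n"
  unfolding sphere_bound_def by (rule order_trans[OF norm_ssum_le]) blast

lemma tempered_norm: "tempered f \<Longrightarrow> tempered (\<lambda>x. norm (f x))"
  unfolding tempered_def sphere_bound_def by simp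

lemma tempered_add:
  assumes "tempered f" "tempered g" shows "tempered (\<lambda>x. f x + g x)"
proof -
  obtain C D where C: "sphere_bound C f" "sphere_bound D g" using assms by (auto simp: tempered_def)
  have "ssum n (\<lambda>y. norm (f y + g y)) x \<le> (C + D) * (sqrt q / R) ^ n" for x n
  proof -
    have "ssum n (\<lambda>y. norm (f y + g y)) x \<le> ssum n (\<lambda>y. norm (f y) + norm (g y)) x"
      by (intro ssum_mono norm_triangle_ineq)
    moreover have "ssum n (\<lambda>y. norm (f y)) x \<le> C * (sqrt q / R) ^ n"
      "ssum n (\<lambda>y. norm (g y)) x \<le> D * (sqrt q / R) ^ n"
      using C by (auto simp: sphere_bound_def)
    ultimately show ?thesis unfolding ssum_add distrib_right by linarith
  qed
  then show ?thesis unfolding tempered_def sphere_bound_def by blast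
qed

lemma tempered_cmult:
  assumes "tempered f" shows "tempered (\<lambda>x. c * f x)"
proof -
  obtain C where C: "sphere_bound C f" using assms by (auto simp: tempered_def)
  have "ssum n (\<lambda>y. norm (c * f y)) x \<le> (norm c * C) * (sqrt q / R) ^ n" for x n
    using C unfolding sphere_bound_def norm_mult ssum_cmult by (simp add: mult.assoc mult_left_mono)
  then show ?thesis unfolding tempered_def sphere_bound_def by blast
qed

lemma tempered_diff:
  "tempered f \<Longrightarrow> tempered g \<Longrightarrow> tempered (\<lambda>x. f x - g x)"
  using tempered_add[of f "\<lambda>x. (-1) * g x"] tempered_cmult[of g "-1"] by simp

lemma tempered_ssum_1:
  assumes "tempered f" shows "tempered (ssum (Suc 0) f)"
proof -
  obtain C where C: "sphere_bound C f" using assms by (auto simp: tempered_def)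
  have "ssum n (\<lambda>y. norm (ssum (Suc 0) f y)) x \<le> (real (q + 1) * C) * (sqrt q / R) ^ n" for x n
  proof -
    have "ssum n (\<lambda>y. norm (ssum (Suc 0) f y)) x \<le> ssum n (ssum (Suc 0) (\<lambda>y. norm (f y))) x"
      by (intro ssum_mono norm_ssum_le)
    also have "\<dots> = ssum (Suc 0) (ssum n (\<lambda>y. norm (f y))) x" by (simp add: ssum_commute)
    also have "\<dots> \<le> ssum (Suc 0) (\<lambda>_. C * (sqrt q / R) ^ n) x"
      using C by (intro ssum_mono) (simp add: sphere_bound_def)
    also have "\<dots> = (real (q + 1) * C) * (sqrt q / R) ^ n"
      by (simp add: ssum_1 card_nbrs)
    finally show ?thesis .
  qed
  then show ?thesis unfolding tempered_def sphere_bound_def by blast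
qed

lemma tempered_ssum:
  assumes "tempered f" shows "tempered (ssum n f)"
  using assms
proof (induction n arbitrary: f rule: induct_nat_012)
  case (ge2 n)
  then show ?case
    unfolding ssum_recurrence[abs_def] by (intro tempered_diff tempered_cmult ge2.IH tempered_ssum_1)
qed (auto simp: tempered_ssum_1)

text \<open>The factor \<open>1/\<surd>q\<close> normalises \<open>t\<close> in such a way that tempered functions have radius of
  convergence at least \<open>R\<close> and the resolvent equation holds at \<open>joukowski t\<close>.\<close>

definition green :: "('a \<Rightarrow> 'b::{real_normed_field,banach}) \<Rightarrow> 'a \<Rightarrow> 'b \<Rightarrow> 'b" where
  "green f x t = (\<Sum>n. ssum n f x * (t / of_real (sqrt q)) ^ n)"

lemma norm_green_term:
  assumes "sphere_bound C f"
  shows "norm (ssum n f x * (t / of_real (sqrt q)) ^ n) \<le> C * (norm t / R) ^ n"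
proof -
  have "norm (ssum n f x * (t / of_real (sqrt q)) ^ n) \<le> C * (sqrt q / R) ^ n * (norm t / sqrt q) ^ n"
    unfolding norm_mult norm_power norm_divide
    using norm_ssum_bound[OF assms, of n x] q_ge_2 by (simp add: mult_right_mono)
  also have "\<dots> = C * (norm t / R) ^ n"
    using sqrt_q by (simp add: power_divide)
  finally show ?thesis .
qed

lemma summable_geom_R: "norm t < R \<Longrightarrow> summable (\<lambda>n. C * (norm t / R) ^ n)"
  using R_pos by (intro summable_mult summable_geometric) (simp add: divide_less_eq)

lemma summable_norm_green:
  assumes "tempered f" "norm t < R"
  shows "summable (\<lambda>n. norm (ssum n f x * (t / of_real (sqrt q)) ^ n))"
proof -
  obtain C where "sphere_bound C f" using assms by (auto simp: tempered_def)
  from norm_green_term[OF this] show ?thesis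
    by (intro summable_comparison_test'[OF summable_geom_R[OF assms(2)], of 0]) auto
qed

lemma green_sums:
  assumes "tempered f" "norm t < R"
  shows "(\<lambda>n. ssum n f x * (t / of_real (sqrt q)) ^ n) sums green f x t"
  unfolding green_def using summable_norm_cancel[OF summable_norm_green[OF assms]]
  by (rule summable_sums)

lemma norm_green_le:
  assumes "sphere_bound C f" "norm t < R"
  shows "norm (green f x t) \<le> C / (1 - norm t / R)"
proof -
  have "(\<lambda>n. C * (norm t / R) ^ n) sums (C * (1 / (1 - norm t / R)))"
    using assms(2) R_pos by (intro sums_mult geometric_sums) (simp add: divide_less_eq)
  then have "suminf (\<lambda>n. C * (norm t / R) ^ n) = C / (1 - norm t / R)" by (simp add: sums_iff)
  moreover have "norm (green f x t) \<le> suminf (\<lambda>n. C * (norm t / R) ^ n)"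
    unfolding green_def
    by (rule norm_suminf_le[OF norm_green_term[OF assms(1)] summable_geom_R[OF assms(2)]])
  ultimately show ?thesis by simp
qed

lemma green_add:
  assumes "tempered f" "tempered g" "norm t < R"
  shows "green (\<lambda>x. f x + g x) x t = green f x t + green g x t"
  using sums_add[OF green_sums[OF assms(1,3), of x] green_sums[OF assms(2,3), of x]]
  unfolding green_def[of "\<lambda>x. f x + g x"] ssum_add by (simp add: sums_iff distrib_right)

lemma green_cmult:
  assumes "tempered f" "norm t < R"
  shows "green (\<lambda>x. c * f x) x t = c * green f x t"
  using sums_mult[OF green_sums[OF assms, of x], of c]
  unfolding green_def[of "\<lambda>x. c * f x"] ssum_cmult by (simp add: sums_iff mult.assoc)

lemma ssum_green:
  assumes "tempered f" "norm t < R"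
  shows "ssum m (\<lambda>y. green f y t) x = green (ssum m f) x t"
    and "(\<lambda>n. ssum m (ssum n f) x * (t / of_real (sqrt q)) ^ n) sums green (ssum m f) x t"
proof -
  have swap: "ssum n (ssum m f) = ssum m (ssum n f)" for n
    by (rule ssum_ssum_commute)
  have "(\<lambda>n. \<Sum>y\<in>tsphere x m. ssum n f y * (t / of_real (sqrt q)) ^ n) sums (\<Sum>y\<in>tsphere x m. green f y t)"
    using green_sums[OF assms] by (intro sums_sum)
  then have *: "(\<lambda>n. ssum m (ssum n f) x * (t / of_real (sqrt q)) ^ n) sums ssum m (\<lambda>y. green f y t) x"
    unfolding ssum_def[of m] sum_distrib_right .
  show "ssum m (\<lambda>y. green f y t) x = green (ssum m f) x t"
    using * unfolding green_def[of "ssum m f"] swap by (simp add: sums_iff)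
  with * show "(\<lambda>n. ssum m (ssum n f) x * (t / of_real (sqrt q)) ^ n) sums green (ssum m f) x t" by simp
qed

lemma green_0 [simp]: "green f x 0 = f x"
  unfolding green_def using powser_zero[of "\<lambda>n. ssum n f x"] by simp

text \<open>The inner spherical sums telescope by their three-term recurrence. So \<open>green f x t\<close> is, up to a
  factor, the value at \<open>x\<close> of the resolvent at \<open>joukowski t\<close> of the sum over neighbours.\<close>

lemma green_resolvent:
  assumes f: "tempered f" and t: "norm t < R" "t \<noteq> 0"
  shows "green (ssum (Suc 0) f) x t =
    joukowski t * green f x t - of_real (sqrt q) / t * (1 - t^2 / of_nat q) * f x"
proof -
  define u where "u = t / of_real (sqrt q)"
  define a where "a n = ssum n f x" for n
  have sq: "of_real (sqrt q) ^ 2 = (of_nat q :: 'b)" by (simp flip: of_real_power)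
  have q0: "of_real (sqrt q) \<noteq> (0 :: 'b)" using q_ge_2 by simp
  have u0: "u \<noteq> 0" using t q0 by (simp add: u_def)
  have G: "(\<lambda>n. a n * u ^ n) sums green f x t"
    using green_sums[OF f t(1)] by (simp add: u_def a_def)
  have G1: "(\<lambda>n. a (Suc n) * u ^ Suc n) sums (green f x t - f x)"
    using G sums_Suc_iff[of "\<lambda>n. a n * u ^ n" "green f x t - f x"] by (simp add: a_def)
  have G2: "(\<lambda>n. a (Suc (Suc n)) * u ^ Suc (Suc n)) sums (green f x t - f x - a 1 * u)"
    using G1 sums_Suc_iff[of "\<lambda>n. a (Suc n) * u ^ Suc n" "green f x t - f x - a 1 * u"] by simp
  let ?b = "\<lambda>n. ssum n (ssum (Suc 0) f) x * u ^ n"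
  have b_Suc: "?b (Suc n) = inverse u * (a (Suc (Suc n)) * u ^ Suc (Suc n)) + of_nat q * u * (a n * u ^ n)
      + (if n = 0 then u * f x else 0)" for n
  proof -
    have "inverse u * (a (Suc (Suc n)) * u ^ Suc (Suc n)) = a (Suc (Suc n)) * u ^ Suc n"
      using u0 by simp
    moreover have "inverse u * u = 1" using u0 by simp
    ultimately show ?thesis
      unfolding ssum_Suc_ssum_1 by (simp add: branching_def a_def distrib_right)
  qed
  have "(\<lambda>n. ?b (Suc n)) sums (inverse u * (green f x t - f x - a 1 * u) + of_nat q * u * green f x t + u * f x)"
    unfolding b_Suc by (intro sums_add sums_mult G G2 sums_single)
  then have "?b sums (inverse u * (green f x t - f x - a 1 * u) + of_nat q * u * green f x t + u * f x + a 1)"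
    using sums_Suc_iff[of ?b "inverse u * (green f x t - f x - a 1 * u) + of_nat q * u * green f x t + u * f x"]
    by (simp add: a_def)
  then have "green (ssum (Suc 0) f) x t =
      inverse u * (green f x t - f x - a 1 * u) + of_nat q * u * green f x t + u * f x + a 1"
    unfolding green_def[of "ssum (Suc 0) f"] u_def[symmetric] by (simp add: sums_iff)
  also have "\<dots> = (inverse u + of_nat q * u) * green f x t - (inverse u - u) * f x"
    using u0 by (simp add: field_simps)
  also have "inverse u + of_nat q * u = joukowski t"
    unfolding sq[symmetric] joukowski_def u_def using q0 t by (simp add: field_simps power2_eq_square)
  also have "inverse u - u = of_real (sqrt q) / t * (1 - t^2 / of_nat q)"
    unfolding sq[symmetric] u_def using q0 t by (simp add: field_simps power2_eq_square)
  finally show ?thesis .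
qed

text \<open>For nonnegative \<open>f\<close> the function \<open>y \<mapsto> green f y r\<close> is a supersolution by the resolvent
  equation, and the correction terms have one sign because the Chebyshev polynomials are
  nonnegative at \<open>joukowski r\<close>.\<close>

lemma green_ssum_le:
  fixes f :: "'a \<Rightarrow> real"
  assumes f: "tempered f" "\<And>x. 0 \<le> f x" and r: "0 < r" "r < R"
  shows "green (ssum n f) x r \<le> sph_poly n (joukowski r) * green f x r"
proof -
  define c where "c = sqrt q / r * (1 - r^2 / q)"
  have "r ^ 2 \<le> 1" using r R_less_1 by (simp add: power_le_one)
  then have c: "0 \<le> c" unfolding c_def using r q_ge_2 by (intro mult_nonneg_nonneg) (auto simp: field_simps)
  have "ssum n (\<lambda>y. green f y r) x = sph_poly n (joukowski r) * green f x r -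
      (\<Sum>k<n. cheb_poly (n - 1 - k) (joukowski r) * ssum k (\<lambda>y. c * f y) x)"
    by (rule ssum_perturbed_eigenfunction)
      (use f r green_resolvent[of f r] in \<open>simp add: ssum_green c_def\<close>)
  moreover have "0 \<le> (\<Sum>k<n. cheb_poly (n - 1 - k) (joukowski r) * ssum k (\<lambda>y. c * f y) x)"
    using f c r by (intro sum_nonneg mult_nonneg_nonneg cheb_poly_joukowski_nonneg ssum_nonneg) auto
  ultimately show ?thesis using f r by (simp add: ssum_green)
qed

lemma holomorphic_green:
  assumes "tempered f" shows "green f x holomorphic_on ball 0 R"
proof (rule power_series_holomorphic)
  fix w :: complex assume "w \<in> ball 0 R"
  then show "(\<lambda>n. (ssum n f x / of_real (sqrt q) ^ n) * (w - 0) ^ n) sums green f x w"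
    using green_sums[OF assms, of w x] by (simp add: power_divide)
qed

end

section \<open>A functional calculus by contour integrals\<close>

text \<open>Fubini's theorem for iterated series of vectors; the double sum is an integral with respect
  to the counting measure.\<close>

lemma suminf_swap_abs:
  fixes a :: "nat \<Rightarrow> nat \<Rightarrow> 'a::banach"
  assumes a: "\<And>n. summable (\<lambda>m. norm (a n m))" "summable (\<lambda>n. \<Sum>m. norm (a n m))"
  shows "(\<Sum>n. \<Sum>m. a n m) = (\<Sum>m. \<Sum>n. a n m)"
proof -
  have eq: "infsum f UNIV = suminf f" if "summable (\<lambda>n. norm (f n))" for f :: "nat \<Rightarrow> 'a"
    using norm_summable_imp_has_sum[OF that summable_sums[OF summable_norm_cancel[OF that]]]
    by (rule infsumI)
  have le: "norm (a n m) \<le> (\<Sum>m. norm (a n m))" for n m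
    using sum_le_suminf[OF a(1), of "{m}" n] by simp
  have abs: "(\<lambda>(n, m). norm (a n m)) summable_on UNIV \<times> UNIV"
  proof (rule summable_on_SigmaI)
    fix n :: nat
    have "((\<lambda>m. norm (a n m)) has_sum (\<Sum>m. norm (a n m))) UNIV"
      using a(1)[of n] by (intro norm_summable_imp_has_sum) (auto intro: summable_sums)
    then show "((\<lambda>m. case (n, m) of (n, m) \<Rightarrow> norm (a n m)) has_sum (\<Sum>m. norm (a n m))) UNIV" by simp
  next
    show "(\<lambda>n. \<Sum>m. norm (a n m)) summable_on UNIV"
      using a(2) by (subst summable_on_UNIV_nonneg_real_iff) (simp_all add: suminf_nonneg a(1))
  next
    fix n m :: nat
    show "0 \<le> (case (n, m) of (n, m) \<Rightarrow> norm (a n m))" by simp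
  qed
  then have sm: "(\<lambda>(n, m). a n m) summable_on UNIV \<times> UNIV"
    using abs_summable_summable[of "\<lambda>(n, m). a n m"] by (simp add: case_prod_unfold)
  have col: "summable (\<lambda>n. norm (a n m))" for m
    by (rule summable_comparison_test'[OF a(2), of 0]) (simp add: le)
  have "(\<Sum>n. \<Sum>m. a n m) = infsum (\<lambda>n. infsum (\<lambda>m. a n m) UNIV) UNIV"
  proof -
    have "summable (\<lambda>n. norm (\<Sum>m. a n m))"
      by (rule summable_comparison_test'[OF a(2), of 0]) (simp add: summable_norm a(1))
    then show ?thesis by (simp add: eq a(1))
  qed
  also have "\<dots> = infsum (\<lambda>m. infsum (\<lambda>n. a n m) UNIV) UNIV"
    by (rule infsum_swap_banach[OF sm])
  also have "\<dots> = (\<Sum>m. \<Sum>n. a n m)"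
  proof -
    have "(\<lambda>(m, n). norm (a n m)) summable_on UNIV \<times> UNIV"
      using abs by (subst (asm) summable_on_swap) (simp add: case_prod_unfold)
    then have "(\<lambda>m. infsum (\<lambda>n. norm (a n m)) UNIV) summable_on UNIV"
      by (rule summable_on_Sigma_banach[where f = "\<lambda>m n. norm (a n m)", simplified])
    moreover have "infsum (\<lambda>n. norm (a n m)) UNIV = (\<Sum>n. norm (a n m))" for m
      by (intro infsumI norm_summable_imp_has_sum) (auto intro: summable_sums col)
    ultimately have "summable (\<lambda>m. \<Sum>n. norm (a n m))" by (simp add: summable_on_imp_summable)
    then have "summable (\<lambda>m. norm (\<Sum>n. a n m))"
      by (rule summable_comparison_test'[of _ 0]) (simp add: summable_norm col)
    then show ?thesis by (simp add: eq col)
  qed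
  finally show ?thesis .
qed

lemma summable_Suc_mult_power:
  fixes x :: real assumes "\<bar>x\<bar> < 1" shows "summable (\<lambda>n. (real n + 1) * x ^ n)"
  using geometric_deriv_sums[of x] assms by (simp add: sums_iff add.commute)

text \<open>These are the holomorphic functions of \<open>joukowski t\<close>, that is, of the spectral value.\<close>

definition symmetric_on_annulus :: "real \<Rightarrow> (complex \<Rightarrow> complex) \<Rightarrow> bool" where
  "symmetric_on_annulus s H \<longleftrightarrow> H holomorphic_on annulus s (1 / s) \<and>
     (\<forall>t\<in>annulus s (1 / s). H (inverse t) = H t)"

lemma symmetric_const: "symmetric_on_annulus s (\<lambda>_. c)"
  by (simp add: symmetric_on_annulus_def)

lemma symmetric_mult:
  "symmetric_on_annulus s H \<Longrightarrow> symmetric_on_annulus s K \<Longrightarrow> symmetric_on_annulus s (\<lambda>t. H t * K t)"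
  by (auto simp: symmetric_on_annulus_def intro!: holomorphic_intros)

lemma symmetric_add:
  "symmetric_on_annulus s H \<Longrightarrow> symmetric_on_annulus s K \<Longrightarrow> symmetric_on_annulus s (\<lambda>t. H t + K t)"
  by (auto simp: symmetric_on_annulus_def intro!: holomorphic_intros)

lemma symmetric_diff:
  "symmetric_on_annulus s H \<Longrightarrow> symmetric_on_annulus s K \<Longrightarrow> symmetric_on_annulus s (\<lambda>t. H t - K t)"
  by (auto simp: symmetric_on_annulus_def intro!: holomorphic_intros)

lemma symmetric_power:
  "symmetric_on_annulus s H \<Longrightarrow> symmetric_on_annulus s (\<lambda>t. H t ^ n)"
  by (auto simp: symmetric_on_annulus_def intro!: holomorphic_intros)

lemma zero_notin_annulus: "0 \<le> s \<Longrightarrow> 0 \<notin> annulus s S"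
  by (auto simp: annulus_def)

lemma annulus_below_1: "0 < s \<Longrightarrow> s < norm t \<Longrightarrow> norm t < 1 \<Longrightarrow> t \<in> annulus s (1 / s)"
  using less_trans[of "norm t" 1 "1 / s"] by (simp add: annulus_def)

context growth begin

lemma q_pos: "0 < q"
  using q_ge_2 by simp

lemma joukowski_inverse: "joukowski (inverse t) = joukowski t"
  by (simp add: joukowski_def)

lemma symmetric_joukowski: "0 \<le> s \<Longrightarrow> symmetric_on_annulus s joukowski"
  unfolding symmetric_on_annulus_def
  by (auto simp: joukowski_inverse) (auto simp: joukowski_def[abs_def] zero_notin_annulus intro!: holomorphic_intros)

lemma symmetric_sph_poly:
  assumes "0 \<le> s" shows "symmetric_on_annulus s (\<lambda>t. sph_poly n (joukowski t))"
  by (induction n rule: induct_nat_012)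
    (auto intro!: symmetric_const symmetric_joukowski symmetric_diff symmetric_mult assms)

text \<open>This factor turns the geometric generating function into the resolvent: it cancels the
  inhomogeneity \<open>1 - t\<^sup>2/q\<close> in the resolvent equation and contributes the differential
  of \<open>joukowski t\<close>. On the unit circle it is, up to symmetrisation, the Plancherel density of the tree.\<close>

definition weight :: "complex \<Rightarrow> complex" where
  "weight t = (1 - t^2) / ((1 - t^2 / of_nat q) * t)"

lemma square_ne_q:
  assumes "norm t < sqrt q" shows "t^2 \<noteq> (of_nat q :: complex)"
proof
  assume "t^2 = of_nat q"
  then have "norm t ^ 2 = q" by (metis norm_of_nat norm_power)
  moreover have "norm t ^ 2 < sqrt q ^ 2" using assms by (intro power_strict_mono) auto
  ultimately show False by simp
qed

lemma holomorphic_weight: "weight holomorphic_on annulus 0 (sqrt q)"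
  unfolding weight_def[abs_def]
  by (intro holomorphic_intros) (use square_ne_q q_pos in \<open>auto simp: annulus_def\<close>)

lemma path_image_circle: "0 \<le> r \<Longrightarrow> path_image (circlepath 0 r) = {t. norm t = r}"
  by (auto simp: path_image_circlepath)

lemma continuous_on_weight: "0 < r \<Longrightarrow> r < sqrt q \<Longrightarrow> continuous_on {t. norm t = r} weight"
  by (rule continuous_on_subset[OF holomorphic_on_imp_continuous_on[OF holomorphic_weight]])
    (auto simp: annulus_def)

lemma R_less_sqrt_q: "R < sqrt q"
  using R_less_1 sqrt_q by linarith

lemma continuous_on_green: "tempered f \<Longrightarrow> r < R \<Longrightarrow> continuous_on {t. norm t = r} (green f x :: complex \<Rightarrow> complex)"
  by (rule continuous_on_subset[OF holomorphic_on_imp_continuous_on[OF holomorphic_green]]) auto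

lemma continuous_on_symmetric:
  "symmetric_on_annulus s H \<Longrightarrow> s < r \<Longrightarrow> r < 1 \<Longrightarrow> 0 < s \<Longrightarrow> continuous_on {t. norm t = r} H"
  unfolding symmetric_on_annulus_def
  by (rule continuous_on_subset[OF holomorphic_on_imp_continuous_on]) (auto intro: annulus_below_1)

text \<open>The Cauchy integral of the holomorphic functional calculus, written in the parameter \<open>t\<close>.\<close>

definition cauchy :: "(complex \<Rightarrow> complex) \<Rightarrow> ('a \<Rightarrow> complex) \<Rightarrow> 'a \<Rightarrow> real \<Rightarrow> complex" where
  "cauchy H f x r =
     contour_integral (circlepath 0 r) (\<lambda>t. H t * weight t * green f x t) / (2 * of_real pi * \<i>)"

lemma contour_integral_symmetric:
  assumes "symmetric_on_annulus s H" "0 < s" "s < r" "r < 1"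
  shows "contour_integral (circlepath 0 r) (\<lambda>t. H t * ((1 - t^2) / t^2)) = 0"
proof -
  have s: "s < 1" "1 < 1 / s" using assms by auto
  then have s': "r < 1 / s" using assms by linarith
  have "contour_integral (circlepath 0 r) (\<lambda>t. H t * ((1 - t^2) / t^2)) =
      contour_integral (circlepath 0 1) (\<lambda>t. H t * ((1 - t^2) / t^2))"
    using assms s s'
    by (intro contour_integral_circlepath_shift[of _ s "1 / s"])
      (auto simp: symmetric_on_annulus_def zero_notin_annulus intro!: holomorphic_intros)
  also have "\<dots> = 0"
    using assms s by (intro contour_integral_symmetric_eq_0) (auto simp: symmetric_on_annulus_def annulus_def)
  finally show ?thesis .
qed

context
  fixes s r :: real
  assumes sr: "0 < s" "s < r" "r < R"
begin

lemma r_less: "0 < r" "r < 1" "r < sqrt q"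
  using sr R_less_1 R_less_sqrt_q by auto

lemma continuous_cauchy:
  assumes "symmetric_on_annulus s H" "tempered f"
  shows "continuous_on {t. norm t = r} (\<lambda>t. H t * weight t * green f x t)"
  using assms sr r_less
  by (intro continuous_intros continuous_on_weight continuous_on_green continuous_on_symmetric[of s])

lemma integrable_cauchy:
  assumes "symmetric_on_annulus s H" "tempered f"
  shows "(\<lambda>t. H t * weight t * green f x t) contour_integrable_on (circlepath 0 r)"
  using continuous_cauchy[OF assms] r_less
  by (intro contour_integrable_continuous_circlepath) (simp only: path_image_circle less_imp_le)

lemma cauchy_diff_cmult:
  assumes "symmetric_on_annulus s H" "tempered f" "tempered g"
  shows "cauchy H (\<lambda>x. f x - c * g x) x r = cauchy H f x r - c * cauchy H g x r"
proof -
  have d: "green (\<lambda>x. f x - c * g x) x t = green f x t - c * green g x t" if "norm t < R" for t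
    using green_add[OF assms(2) tempered_cmult[OF assms(3), of "-c"] that]
      green_cmult[OF assms(3) that, of "-c"] by simp
  have "cauchy H (\<lambda>x. f x - c * g x) x r = contour_integral (circlepath 0 r)
    (\<lambda>t. H t * weight t * green f x t - c * (H t * weight t * green g x t)) / (2 * of_real pi * \<i>)"
    unfolding cauchy_def
    using sr r_less
    by (intro arg_cong2[where f = divide] refl contour_integral_cong) (auto simp: d algebra_simps)
  then show ?thesis
    using assms by (simp add: contour_integral_diff contour_integral_lmul contour_integrable_lmul integrable_cauchy cauchy_def diff_divide_distrib)
qed

lemma cauchy_symbol_diff_cmult:
  assumes "symmetric_on_annulus s H" "symmetric_on_annulus s K" "tempered f"
  shows "cauchy (\<lambda>t. H t - c * K t) f x r = cauchy H f x r - c * cauchy K f x r"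
proof -
  have "cauchy (\<lambda>t. H t - c * K t) f x r = contour_integral (circlepath 0 r)
    (\<lambda>t. H t * weight t * green f x t - c * (K t * weight t * green f x t)) / (2 * of_real pi * \<i>)"
    unfolding cauchy_def
    by (intro arg_cong2[where f = divide] refl contour_integral_cong) (auto simp: algebra_simps)
  then show ?thesis
    using assms by (simp add: contour_integral_diff contour_integral_lmul contour_integrable_lmul integrable_cauchy cauchy_def diff_divide_distrib)
qed

text \<open>Inserting the resolvent equation leaves an error with integrand \<open>H t (1 - t\<^sup>2) / t\<^sup>2\<close>, which
  no longer involves \<open>green\<close>; the contour can therefore be moved to the unit circle,
  where the integral vanishes by symmetry.\<close>

lemma cauchy_ssum_1:
  assumes H: "symmetric_on_annulus s H" and f: "tempered f"
  shows "cauchy H (ssum (Suc 0) f) x r = cauchy (\<lambda>t. joukowski t * H t) f x r"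
proof -
  let ?C = "contour_integral (circlepath 0 r)"
  have "?C (\<lambda>t. H t * weight t * green (ssum (Suc 0) f) x t) =
      ?C (\<lambda>t. joukowski t * H t * weight t * green f x t - of_real (sqrt q) * f x * (H t * ((1 - t^2) / t^2)))"
  proof (rule contour_integral_cong[OF refl])
    fix t assume "t \<in> path_image (circlepath 0 r)"
    then have t: "norm t = r" "norm t < R" "t \<noteq> 0" "norm t < sqrt q"
      using sr r_less by (auto simp: path_image_circle)
    have w: "weight t * (of_real (sqrt q) / t * (1 - t^2 / of_nat q)) = of_real (sqrt q) * ((1 - t^2) / t^2)"
      using t square_ne_q[OF t(4)] q_pos by (simp add: weight_def power2_eq_square)
    have "H t * weight t * green (ssum (Suc 0) f) x t = joukowski t * H t * weight t * green f x t -
      H t * f x * (weight t * (of_real (sqrt q) / t * (1 - t^2 / of_nat q)))"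
      unfolding green_resolvent[OF f t(2,3)] by (simp only: algebra_simps)
    then show "H t * weight t * green (ssum (Suc 0) f) x t =
      joukowski t * H t * weight t * green f x t - of_real (sqrt q) * f x * (H t * ((1 - t^2) / t^2))"
      unfolding w by (simp only: mult_ac)
  qed
  also have "\<dots> = ?C (\<lambda>t. joukowski t * H t * weight t * green f x t) -
      of_real (sqrt q) * f x * ?C (\<lambda>t. H t * ((1 - t^2) / t^2))"
  proof -
    have i: "(\<lambda>t. H t * ((1 - t^2) / t^2)) contour_integrable_on (circlepath 0 r)"
    proof (rule contour_integrable_continuous_circlepath)
      show "continuous_on (path_image (circlepath 0 r)) (\<lambda>t. H t * ((1 - t^2) / t^2))"
        unfolding path_image_circle[OF less_imp_le[OF r_less(1)]]
        using r_less sr H by (intro continuous_intros continuous_on_symmetric[of s]) auto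
    qed
    have j: "(\<lambda>t. joukowski t * H t * weight t * green f x t) contour_integrable_on (circlepath 0 r)"
      using sr by (intro integrable_cauchy symmetric_mult symmetric_joukowski H f) auto
    show ?thesis
      by (simp only: contour_integral_diff[OF j contour_integrable_lmul[OF i]] contour_integral_lmul[OF i])
  qed
  also have "?C (\<lambda>t. H t * ((1 - t^2) / t^2)) = 0"
    using sr r_less by (intro contour_integral_symmetric[OF H]) auto
  finally show ?thesis by (simp add: cauchy_def)
qed

lemma cauchy_ssum:
  assumes H: "symmetric_on_annulus s H" and f: "tempered f"
  shows "cauchy H (ssum n f) x r = cauchy (\<lambda>t. sph_poly n (joukowski t) * H t) f x r"
  using f
proof (induction n arbitrary: f rule: induct_nat_012)
  case 1 then show ?case using H by (simp add: cauchy_ssum_1)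
next
  case (ge2 n)
  have s0: "0 \<le> s" using sr by simp
  note sym = symmetric_mult[OF symmetric_sph_poly[OF s0] H]
  have "cauchy H (ssum (Suc (Suc n)) f) x r =
      cauchy H (ssum (Suc n) (ssum (Suc 0) f)) x r - of_nat (branching n) * cauchy H (ssum n f) x r"
    unfolding ssum_recurrence[abs_def]
    using ge2.prems by (intro cauchy_diff_cmult H tempered_ssum tempered_ssum_1)
  also have "\<dots> = cauchy (\<lambda>t. joukowski t * (sph_poly (Suc n) (joukowski t) * H t)) f x r -
      of_nat (branching n) * cauchy (\<lambda>t. sph_poly n (joukowski t) * H t) f x r"
    using ge2 by (simp only: tempered_ssum_1 cauchy_ssum_1[OF sym])
  also have "\<dots> = cauchy (\<lambda>t. joukowski t * (sph_poly (Suc n) (joukowski t) * H t) -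
      of_nat (branching n) * (sph_poly n (joukowski t) * H t)) f x r"
    using ge2.prems by (intro cauchy_symbol_diff_cmult[symmetric] sym symmetric_mult[OF symmetric_joukowski[OF s0]])
  also have "\<dots> = cauchy (\<lambda>t. sph_poly (Suc (Suc n)) (joukowski t) * H t) f x r"
    by (simp add: algebra_simps)
  finally show ?case .
qed simp

text \<open>The integrand has a simple pole at the origin, with residue \<open>green f x 0\<close>.\<close>

lemma cauchy_one:
  assumes f: "tempered f" shows "cauchy (\<lambda>_. 1) f x r = f x"
proof -
  let ?g = "\<lambda>t. (1 - t^2) / (1 - t^2 / of_nat q) * green f x t"
  have sub: "cball 0 r \<subseteq> ball 0 R" using sr by auto
  have "?g holomorphic_on cball 0 r"
    using r_less square_ne_q q_pos
    by (intro holomorphic_intros holomorphic_on_subset[OF holomorphic_green[OF f] sub]) auto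
  then have "((\<lambda>u. ?g u / (u - 0)) has_contour_integral 2 * of_real pi * \<i> * ?g 0) (circlepath 0 r)"
    by (rule Cauchy_integral_circlepath_simple) (use r_less in simp)
  then show ?thesis
    by (simp add: cauchy_def weight_def contour_integral_unique mult.assoc divide_simps)
qed

text \<open>The factor \<open>1 / (1 - r/R)\<close> is the price of moving the contour towards the boundary circle; it is compensated
  by the decay of powers of the symbol.\<close>

lemma norm_cauchy_le:
  assumes H: "symmetric_on_annulus s H" and f: "sphere_bound C f"
    and B: "\<And>t. norm t = r \<Longrightarrow> norm (H t * weight t) \<le> B"
  shows "norm (cauchy H f x r) \<le> B * C / (1 - r / R)"
proof -
  have B0: "0 \<le> B" using B[of "of_real r"] r_less by (auto intro: order_trans[OF norm_ge_zero])
  have C0: "0 \<le> C" using f by (rule sphere_bound_nonneg)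
  have rR: "0 < 1 - r / R" using sr R_pos by simp
  let ?I = "contour_integral (circlepath 0 r) (\<lambda>t. H t * weight t * green f x t)"
  have "norm ?I \<le> B * (C / (1 - r / R)) * (2 * pi * r)"
  proof (rule has_contour_integral_bound_circlepath)
    show "((\<lambda>t. H t * weight t * green f x t) has_contour_integral ?I) (circlepath 0 r)"
      using f by (intro has_contour_integral_integral integrable_cauchy H) (auto simp: tempered_def)
    fix t :: complex assume "norm (t - 0) = r"
    then show "norm (H t * weight t * green f x t) \<le> B * (C / (1 - r / R))"
      unfolding norm_mult[of "H t * weight t"] using sr B0 B norm_green_le[OF f, of t x] by (intro mult_mono) auto
  qed (use r_less B0 C0 rR in auto)
  then have "norm (cauchy H f x r) \<le> B * (C / (1 - r / R)) * r"
    by (simp add: cauchy_def norm_divide norm_mult field_simps)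
  also have "\<dots> \<le> B * (C / (1 - r / R)) * 1"
    using r_less B0 C0 rR by (intro mult_left_mono) auto
  finally show ?thesis by simp
qed

end

end

section \<open>Convolution operators in the functional calculus\<close>

lemma summable_norm_le:
  fixes f :: "nat \<Rightarrow> 'a::banach"
  shows "summable g \<Longrightarrow> (\<And>n. norm (f n) \<le> g n) \<Longrightarrow> summable f"
  by (rule summable_comparison_test'[of g 0])

context growth begin

text \<open>Convolution by a radial kernel, with the summation arranged by spheres.\<close>

definition conv :: "(nat \<Rightarrow> complex) \<Rightarrow> ('a \<Rightarrow> complex) \<Rightarrow> 'a \<Rightarrow> complex" where
  "conv \<kappa> f x = (\<Sum>n. \<kappa> n * ssum n f x)"

definition symbol :: "(nat \<Rightarrow> complex) \<Rightarrow> complex \<Rightarrow> complex" where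
  "symbol \<kappa> t = (\<Sum>n. \<kappa> n * sph_poly n (joukowski t))"

lemma norm_sph_poly_annulus:
  fixes t :: "'b::real_normed_field"
  assumes "0 < s" "s \<le> norm t" "norm t \<le> 1 / s"
  shows "norm (sph_poly n (joukowski t)) \<le> 2 * (real n + 1) * (sqrt q / s) ^ n"
proof -
  have "t \<noteq> 0" using assms by auto
  moreover have "norm (inverse t) \<le> 1 / s"
    using le_imp_inverse_le[OF assms(2,1)] by (simp add: norm_inverse flip: inverse_eq_divide)
  ultimately show ?thesis using norm_sph_poly_le[of t "1 / s" n] assms(3) by simp
qed

lemma norm_kernel_sph_poly:
  assumes "0 < s" "0 < s'" "s' \<le> norm t" "norm t \<le> 1 / s'"
    and K: "norm (\<kappa> n) \<le> C * (s / sqrt q) ^ n"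
  shows "norm (\<kappa> n * sph_poly n (joukowski t)) \<le> 2 * C * ((real n + 1) * (s / s') ^ n)"
proof -
  have "norm (\<kappa> n * sph_poly n (joukowski t)) \<le>
      C * (s / sqrt q) ^ n * (2 * (real n + 1) * (sqrt q / s') ^ n)"
    unfolding norm_mult using assms
    by (intro mult_mono norm_sph_poly_annulus order_trans[OF norm_ge_zero K]) auto
  also have "\<dots> = 2 * C * ((real n + 1) * ((s / sqrt q) ^ n * (sqrt q / s') ^ n))"
    by (simp only: mult_ac)
  also have "(s / sqrt q) ^ n * (sqrt q / s') ^ n = (s / s') ^ n"
    using q_pos by (simp flip: power_mult_distrib)
  finally show ?thesis .
qed

lemma kernel_const_nonneg:
  assumes "\<And>n. norm (\<kappa> n) \<le> C * (s / sqrt q) ^ n" shows "0 \<le> C"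
  using order_trans[OF norm_ge_zero assms[of 0]] by simp

lemma summable_poly_geometric:
  assumes "0 < s" "s < s'" shows "summable (\<lambda>n. B * ((real n + 1) * (s / s') ^ n))"
  using assms by (intro summable_mult summable_Suc_mult_power) simp

lemma summable_kernel_ssum:
  assumes s: "0 < s" "s < R" and K: "\<And>n. norm (\<kappa> n) \<le> C * (s / sqrt q) ^ n" and f: "tempered f"
  shows "summable (\<lambda>n. norm (\<kappa> n * ssum n f x))"
proof -
  obtain B where B: "sphere_bound B f" using f by (auto simp: tempered_def)
  have le: "norm (\<kappa> n * ssum n f x) \<le> C * B * (s / R) ^ n" for n
  proof -
    have "norm (\<kappa> n * ssum n f x) \<le> C * (s / sqrt q) ^ n * (B * (sqrt q / R) ^ n)"
      unfolding norm_mult using K norm_ssum_bound[OF B]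
      by (intro mult_mono order_trans[OF norm_ge_zero K]) auto
    also have "\<dots> = C * B * ((s / sqrt q) ^ n * (sqrt q / R) ^ n)"
      by (simp only: mult_ac)
    also have "(s / sqrt q) ^ n * (sqrt q / R) ^ n = (s / R) ^ n"
      using q_pos by (simp flip: power_mult_distrib)
    finally show ?thesis .
  qed
  have "summable (\<lambda>n. C * B * (s / R) ^ n)"
    using s R_pos by (intro summable_mult summable_geometric) simp
  then show ?thesis by (rule summable_comparison_test'[of _ 0]) (simp add: le)
qed

lemma green_nonneg:
  fixes f :: "'a \<Rightarrow> real"
  assumes "tempered f" "\<And>x. 0 \<le> f x" "0 \<le> r" "r < R"
  shows "0 \<le> green f x r"
  unfolding green_def
proof (rule suminf_nonneg)
  show "summable (\<lambda>n. ssum n f x * (r / of_real (sqrt q)) ^ n)"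
    using green_sums[OF assms(1), of r x] assms(3,4) by (simp add: sums_iff)
  show "0 \<le> ssum n f x * (r / of_real (sqrt q)) ^ n" for n
    using assms by (intro mult_nonneg_nonneg ssum_nonneg) auto
qed

text \<open>Interchanging the sum of the kernel with that of the resolvent needs an absolutely
  convergent majorant. Spherical sums of \<open>|f|\<close> provide it: the factor gained in \<open>green_ssum_le\<close> is of
  order \<open>(\<surd>q / r)\<^sup>n\<close>, and this is beaten by the decay of the kernel as \<open>s < r\<close>.\<close>

lemma green_conv:
  assumes s: "0 < s" "s < r" "r < R" and K: "\<And>n. norm (\<kappa> n) \<le> C * (s / sqrt q) ^ n"
    and f: "tempered f" and t: "norm t = r"
  shows "green (conv \<kappa> f) x t = (\<Sum>n. \<kappa> n * green (ssum n f) x t)"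
    and "\<exists>B. \<forall>n t. norm t = r \<longrightarrow> norm (\<kappa> n * green (ssum n f) x t) \<le> B * ((real n + 1) * (s / r) ^ n)"
proof -
  define F where "F = (\<lambda>y. norm (f y))"
  define u where "u = r / sqrt q"
  have F: "tempered F" "\<And>y. 0 \<le> F y" using f by (simp_all add: F_def tempered_norm)
  have C0: "0 \<le> C" using K by (rule kernel_const_nonneg)
  have r: "0 < r" "r < 1" "norm r < R" using s R_less_1 by auto
  have Fsums: "(\<lambda>m. ssum n (ssum m F) x * u ^ m) sums green (ssum n F) x r" for n
    using ssum_green(2)[OF F(1), of r n x] r by (simp add: u_def)
  have term_le: "norm (ssum m (ssum n f) x * (t / of_real (sqrt q)) ^ m) \<le> ssum n (ssum m F) x * u ^ m"
    if t: "norm t = r" for n m t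
  proof -
    have "norm (ssum m (ssum n f) x) \<le> ssum m (ssum n F) x"
      unfolding F_def using norm_ssum_le[of m "ssum n f" x]
      by (rule order_trans) (intro ssum_mono norm_ssum_le)
    then show ?thesis
      unfolding norm_mult norm_power norm_divide u_def ssum_ssum_commute[of n m F] using t q_pos r(1)
      by (simp add: mult_right_mono)
  qed
  have le2: "green (ssum n F) x r \<le> 2 * (real n + 1) * (sqrt q / r) ^ n * green F x r" for n
  proof -
    have "green (ssum n F) x r \<le> sph_poly n (joukowski r) * green F x r"
      using r F by (intro green_ssum_le) auto
    also have "\<dots> \<le> 2 * (real n + 1) * (sqrt q / r) ^ n * green F x r"
    proof (rule mult_right_mono)
      have "r \<le> 1 / r" using r mult_le_one[of r r] by (simp add: field_simps)
      then show "sph_poly n (joukowski r) \<le> 2 * (real n + 1) * (sqrt q / r) ^ n"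
        using norm_sph_poly_annulus[of r r n] r by simp
      show "0 \<le> green F x r"
        using r F by (intro green_nonneg) auto
    qed
    finally show ?thesis .
  qed
  have bound: "norm (\<kappa> n) * green (ssum n F) x r \<le> (2 * C * green F x r) * ((real n + 1) * (s / r) ^ n)" for n
  proof -
    have "0 \<le> green (ssum n F) x r"
      using r F by (intro green_nonneg tempered_ssum ssum_nonneg) auto
    then have "norm (\<kappa> n) * green (ssum n F) x r \<le>
        C * (s / sqrt q) ^ n * (2 * (real n + 1) * (sqrt q / r) ^ n * green F x r)"
      using le2 K C0 s by (intro mult_mono) auto
    also have "\<dots> = (2 * C * green F x r) * ((real n + 1) * ((s / sqrt q) ^ n * (sqrt q / r) ^ n))"
      by (simp only: mult_ac)
    also have "(s / sqrt q) ^ n * (sqrt q / r) ^ n = (s / r) ^ n"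
      using q_pos by (simp flip: power_mult_distrib)
    finally show ?thesis .
  qed
  have sum1: "summable (\<lambda>m. norm (ssum m (ssum n f) x * (t / of_real (sqrt q)) ^ m))"
    if t: "norm t = r" for n and t :: complex
    by (rule summable_comparison_test'[OF sums_summable[OF Fsums[of n]], of 0]) (simp only: real_norm_def abs_norm_cancel term_le[OF t])
  have le3: "(\<Sum>m. norm (ssum m (ssum n f) x * (t / of_real (sqrt q)) ^ m)) \<le> green (ssum n F) x r"
    if t: "norm t = r" for n and t :: complex
    by (rule sums_le[OF term_le[OF t] summable_sums[OF sum1[OF t]] Fsums])
  show "\<exists>B. \<forall>n t. norm t = r \<longrightarrow> norm (\<kappa> n * green (ssum n f) x t) \<le> B * ((real n + 1) * (s / r) ^ n)"
  proof (intro exI allI impI)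
    fix n and t :: complex assume t: "norm t = r"
    have "norm (green (ssum n f) x t) \<le> green (ssum n F) x r"
      unfolding green_def[of "ssum n f"] by (rule order_trans[OF summable_norm[OF sum1[OF t]] le3[OF t]])
    then show "norm (\<kappa> n * green (ssum n f) x t) \<le> (2 * C * green F x r) * ((real n + 1) * (s / r) ^ n)"
      unfolding norm_mult by (rule order_trans[OF mult_left_mono bound]) simp
  qed
  let ?a = "\<lambda>n m. \<kappa> n * (ssum m (ssum n f) x * (t / of_real (sqrt q)) ^ m)"
  have a1: "summable (\<lambda>m. norm (?a n m))" for n
    unfolding norm_mult[of "\<kappa> n"] using sum1[OF t] by (rule summable_mult)
  have "(\<Sum>n. \<Sum>m. ?a n m) = (\<Sum>m. \<Sum>n. ?a n m)"
  proof (rule suminf_swap_abs[OF a1])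
    have "summable (\<lambda>n. (2 * C * green F x r) * ((real n + 1) * (s / r) ^ n))"
      using s by (intro summable_poly_geometric) auto
    moreover have "norm (\<Sum>m. norm (?a n m)) \<le> (2 * C * green F x r) * ((real n + 1) * (s / r) ^ n)" for n
    proof -
      have "(\<Sum>m. norm (?a n m)) = norm (\<kappa> n) * (\<Sum>m. norm (ssum m (ssum n f) x * (t / of_real (sqrt q)) ^ m))"
        unfolding norm_mult[of "\<kappa> n"] by (rule suminf_mult[OF sum1[OF t]])
      also have "\<dots> \<le> norm (\<kappa> n) * green (ssum n F) x r"
        using le3[OF t] by (intro mult_left_mono) auto
      finally show ?thesis using bound[of n] suminf_nonneg[OF a1[of n]] by simp
    qed
    ultimately show "summable (\<lambda>n. \<Sum>m. norm (?a n m))"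
      by (rule summable_norm_le)
  qed
  moreover have "(\<Sum>m. ?a n m) = \<kappa> n * green (ssum n f) x t" for n
    unfolding green_def using summable_norm_cancel[OF sum1[OF t]] by (rule suminf_mult)
  moreover have "(\<Sum>n. ?a n m) = ssum m (conv \<kappa> f) x * (t / of_real (sqrt q)) ^ m" for m
  proof -
    have "(\<lambda>n. \<Sum>y\<in>tsphere x m. \<kappa> n * ssum n f y) sums (\<Sum>y\<in>tsphere x m. conv \<kappa> f y)"
      unfolding conv_def using s r
      by (intro sums_sum summable_sums summable_norm_cancel[OF summable_kernel_ssum[of s, OF _ _ K f]]) auto
    then have "(\<lambda>n. \<kappa> n * ssum m (ssum n f) x) sums ssum m (conv \<kappa> f) x"
      by (simp add: ssum_def sum_distrib_left)
    from sums_mult2[OF this, of "(t / of_real (sqrt q)) ^ m"] show ?thesis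
      by (simp add: sums_iff mult.assoc)
  qed
  ultimately show "green (conv \<kappa> f) x t = (\<Sum>n. \<kappa> n * green (ssum n f) x t)"
    by (simp add: green_def)
qed

text \<open>Termwise application of \<open>cauchy_ssum\<close>, justified by uniform convergence on the contour of
  both series, the one with the spherical sums of \<open>f\<close> and the one defining the symbol.\<close>

lemma cauchy_conv:
  assumes s: "0 < s" "s < r" "r < R" and K: "\<And>n. norm (\<kappa> n) \<le> C * (s / sqrt q) ^ n"
    and f: "tempered f" and H: "symmetric_on_annulus s H"
  shows "cauchy H (conv \<kappa> f) x r = cauchy (\<lambda>t. symbol \<kappa> t * H t) f x r"
proof -
  let ?C = "contour_integral (circlepath 0 r)"
  have r: "0 < r" "r < 1" "r < sqrt q" using s R_less_1 R_less_sqrt_q by auto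
  have bdd: "\<exists>B. \<forall>t. norm t = r \<longrightarrow> norm (g t) \<le> B" if "continuous_on {t. norm t = r} g" for g :: "complex \<Rightarrow> complex"
  proof -
    have "compact {t::complex. norm t = r}" using compact_sphere[of "0::complex" r] by (simp add: sphere_def)
    then have "bounded (g ` {t. norm t = r})" using that by (intro compact_imp_bounded compact_continuous_image)
    then show ?thesis unfolding bounded_iff by auto
  qed
  have cH: "continuous_on {t. norm t = r} (\<lambda>t. H t * weight t)"
    using s r by (intro continuous_intros continuous_on_symmetric[OF H] continuous_on_weight) auto
  obtain W where W: "\<And>t. norm t = r \<Longrightarrow> norm (H t * weight t) \<le> W" using bdd[OF cH] by auto
  obtain V where V: "\<And>t. norm t = r \<Longrightarrow> norm (H t * weight t * green f x t) \<le> V"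
    using bdd[OF continuous_cauchy[OF s H f]] by metis
  obtain B where B: "\<And>n t. norm t = r \<Longrightarrow> norm (\<kappa> n * green (ssum n f) x t) \<le> B * ((real n + 1) * (s / r) ^ n)"
    using green_conv(2)[OF s K f, of "of_real r" x] r by auto
  have sym: "symmetric_on_annulus s (\<lambda>t. sph_poly n (joukowski t) * H t)" for n
    using s by (intro symmetric_mult symmetric_sph_poly H) auto
  have I: "?C (\<lambda>t. \<kappa> n * (H t * weight t * green (ssum n f) x t)) =
      ?C (\<lambda>t. \<kappa> n * (sph_poly n (joukowski t) * H t * weight t * green f x t))" for n
  proof -
    have "?C (\<lambda>t. \<kappa> n * (H t * weight t * green (ssum n f) x t)) = \<kappa> n * ?C (\<lambda>t. H t * weight t * green (ssum n f) x t)"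
      by (intro contour_integral_lmul integrable_cauchy[OF s] H tempered_ssum f)
    also have "?C (\<lambda>t. H t * weight t * green (ssum n f) x t) = ?C (\<lambda>t. sph_poly n (joukowski t) * H t * weight t * green f x t)"
      using cauchy_ssum[OF s H f, of n x] by (simp add: cauchy_def)
    also have "\<kappa> n * \<dots> = ?C (\<lambda>t. \<kappa> n * (sph_poly n (joukowski t) * H t * weight t * green f x t))"
      by (intro contour_integral_lmul[symmetric] integrable_cauchy[OF s] sym f)
    finally show ?thesis .
  qed
  have S1: "(\<lambda>n. ?C (\<lambda>t. \<kappa> n * (H t * weight t * green (ssum n f) x t))) sums
      ?C (\<lambda>t. \<Sum>n. \<kappa> n * (H t * weight t * green (ssum n f) x t))"
  proof (rule contour_integral_suminf_circlepath)
    fix n and t :: complex assume t: "norm t = r"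
    have "norm (\<kappa> n * (H t * weight t * green (ssum n f) x t)) =
        norm (H t * weight t) * norm (\<kappa> n * green (ssum n f) x t)" by (simp add: norm_mult mult_ac)
    also have "\<dots> \<le> W * (B * ((real n + 1) * (s / r) ^ n))"
      using W[OF t] B[OF t] by (intro mult_mono order_trans[OF norm_ge_zero W[OF t]]) auto
    finally show "norm (\<kappa> n * (H t * weight t * green (ssum n f) x t)) \<le> W * B * ((real n + 1) * (s / r) ^ n)"
      by (simp add: mult_ac)
  next
    fix n show "continuous_on (path_image (circlepath 0 r)) (\<lambda>t. \<kappa> n * (H t * weight t * green (ssum n f) x t))"
      unfolding path_image_circle[OF less_imp_le[OF r(1)]]
      by (intro continuous_intros continuous_cauchy[OF s] H tempered_ssum f)
  qed (use s r summable_poly_geometric in auto)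
  have S2: "?C (\<lambda>t. \<Sum>n. \<kappa> n * (H t * weight t * green (ssum n f) x t)) =
      ?C (\<lambda>t. H t * weight t * green (conv \<kappa> f) x t)"
  proof (rule contour_integral_cong[OF refl])
    fix t assume "t \<in> path_image (circlepath 0 r)"
    then have t: "norm t = r" using r by (simp add: path_image_circle del: path_image_circlepath)
    have "summable (\<lambda>n. \<kappa> n * green (ssum n f) x t)"
      using s by (intro summable_norm_le[OF summable_poly_geometric B[OF t]]) auto
    from suminf_mult[OF this, of "H t * weight t"]
    show "(\<Sum>n. \<kappa> n * (H t * weight t * green (ssum n f) x t)) = H t * weight t * green (conv \<kappa> f) x t"
      unfolding green_conv(1)[OF s K f t] by (simp add: mult_ac)
  qed
  have S3: "(\<lambda>n. ?C (\<lambda>t. \<kappa> n * (sph_poly n (joukowski t) * H t * weight t * green f x t))) sums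
      ?C (\<lambda>t. \<Sum>n. \<kappa> n * (sph_poly n (joukowski t) * H t * weight t * green f x t))"
  proof (rule contour_integral_suminf_circlepath)
    fix n and t :: complex assume t: "norm t = r"
    have P: "norm (\<kappa> n * sph_poly n (joukowski t)) \<le> 2 * C * ((real n + 1) * (s / r) ^ n)"
      using s r t mult_le_one[of r r] by (intro norm_kernel_sph_poly K) (auto simp: field_simps)
    have "norm (\<kappa> n * (sph_poly n (joukowski t) * H t * weight t * green f x t)) =
        norm (H t * weight t * green f x t) * norm (\<kappa> n * sph_poly n (joukowski t))" by (simp add: norm_mult mult_ac)
    also have "\<dots> \<le> V * (2 * C * ((real n + 1) * (s / r) ^ n))"
      using V[OF t] P by (intro mult_mono order_trans[OF norm_ge_zero V[OF t]]) auto
    finally show "norm (\<kappa> n * (sph_poly n (joukowski t) * H t * weight t * green f x t)) \<le> V * (2 * C) * ((real n + 1) * (s / r) ^ n)"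
      by (simp add: mult_ac)
  next
    fix n show "continuous_on (path_image (circlepath 0 r)) (\<lambda>t. \<kappa> n * (sph_poly n (joukowski t) * H t * weight t * green f x t))"
      unfolding path_image_circle[OF less_imp_le[OF r(1)]]
      by (intro continuous_on_mult[OF continuous_on_const] continuous_cauchy[OF s] sym f)
  qed (use s r summable_poly_geometric in auto)
  have S4: "?C (\<lambda>t. \<Sum>n. \<kappa> n * (sph_poly n (joukowski t) * H t * weight t * green f x t)) =
      ?C (\<lambda>t. symbol \<kappa> t * H t * weight t * green f x t)"
  proof (rule contour_integral_cong[OF refl])
    fix t assume "t \<in> path_image (circlepath 0 r)"
    then have t: "norm t = r" using r by (simp add: path_image_circle del: path_image_circlepath)
    have P: "norm (\<kappa> n * sph_poly n (joukowski t)) \<le> 2 * C * ((real n + 1) * (s / r) ^ n)" for n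
      using s r t mult_le_one[of r r] by (intro norm_kernel_sph_poly K) (auto simp: field_simps)
    have "summable (\<lambda>n. \<kappa> n * sph_poly n (joukowski t))"
      using s by (intro summable_norm_le[OF summable_poly_geometric P]) auto
    from suminf_mult[OF this, of "H t * weight t * green f x t"]
    show "(\<Sum>n. \<kappa> n * (sph_poly n (joukowski t) * H t * weight t * green f x t)) =
        symbol \<kappa> t * H t * weight t * green f x t"
      unfolding symbol_def by (simp add: mult_ac)
  qed
  have "?C (\<lambda>t. H t * weight t * green (conv \<kappa> f) x t) = ?C (\<lambda>t. symbol \<kappa> t * H t * weight t * green f x t)"
    using sums_unique2[OF S1[unfolded I] S3] unfolding S2 S4 .
  then show ?thesis by (simp add: cauchy_def)
qed

end

section \<open>Inversion of the spherical transform; polynomials in the Laplacian\<close>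

context growth begin

lemma bounded_on_circle:
  fixes g :: "complex \<Rightarrow> complex"
  assumes "continuous_on {t. norm t = r} g"
  shows "\<exists>B. \<forall>t. norm t = r \<longrightarrow> norm (g t) \<le> B"
proof -
  have "compact {t::complex. norm t = r}" using compact_sphere[of "0::complex" r] by (simp add: sphere_def)
  then have "bounded (g ` {t. norm t = r})" using assms by (intro compact_imp_bounded compact_continuous_image)
  then show ?thesis unfolding bounded_iff by auto
qed

lemma R_less_root: "1 \<le> sqrt q / R"
  using R_pos R_less_sqrt_q by simp

text \<open>For a point mass at distance \<open>n\<close> from \<open>x\<close> the resolvent is a power of \<open>t\<close>, and the functional
  calculus must return its spherical sums at \<open>x\<close>. This reads off the integral without computing a residue.\<close>

lemma sph_poly_orthogonality:
  "contour_integral (circlepath 0 1) (\<lambda>t. sph_poly m (joukowski t) * weight t * t ^ n) =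
    (if m = n then 2 * of_real pi * \<i> * of_real (sqrt q) ^ n else 0)"
proof -
  define r s where "r = R / 2" and "s = R / 4"
  have rs: "0 < s" "s < r" "r < R" "0 < r" "r < sqrt q" using R_pos R_less_sqrt_q by (auto simp: r_def s_def)
  obtain x y :: 'a where y: "y \<in> tsphere x n" using sphere_nonempty by blast
  define f :: "'a \<Rightarrow> complex" where "f z = (if z = y then 1 else 0)" for z
  have "ssum k (\<lambda>z. norm (f z)) w \<le> 1 * (sqrt q / R) ^ k" for k w
  proof -
    have "ssum k (\<lambda>z. norm (f z)) w = (if y \<in> tsphere w k then 1 else 0)"
      by (simp add: ssum_def f_def if_distrib[of norm] sum.delta cong: if_cong)
    also have "\<dots> \<le> 1 * (sqrt q / R) ^ k" using R_less_root one_le_power[of "sqrt q / R" k] by auto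
    finally show ?thesis .
  qed
  then have f: "tempered f" unfolding tempered_def sphere_bound_def by blast
  have S: "ssum k f x = (if k = n then 1 else 0)" for k
  proof -
    have "ssum k f x = (if y \<in> tsphere x k then 1 else 0)"
      by (simp add: ssum_def f_def sum.delta)
    then show ?thesis using y by (auto simp: tsphere_def)
  qed
  have g: "green f x t = (t / of_real (sqrt q)) ^ n" for t
  proof -
    have "green f x t = (\<Sum>k. if k = n then (t / of_real (sqrt q)) ^ k else 0)"
      unfolding green_def S by (intro arg_cong[of _ _ suminf]) auto
    then show ?thesis using sums_single[of n "\<lambda>k. (t / of_real (sqrt q)) ^ k"] by (simp add: sums_iff)
  qed
  have qn: "of_real (sqrt q) ^ n \<noteq> (0::complex)" using q_pos by simp
  let ?G = "\<lambda>t. sph_poly m (joukowski t) * weight t * t ^ n"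
  have hol: "?G holomorphic_on annulus 0 (sqrt q)"
  proof -
    have "(\<lambda>t. sph_poly m (joukowski t)) holomorphic_on annulus 0 (sqrt q)" for m
    proof (induction m rule: induct_nat_012)
      case 1 then show ?case
        by (auto simp: joukowski_def[abs_def] zero_notin_annulus intro!: holomorphic_intros)
    next
      case (ge2 n)
      then show ?case by (auto simp: joukowski_def[abs_def] zero_notin_annulus intro!: holomorphic_intros)
    qed simp
    then show ?thesis by (intro holomorphic_intros holomorphic_weight)
  qed
  have sqc: "1 < sqrt q" by (rule sqrt_q)
  have "contour_integral (circlepath 0 1) ?G = contour_integral (circlepath 0 r) ?G"
    using rs sqc by (intro contour_integral_circlepath_shift[OF hol]) auto
  also have "\<dots> = contour_integral (circlepath 0 r)
      (\<lambda>t. of_real (sqrt q) ^ n * (sph_poly m (joukowski t) * 1 * weight t * green f x t))"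
    using qn by (simp add: g power_divide)
  also have "\<dots> = of_real (sqrt q) ^ n *
      contour_integral (circlepath 0 r) (\<lambda>t. sph_poly m (joukowski t) * 1 * weight t * green f x t)"
    using rs by (intro contour_integral_lmul integrable_cauchy[of s] symmetric_mult symmetric_sph_poly symmetric_const f) auto
  also have "contour_integral (circlepath 0 r) (\<lambda>t. sph_poly m (joukowski t) * 1 * weight t * green f x t) =
      2 * of_real pi * \<i> * ssum m f x"
    using cauchy_ssum[OF rs(1-3) symmetric_const f, of 1 m x] cauchy_one[OF rs(1-3) tempered_ssum[OF f], of m x]
    by (simp add: cauchy_def divide_eq_eq mult_ac)
  finally show ?thesis by (simp add: S)
qed

lemma continuous_on_sph_poly:
  fixes A :: "complex set"
  assumes "0 \<notin> A" shows "continuous_on A (\<lambda>t. sph_poly m (joukowski t))"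
proof (induction m rule: induct_nat_012)
  case 1
  then show ?case using assms by (auto simp: joukowski_def intro!: continuous_intros)
next
  case (ge2 n)
  then show ?case using assms by (auto simp: joukowski_def intro!: continuous_intros)
qed simp

text \<open>The orthogonality relation expresses \<open>\<kappa> n\<close> as an integral over the unit circle of the symbol
  against \<open>t\<^sup>n\<close>. If the symbol extends holomorphically inwards, the circle can be shrunk, and
  \<open>|t|\<^sup>n\<close> yields the decay.\<close>

lemma kernel_inversion:
  assumes K: "summable (\<lambda>n. norm (\<kappa> n) * ((real n + 1) * sqrt q ^ n))"
    and G: "\<And>t. norm t = 1 \<Longrightarrow> G t = symbol \<kappa> t"
    and hol: "G holomorphic_on annulus s (1 / s)" and s: "0 < s" "s < s1" "s1 < 1"
  shows "\<exists>C. \<forall>n. norm (\<kappa> n) \<le> C * (s1 / sqrt q) ^ n"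
proof -
  let ?C = "contour_integral (circlepath 0 1)"
  have c1: "continuous_on {t. norm t = 1} weight" using sqrt_q by (intro continuous_on_weight) auto
  have s1q: "s1 < sqrt q" using s sqrt_q by linarith
  have c2: "continuous_on {t. norm t = s1} (\<lambda>t. G t * weight t)"
    using s s1q by (intro continuous_on_mult continuous_on_weight holomorphic_on_imp_continuous_on
      [OF holomorphic_on_subset[OF hol]]) (auto intro: annulus_below_1)
  obtain W where W: "\<And>t. norm t = 1 \<Longrightarrow> norm (weight t) \<le> W" using bounded_on_circle[OF c1] by auto
  obtain V where V: "\<And>t. norm t = s1 \<Longrightarrow> norm (G t * weight t) \<le> V" using bounded_on_circle[OF c2] by auto
  have V0: "0 \<le> V" using V[of "of_real s1"] s by (auto intro: order_trans[OF norm_ge_zero])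
  have P: "norm (sph_poly m (joukowski t)) \<le> 2 * ((real m + 1) * sqrt q ^ m)" if "norm t = 1" for m and t :: complex
    using norm_sph_poly_annulus[of 1 t m] that by (simp add: algebra_simps)
  have eq: "2 * of_real pi * \<i> * of_real (sqrt q) ^ n * \<kappa> n = contour_integral (circlepath 0 s1) (\<lambda>t. G t * weight t * t ^ n)" for n
  proof -
    have "(\<lambda>m. ?C (\<lambda>t. \<kappa> m * (sph_poly m (joukowski t) * weight t * t ^ n))) sums
        ?C (\<lambda>t. \<Sum>m. \<kappa> m * (sph_poly m (joukowski t) * weight t * t ^ n))"
    proof (rule contour_integral_suminf_circlepath)
      fix m and t :: complex assume t: "norm t = 1"
      have "norm (\<kappa> m * (sph_poly m (joukowski t) * weight t * t ^ n)) =
          norm (\<kappa> m) * (norm (sph_poly m (joukowski t)) * norm (weight t))"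
        using t by (simp add: norm_mult norm_power)
      also have "\<dots> \<le> norm (\<kappa> m) * (2 * ((real m + 1) * sqrt q ^ m) * W)"
        using P[OF t] W[OF t] by (intro mult_left_mono mult_mono) auto
      finally show "norm (\<kappa> m * (sph_poly m (joukowski t) * weight t * t ^ n)) \<le>
          (2 * W) * (norm (\<kappa> m) * ((real m + 1) * sqrt q ^ m))" by (simp only: mult_ac)
    next
      show "summable (\<lambda>m. (2 * W) * (norm (\<kappa> m) * ((real m + 1) * sqrt q ^ m)))"
        using K by (rule summable_mult)
      fix m
      have "continuous_on {t. norm t = 1} (\<lambda>t. sph_poly m (joukowski t) :: complex)"
        by (rule continuous_on_sph_poly) simp
      then show "continuous_on (path_image (circlepath 0 1)) (\<lambda>t. \<kappa> m * (sph_poly m (joukowski t) * weight t * t ^ n))"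
        unfolding path_image_circle[OF zero_le_one] by (intro continuous_intros c1)
    qed simp
    moreover have "?C (\<lambda>t. \<Sum>m. \<kappa> m * (sph_poly m (joukowski t) * weight t * t ^ n)) = ?C (\<lambda>t. G t * weight t * t ^ n)"
    proof (rule contour_integral_cong[OF refl])
      fix t assume "t \<in> path_image (circlepath 0 1)"
      then have t: "norm t = 1" by (simp add: path_image_circle del: path_image_circlepath)
      have "summable (\<lambda>m. \<kappa> m * sph_poly m (joukowski t))"
      proof (rule summable_norm_le[OF summable_mult[OF K, of 2]])
        fix m show "norm (\<kappa> m * sph_poly m (joukowski t)) \<le> 2 * (norm (\<kappa> m) * ((real m + 1) * sqrt q ^ m))"
          unfolding norm_mult using mult_left_mono[OF P[OF t], of "norm (\<kappa> m)" m] by (simp add: mult_ac)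
      qed
      from suminf_mult[OF this, of "weight t * t ^ n"]
      show "(\<Sum>m. \<kappa> m * (sph_poly m (joukowski t) * weight t * t ^ n)) = G t * weight t * t ^ n"
        unfolding G[OF t] symbol_def by (simp add: mult_ac)
    qed
    moreover have "?C (\<lambda>t. \<kappa> m * (sph_poly m (joukowski t) * weight t * t ^ n)) =
        (if m = n then \<kappa> m * (2 * of_real pi * \<i> * of_real (sqrt q) ^ n) else 0)" for m
    proof -
      have "continuous_on {t. norm t = 1} (\<lambda>t. sph_poly m (joukowski t) :: complex)"
        by (rule continuous_on_sph_poly) simp
      then have "(\<lambda>t. sph_poly m (joukowski t) * weight t * t ^ n) contour_integrable_on circlepath 0 1"
        by (intro contour_integrable_continuous_circlepath, unfold path_image_circle[OF zero_le_one])
          (intro continuous_intros c1)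
      then show ?thesis by (simp add: contour_integral_lmul sph_poly_orthogonality)
    qed
    ultimately have "?C (\<lambda>t. G t * weight t * t ^ n) = \<kappa> n * (2 * of_real pi * \<i> * of_real (sqrt q) ^ n)"
      using sums_unique2[OF _ sums_single[of n "\<lambda>m. \<kappa> m * (2 * of_real pi * \<i> * of_real (sqrt q) ^ n)"]]
      by simp
    moreover have "?C (\<lambda>t. G t * weight t * t ^ n) = contour_integral (circlepath 0 s1) (\<lambda>t. G t * weight t * t ^ n)"
    proof (rule contour_integral_circlepath_shift)
      have "annulus s (min (1 / s) (sqrt q)) \<subseteq> annulus s (1 / s)" "annulus s (min (1 / s) (sqrt q)) \<subseteq> annulus 0 (sqrt q)"
        using s by (auto simp: annulus_def)
      then show "(\<lambda>t. G t * weight t * t ^ n) holomorphic_on annulus s (min (1 / s) (sqrt q))"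
        by (intro holomorphic_intros holomorphic_on_subset[OF hol] holomorphic_on_subset[OF holomorphic_weight])
      have "1 < 1 / s" using s by simp
      then have "s1 < 1 / s" using s by linarith
      then show "1 < min (1 / s) (sqrt q)" "s1 < min (1 / s) (sqrt q)"
        using \<open>1 < 1 / s\<close> s1q sqrt_q by (simp_all only: min_less_iff_conj)
    qed (use s in auto)
    ultimately show ?thesis by (simp add: mult_ac)
  qed
  have "norm (\<kappa> n) \<le> (V * s1) * (s1 / sqrt q) ^ n" for n
  proof -
    let ?I = "contour_integral (circlepath 0 s1) (\<lambda>t. G t * weight t * t ^ n)"
    have "norm ?I \<le> V * s1 ^ n * (2 * pi * s1)"
    proof (rule has_contour_integral_bound_circlepath)
      have "continuous_on (path_image (circlepath 0 s1)) (\<lambda>t. G t * weight t * t ^ n)"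
        unfolding path_image_circle[OF less_imp_le[OF less_trans[OF s(1,2)]]] by (intro continuous_intros c2)
      then show "((\<lambda>t. G t * weight t * t ^ n) has_contour_integral ?I) (circlepath 0 s1)"
        by (intro has_contour_integral_integral contour_integrable_continuous_circlepath)
      fix t :: complex assume "norm (t - 0) = s1"
      then show "norm (G t * weight t * t ^ n) \<le> V * s1 ^ n"
        using V[of t] s unfolding norm_mult[of _ "t ^ n"] norm_power by (simp add: mult_right_mono)
    qed (use s V0 in auto)
    then have "2 * pi * sqrt q ^ n * norm (\<kappa> n) \<le> V * s1 ^ n * (2 * pi * s1)"
      unfolding eq[symmetric] by (simp add: norm_mult norm_power)
    then have "sqrt q ^ n * norm (\<kappa> n) \<le> V * s1 * s1 ^ n" by (simp add: mult_ac)
    then show ?thesis using q_pos by (simp add: power_divide field_simps)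
  qed
  then show ?thesis by blast
qed

lemma holomorphic_symbol:
  assumes s: "0 < s" and K: "\<And>n. norm (\<kappa> n) \<le> C * (s / sqrt q) ^ n"
  shows "symbol \<kappa> holomorphic_on annulus s (1 / s)"
proof (rule holomorphic_uniform_sequence[OF open_annulus])
  fix n show "(\<lambda>t. \<Sum>i<n. \<kappa> i * sph_poly i (joukowski t)) holomorphic_on annulus s (1 / s)"
    using symmetric_sph_poly[of s] s by (intro holomorphic_intros) (auto simp: symmetric_on_annulus_def)
next
  fix t assume t: "t \<in> annulus s (1 / s)"
  define m where "m = min (norm t) (1 / norm t)"
  have t0: "0 < norm t" using s t unfolding annulus_def mem_Collect_eq by linarith
  have "s < 1 / norm t" using t t0 s by (simp add: annulus_def field_simps)
  then have "s < m" using t by (simp add: m_def annulus_def)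
  then obtain s2 where s2: "s < s2" "s2 < m" using dense by blast
  have s20: "0 < s2" using s s2 by simp
  have "norm t < 1 / s2" using s2 t0 s20 by (simp add: m_def field_simps)
  then have "t \<in> annulus s2 (1 / s2)" using s2 by (simp add: annulus_def m_def)
  then obtain d where d: "0 < d" "cball t d \<subseteq> annulus s2 (1 / s2)"
    using open_contains_cball[of "annulus s2 (1 / s2)"] by auto
  have "annulus s2 (1 / s2) \<subseteq> annulus s (1 / s)"
    using s s2 s20 frac_le[of 1 1 s s2] by (auto simp: annulus_def)
  moreover have "uniform_limit (cball t d) (\<lambda>n t. \<Sum>i<n. \<kappa> i * sph_poly i (joukowski t)) (symbol \<kappa>) sequentially"
    unfolding symbol_def[abs_def]
  proof (rule Weierstrass_m_test)
    fix n x assume "x \<in> cball t d"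
    then have "x \<in> annulus s2 (1 / s2)" using d by blast
    then show "norm (\<kappa> n * sph_poly n (joukowski x)) \<le> 2 * C * ((real n + 1) * (s / s2) ^ n)"
      using s s20 by (intro norm_kernel_sph_poly K) (auto simp: annulus_def)
  qed (use s s2 summable_poly_geometric in auto)
  ultimately show "\<exists>d. 0 < d \<and> cball t d \<subseteq> annulus s (1 / s) \<and>
      uniform_limit (cball t d) (\<lambda>n t. \<Sum>i<n. \<kappa> i * sph_poly i (joukowski t)) (symbol \<kappa>) sequentially"
    using d by blast
qed

text \<open>Both sides are holomorphic on the annulus and agree on the unit circle.\<close>

lemma symbol_eq_on_annulus:
  assumes s: "0 < s" "s < 1" and K: "\<And>n. norm (\<kappa> n) \<le> C * (s / sqrt q) ^ n"
    and G: "\<And>t. norm t = 1 \<Longrightarrow> G t = symbol \<kappa> t" and hol: "G holomorphic_on annulus s (1 / s)"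
    and t: "t \<in> annulus s (1 / s)"
  shows "symbol \<kappa> t = G t"
proof -
  have 1: "1 < 1 / s" using s by simp
  have "symbol \<kappa> t - G t = 0"
  proof (rule analytic_continuation[where S = "annulus s (1 / s)" and U = "sphere 0 1" and \<xi> = 1
        and f = "\<lambda>t. symbol \<kappa> t - G t"])
    show "(\<lambda>t. symbol \<kappa> t - G t) holomorphic_on annulus s (1 / s)"
      by (intro holomorphic_intros holomorphic_symbol[OF s(1) K] hol)
    have "sphere (0::complex) 1 \<noteq> {x}" for x
    proof
      assume "sphere 0 1 = {x}"
      then have "(-1::complex) \<in> {x}" "(1::complex) \<in> {x}" by (simp_all flip: \<open>sphere 0 1 = {x}\<close>)
      then show False by simp
    qed
    moreover have "connected (sphere (0::complex) 1)" by (intro connected_sphere) simp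
    ultimately show "(1::complex) islimpt sphere 0 1"
      by (intro connected_imp_perfect) auto
    show "sphere 0 1 \<subseteq> annulus s (1 / s)" "1 \<in> annulus s (1 / s)" using s 1 by (auto simp: annulus_def)
  qed (use G t in \<open>simp_all add: connected_annulus0\<close>)
  then show ?thesis by simp
qed

definition lap_value :: "complex \<Rightarrow> complex" where
  "lap_value t = 1 - joukowski t / of_nat (q + 1)"

abbreviation L :: "('a \<Rightarrow> complex) \<Rightarrow> 'a \<Rightarrow> complex" where "L \<equiv> laplacian q E"

lemma L_eq: "L f x = f x - inverse (of_nat (q + 1)) * ssum (Suc 0) f x"
  by (simp add: laplacian_def ssum_def tsphere_def divide_inverse mult.commute)

lemma L_add: "L (\<lambda>x. f x + g x) x = L f x + L g x"
  and L_cmult: "L (\<lambda>x. c * f x) x = c * L f x"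
  by (simp_all add: L_eq ssum_add ssum_diff ssum_cmult algebra_simps)

lemma tempered_L: "tempered f \<Longrightarrow> tempered (L f)"
  unfolding L_eq[abs_def] by (intro tempered_diff tempered_cmult tempered_ssum_1)

definition poly_lap :: "complex poly \<Rightarrow> ('a \<Rightarrow> complex) \<Rightarrow> 'a \<Rightarrow> complex" where
  "poly_lap P = fold_coeffs (\<lambda>a g f x. a * f x + g (L f) x) P (\<lambda>f x. 0)"

lemma poly_lap_0 [simp]: "poly_lap 0 f x = 0"
  by (simp add: poly_lap_def)

lemma poly_lap_pCons [simp]: "poly_lap (pCons a P) f x = a * f x + poly_lap P (L f) x"
  by (cases "P = 0 \<and> a = 0") (auto simp: poly_lap_def)

lemma poly_lap_add: "poly_lap (P + Q) f x = poly_lap P f x + poly_lap Q f x"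
proof (induction P arbitrary: Q f)
  case (pCons a P)
  show ?case using pCons.IH by (cases Q) (simp add: algebra_simps)
qed simp

lemma poly_lap_smult: "poly_lap (smult c P) f x = c * poly_lap P f x"
  by (induction P arbitrary: f) (auto simp: algebra_simps)

lemma poly_lap_sum: "poly_lap (\<Sum>i\<in>I. P i) f x = (\<Sum>i\<in>I. poly_lap (P i) f x)"
  by (induction I rule: infinite_finite_induct) (auto simp: poly_lap_add)

lemma poly_lap_linear:
  "poly_lap P (\<lambda>x. f x + g x) x = poly_lap P f x + poly_lap P g x"
  "poly_lap P (\<lambda>x. c * f x) x = c * poly_lap P f x"
proof (induction P arbitrary: f g)
  case (pCons a P)
  { case 1 show ?case using pCons.IH(1) by (simp add: L_add[abs_def] algebra_simps) }
  { case 2 show ?case using pCons.IH(2) by (simp add: L_cmult[abs_def] algebra_simps) }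
qed auto

lemma poly_lap_sum_fun: "poly_lap P (\<lambda>x. \<Sum>i\<in>I. f i x) x = (\<Sum>i\<in>I. poly_lap P (f i) x)"
proof (induction I rule: infinite_finite_induct)
  case (insert i I)
  then show ?case by (simp add: poly_lap_linear(1))
qed (use poly_lap_linear(2)[of P 0] in auto)

lemma poly_lap_L: "poly_lap P (L f) = L (poly_lap P f)"
proof (induction P arbitrary: f)
  case 0 show ?case by (auto simp: L_eq ssum_def)
next
  case (pCons a P)
  show ?case
  proof
    fix x
    have "L (poly_lap (pCons a P) f) x = L (\<lambda>x. a * f x + poly_lap P (L f) x) x"
      by (simp only: poly_lap_pCons[abs_def])
    also have "\<dots> = a * L f x + L (poly_lap P (L f)) x" by (simp only: L_add L_cmult)
    finally show "poly_lap (pCons a P) (L f) x = L (poly_lap (pCons a P) f) x"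
      by (simp add: pCons.IH)
  qed
qed

lemma poly_lap_mult: "poly_lap (P * Q) f = poly_lap P (poly_lap Q f)"
proof (induction P arbitrary: f)
  case (pCons a P)
  show ?case
    by (rule ext) (simp add: poly_lap_add poly_lap_smult pCons.IH poly_lap_L)
qed auto

lemma poly_lap_1 [simp]: "poly_lap 1 f = f"
  by (rule ext) (simp add: one_pCons)

lemma poly_lap_linear_factor: "poly_lap [:-c, 1:] f x = L f x - c * f x"
  by simp

lemma poly_lap_eigenfunction:
  assumes "L g = (\<lambda>x. c * g x)" shows "poly_lap P g x = poly P c * g x"
  by (induction P) (simp_all add: assms poly_lap_linear(2) algebra_simps)

lemma tempered_poly_lap: "tempered f \<Longrightarrow> tempered (poly_lap P f)"
proof (induction P arbitrary: f)
  case 0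
  show ?case unfolding tempered_def sphere_bound_def by (intro exI[of _ 0]) (simp add: ssum_def)
next
  case (pCons a P)
  then show ?case
    unfolding poly_lap_pCons[abs_def] by (intro tempered_add tempered_cmult pCons.IH tempered_L)
qed

lemma symmetric_lap_value: "0 \<le> s \<Longrightarrow> symmetric_on_annulus s lap_value"
  unfolding lap_value_def[abs_def] divide_inverse
  by (intro symmetric_diff symmetric_mult symmetric_const symmetric_joukowski)

lemma symmetric_poly_lap_value: "0 \<le> s \<Longrightarrow> symmetric_on_annulus s (\<lambda>t. poly P (lap_value t))"
  by (induction P) (auto intro!: symmetric_add symmetric_mult symmetric_const symmetric_lap_value)

lemma cauchy_L:
  assumes s: "0 < s" "s < r" "r < R" and H: "symmetric_on_annulus s H" and f: "tempered f"
  shows "cauchy H (L f) x r = cauchy (\<lambda>t. lap_value t * H t) f x r"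
proof -
  have s0: "0 \<le> s" using s by simp
  have "cauchy H (L f) x r = cauchy H f x r - inverse (of_nat (q + 1)) * cauchy H (ssum (Suc 0) f) x r"
    unfolding L_eq[abs_def] by (intro cauchy_diff_cmult[OF s] H f tempered_ssum_1)
  also have "\<dots> = cauchy (\<lambda>t. H t - inverse (of_nat (q + 1)) * (joukowski t * H t)) f x r"
    unfolding cauchy_ssum_1[OF s H f]
    by (intro cauchy_symbol_diff_cmult[OF s, symmetric] symmetric_mult symmetric_joukowski H f s0)
  finally show ?thesis by (simp add: lap_value_def divide_inverse algebra_simps)
qed

lemma cauchy_poly_lap:
  assumes s: "0 < s" "s < r" "r < R" and H: "symmetric_on_annulus s H" and f: "tempered f"
  shows "cauchy H (poly_lap P f) x r = cauchy (\<lambda>t. poly P (lap_value t) * H t) f x r"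
  using f
proof (induction P arbitrary: f)
  case 0
  have "poly_lap 0 f = (\<lambda>x. f x - 1 * f x)" by auto
  then have "cauchy H (poly_lap 0 f) x r = 0"
    using cauchy_diff_cmult[OF s H 0 0, of 1 x] by simp
  moreover have "cauchy (\<lambda>t. poly 0 (lap_value t) * H t) f x r = 0"
    using cauchy_symbol_diff_cmult[OF s H H 0, of 1 x] by simp
  ultimately show ?case by (simp only:)
next
  case (pCons a P)
  have s0: "0 \<le> s" using s by simp
  have "poly_lap (pCons a P) f = (\<lambda>x. poly_lap P (L f) x - (-a) * f x)" by (auto simp: add.commute)
  then have "cauchy H (poly_lap (pCons a P) f) x r = cauchy H (poly_lap P (L f)) x r - (-a) * cauchy H f x r"
    using pCons.prems by (simp only:) (intro cauchy_diff_cmult[OF s] H tempered_poly_lap tempered_L)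
  also have "cauchy H (poly_lap P (L f)) x r = cauchy (\<lambda>t. lap_value t * (poly P (lap_value t) * H t)) f x r"
    using pCons by (simp only: tempered_L cauchy_L[OF s symmetric_mult[OF symmetric_poly_lap_value[OF s0] H]])
  also have "\<dots> - (-a) * cauchy H f x r =
      cauchy (\<lambda>t. lap_value t * (poly P (lap_value t) * H t) - (-a) * H t) f x r"
    using pCons.prems
    by (intro cauchy_symbol_diff_cmult[OF s, symmetric] symmetric_mult symmetric_lap_value symmetric_poly_lap_value H s0)
  also have "(\<lambda>t. lap_value t * (poly P (lap_value t) * H t) - (-a) * H t) = (\<lambda>t. poly (pCons a P) (lap_value t) * H t)"
    by (auto simp: algebra_simps)
  finally show ?case .
qed

end

section \<open>Estimates near the boundary circle\<close>

text \<open>On the circle \<open>cnj t\<close> equals \<open>R\<^sup>2 / t\<close>, so \<open>|U|\<^sup>2\<close> is there the restriction of the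
  function \<open>V t = U t * cnj (U (R\<^sup>2 / cnj t))\<close>, which is holomorphic near the circle. As \<open>V\<close> is not identically one,
  \<open>1 - V\<close> has zeros of finite order, whereas \<open>F\<close> vanishes at least to first order at each zero on the
  circle. Compactness makes the local estimates uniform.\<close>

lemma lojasiewicz_circle:
  fixes U F :: "complex \<Rightarrow> complex"
  assumes s: "0 < s" "s < R"
    and U: "U holomorphic_on annulus s (R^2 / s)" and F: "F holomorphic_on annulus s (R^2 / s)"
    and le1: "\<And>t. norm t = R \<Longrightarrow> norm (U t) \<le> 1"
    and ex: "norm t1 = R" "norm (U t1) < 1"
    and zero: "\<And>t. norm t = R \<Longrightarrow> norm (U t) = 1 \<Longrightarrow> F t = 0"
  shows "\<exists>c>0. \<exists>n. \<exists>B>0. \<forall>t. norm t = R \<longrightarrow>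
    norm (F t) \<le> B \<and> c * (norm (F t) / B) ^ n \<le> 1 - norm (U t) ^ 2"
proof -
  let ?A = "annulus s (R^2 / s)"
  let ?C = "{t::complex. norm t = R}"
  have "s * R < R * R" using s by simp
  then have "R < R^2 / s" using s by (simp add: less_divide_eq power2_eq_square mult.commute)
  then have CA: "?C \<subseteq> ?A" using s by (auto simp: annulus_def)
  have compC: "compact ?C" using compact_sphere[of "0::complex" R] by (simp add: sphere_def)
  have contF: "continuous_on ?C F" and contU: "continuous_on ?C U"
    using F U CA by (auto intro: holomorphic_on_imp_continuous_on holomorphic_on_subset)
  have "bounded (F ` ?C)" using compC contF by (intro compact_imp_bounded compact_continuous_image)
  then obtain B0 where B0: "\<And>t. norm t = R \<Longrightarrow> norm (F t) \<le> B0" unfolding bounded_iff by auto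
  define B where "B = max B0 1"
  have B: "0 < B" "\<And>t. norm t = R \<Longrightarrow> norm (F t) \<le> B" using B0 by (force simp: B_def)+
  define Q where "Q t = norm (F t) / B" for t
  have Q: "0 \<le> Q t" "norm t = R \<Longrightarrow> Q t \<le> 1" for t using B by (auto simp: Q_def)
  \<comment> \<open>Schwarz reflection in the circle \<open>|t| = R\<close>.\<close>
  define V where "V t = U t * cnj (U (R^2 / cnj t))" for t
  have inv: "R^2 / t \<in> ?A" if "t \<in> ?A" for t :: complex
  proof -
    have t: "s < norm t" "norm t * s < R^2" "0 < norm t"
      using that s by (auto simp: annulus_def less_divide_eq)
    then have "s < R^2 / norm t" by (simp add: less_divide_eq mult.commute)
    moreover have "R^2 / norm t < R^2 / s" using t s by (intro divide_strict_left_mono) auto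
    ultimately show ?thesis by (simp add: annulus_def norm_divide norm_power)
  qed
  \<comment> \<open>Conjugating both the argument and the value preserves holomorphy.\<close>
  have "V holomorphic_on ?A"
  proof -
    have "(\<lambda>t. U (R^2 / t)) holomorphic_on ?A"
    proof -
      have "(\<lambda>t. of_real (R^2) / t) holomorphic_on ?A"
        using s by (intro holomorphic_intros) (auto simp: zero_notin_annulus)
      moreover have "(\<lambda>t. of_real (R^2) / t) ` ?A \<subseteq> ?A" by (rule image_subsetI) (rule inv)
      ultimately have "(U \<circ> (\<lambda>t. of_real (R^2) / t)) holomorphic_on ?A"
        by (rule holomorphic_on_compose_gen[OF _ U])
      then show ?thesis unfolding o_def .
    qed
    moreover have "cnj ` ?A = ?A" unfolding image_cnj_conv_vimage_cnj by (auto simp: annulus_def)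
    ultimately have "(cnj \<circ> (\<lambda>t. U (R^2 / t)) \<circ> cnj) holomorphic_on ?A"
      by (intro holomorphic_on_compose_cnj_cnj) auto
    then show ?thesis unfolding V_def[abs_def] o_def by (intro holomorphic_intros U)
  qed
  then have hol: "(\<lambda>t. 1 - V t) holomorphic_on ?A" by (intro holomorphic_intros)
  have Vc: "1 - V t = of_real (1 - norm (U t) ^ 2)" if "norm t = R" for t
  proof -
    have "R^2 / cnj t = t"
    proof -
      have "t * cnj t = R^2" using complex_norm_square[of t] that by simp
      moreover have "t \<noteq> 0" using that s by auto
      ultimately show ?thesis by (metis complex_cnj_zero_iff nonzero_mult_div_cancel_right)
    qed
    then show ?thesis by (simp add: V_def flip: complex_norm_square)
  qed
  have nn: "0 \<le> 1 - norm (U t) ^ 2" if "norm t = R" for t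
    using le1[OF that] by (simp add: power_le_one)
  have local: "\<exists>e>0. \<exists>c>0. \<exists>n. \<forall>t. norm t = R \<and> dist t z < e \<longrightarrow> c * Q t ^ n \<le> 1 - norm (U t) ^ 2"
    if z: "norm z = R" for z
  proof (cases "norm (U z) = 1")
    case False
    then have z1: "0 < 1 - norm (U z) ^ 2" using le1[OF z] by (simp add: power_less_one_iff abs_square_less_1)
    have cont: "continuous_on ?C (\<lambda>t. 1 - norm (U t) ^ 2)" by (intro continuous_intros contU)
    have zC: "z \<in> ?C" using z by simp
    have half: "0 < (1 - norm (U z) ^ 2) / 2" using z1 by simp
    obtain e where e: "0 < e" "\<And>t. t \<in> ?C \<Longrightarrow> dist t z < e \<Longrightarrow>
        dist (1 - norm (U t) ^ 2) (1 - norm (U z) ^ 2) < (1 - norm (U z) ^ 2) / 2"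
      using cont[unfolded continuous_on_iff, rule_format, OF zC half] by blast
    have "(1 - norm (U z) ^ 2) / 2 * Q t ^ 0 \<le> 1 - norm (U t) ^ 2" if "norm t = R" "dist t z < e" for t
    proof -
      have "t \<in> ?C" using that by simp
      from e(2)[OF this that(2)] have "\<bar>(1 - norm (U t) ^ 2) - (1 - norm (U z) ^ 2)\<bar> < (1 - norm (U z) ^ 2) / 2"
        unfolding dist_real_def .
      moreover have "b / 2 \<le> a" if "\<bar>a - b\<bar> < b / 2" for a b :: real
        using that by (simp only: abs_less_iff) (simp add: field_simps)
      ultimately show ?thesis unfolding power_0 mult_1_right by blast
    qed
    then show ?thesis using e(1) half by blast
  next
    case True
    have nonconst: "\<not> (\<lambda>t. 1 - V t) constant_on ?A"
    proof
      assume "(\<lambda>t. 1 - V t) constant_on ?A"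
      then obtain y where y: "\<And>x. x \<in> ?A \<Longrightarrow> 1 - V x = y" unfolding constant_on_def by blast
      have "t1 \<in> ?A" "z \<in> ?A" using CA ex(1) z by auto
      then have "1 - V t1 = 1 - V z" using y by (simp only:)
      then have "of_real (1 - norm (U t1) ^ 2) = (of_real (1 - norm (U z) ^ 2) :: complex)"
        by (simp only: Vc ex z)
      then have "1 - norm (U t1) ^ 2 = 1 - norm (U z) ^ 2" by (rule of_real_eq_iff[THEN iffD1])
      then have "norm (U t1) ^ 2 = 1" using True by simp
      moreover have "norm (U t1) ^ 2 < 1 ^ 2" using ex by (intro power_strict_mono) auto
      ultimately show False by simp
    qed
    have zA: "z \<in> ?A" using CA z by auto
    have Vz: "1 - V z = 0" using Vc[OF z] True by simp
    obtain g r n where g: "0 < n" "0 < r" "ball z r \<subseteq> ?A" "g holomorphic_on ball z r"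
      "\<And>w. w \<in> ball z r \<Longrightarrow> 1 - V w = (w - z)^n * g w" "\<And>w. w \<in> ball z r \<Longrightarrow> g w \<noteq> 0"
      using holomorphic_factor_zero_nonconstant[OF hol open_annulus connected_annulus0 zA Vz nonconst] by metis
    have zr: "z \<in> ball z r" using g(2) by simp
    have cont: "continuous (at z) g"
      using holomorphic_on_imp_continuous_on[OF g(4)] zr by (simp add: continuous_on_eq_continuous_at)
    have gz: "norm (g z) / 2 > 0" using g(6)[OF zr] by simp
    obtain e1 where e1: "0 < e1" "\<And>w. dist w z < e1 \<Longrightarrow> dist (g w) (g z) < norm (g z) / 2"
      using cont[unfolded continuous_at_eps_delta, rule_format, OF gz] by blast
    have glow: "norm (g z) / 2 \<le> norm (g w)" if "dist w z < e1" for w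
      using e1(2)[OF that] norm_triangle_ineq2[of "g z" "g z - g w"] by (simp add: dist_norm norm_minus_commute)
    have "F field_differentiable (at z)"
      using F open_annulus zA holomorphic_on_imp_differentiable_at by blast
    then obtain D where "(F has_field_derivative D) (at z)" unfolding field_differentiable_def by blast
    then have "((\<lambda>w. norm ((F w - F z) / (w - z))) \<longlongrightarrow> norm D) (at z)"
      unfolding has_field_derivative_iff by (rule tendsto_norm)
    then have "\<forall>\<^sub>F w in at z. norm ((F w - F z) / (w - z)) < norm D + 1"
      by (rule order_tendstoD) simp
    then obtain e2 where e2: "0 < e2" "\<And>w. w \<noteq> z \<Longrightarrow> dist w z < e2 \<Longrightarrow> norm ((F w - F z) / (w - z)) < norm D + 1"
      unfolding eventually_at by auto
    have Fz: "F z = 0" using zero z True by blast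
    define l where "l = (norm D + 1) / B"
    have l: "0 < l" using B by (simp add: l_def add_nonneg_pos)
    have Ql: "Q w \<le> l * norm (w - z)" if "dist w z < e2" for w
    proof (cases "w = z")
      case False
      then have "norm (F w) \<le> (norm D + 1) * norm (w - z)"
        using e2(2)[OF False that] Fz by (simp add: norm_divide divide_less_eq)
      then show ?thesis using B by (simp add: Q_def l_def divide_right_mono)
    qed (simp add: Q_def Fz)
    define c where "c = norm (g z) / 2 / l ^ n"
    have "c * Q t ^ n \<le> 1 - norm (U t) ^ 2" if t: "norm t = R" "dist t z < min r (min e1 e2)" for t
    proof -
      have "c * Q t ^ n \<le> c * (l * norm (t - z)) ^ n"
        using gz l t Ql[of t] Q by (intro mult_left_mono power_mono) (auto simp: c_def)
      also have "\<dots> = norm (g z) / 2 * norm (t - z) ^ n" using l by (simp add: c_def power_mult_distrib)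
      also have "\<dots> \<le> norm (g t) * norm (t - z) ^ n"
        using glow[of t] t by (intro mult_right_mono) auto
      also have "\<dots> = norm (1 - V t)"
        using g(5)[of t] t by (simp add: dist_commute norm_mult norm_power mult.commute)
      also have "\<dots> = 1 - norm (U t) ^ 2" unfolding Vc[OF t(1)] norm_of_real using nn[OF t(1)] by simp
      finally show ?thesis .
    qed
    moreover have "0 < c" "0 < min r (min e1 e2)" using gz l g e1 e2 by (auto simp: c_def)
    ultimately show ?thesis by blast
  qed
  have "\<exists>c>0. \<exists>n. \<forall>t. norm t = R \<longrightarrow> c * Q t ^ n \<le> 1 - norm (U t) ^ 2"
  proof (rule ccontr)
    assume neg: "\<not> ?thesis"
    have "\<forall>m::nat. \<exists>t. norm t = R \<and> \<not> (1 / (real m + 1) * Q t ^ m \<le> 1 - norm (U t) ^ 2)"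
    proof
      fix m :: nat
      have "0 < 1 / (real m + 1)" by simp
      then show "\<exists>t. norm t = R \<and> \<not> (1 / (real m + 1) * Q t ^ m \<le> 1 - norm (U t) ^ 2)" using neg by blast
    qed
    then obtain f where f: "\<And>m. norm (f m) = R" "\<And>m. \<not> (1 / (real m + 1) * Q (f m) ^ m \<le> 1 - norm (U (f m)) ^ 2)"
      by metis
    obtain z r where z: "z \<in> ?C" "strict_mono (r :: nat \<Rightarrow> nat)" "(f \<circ> r) \<longlonglongrightarrow> z"
      using seq_compactE[OF compact_imp_seq_compact[OF compC], of f] f(1) by auto
    obtain e c n where e: "0 < e" "0 < c" "\<And>t. norm t = R \<Longrightarrow> dist t z < e \<Longrightarrow> c * Q t ^ n \<le> 1 - norm (U t) ^ 2"
      using local[of z] z(1) by auto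
    have "\<forall>\<^sub>F m in sequentially. dist (f (r m)) z < e"
      using tendstoD[OF z(3) e(1)] by (simp add: o_def)
    moreover have "\<forall>\<^sub>F m in sequentially. max n (nat \<lceil>1 / c\<rceil>) \<le> m" by (rule eventually_ge_at_top)
    ultimately obtain m where m: "dist (f (r m)) z < e" "n \<le> m" "nat \<lceil>1 / c\<rceil> \<le> m"
      using eventually_happens[OF eventually_conj] by fastforce
    have rm: "m \<le> r m" using z(2) by (rule seq_suble)
    have "1 / (real (r m) + 1) \<le> c"
    proof -
      have "1 / c \<le> real m" using m(3) by linarith
      then have "1 / c \<le> real (r m) + 1" using rm by linarith
      then show ?thesis using e(2) by (simp add: field_simps)
    qed
    moreover have "Q (f (r m)) ^ r m \<le> Q (f (r m)) ^ n" using Q f(1) m(2) rm by (intro power_decreasing) auto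
    ultimately have "1 / (real (r m) + 1) * Q (f (r m)) ^ r m \<le> c * Q (f (r m)) ^ n"
      using Q e(2) by (intro mult_mono) auto
    then show False using e(3)[OF f(1) m(1)] f(2)[of "r m"] by linarith
  qed
  then show ?thesis using B unfolding Q_def by blast
qed

text \<open>Transfers estimates from the boundary circle to slightly smaller circles.\<close>

lemma radial_lipschitz:
  assumes F: "F holomorphic_on annulus s S" and s: "0 < s" "s < r0" "r0 < R" "R < S"
  shows "\<exists>C\<ge>0. \<forall>t c. norm t = R \<and> r0 / R \<le> c \<and> c \<le> 1 \<longrightarrow> norm (F (of_real c * t) - F t) \<le> C * (1 - c)"
proof -
  let ?K = "cball 0 R - ball 0 r0 :: complex set"
  have K: "?K \<subseteq> annulus s S" using s by (auto simp: annulus_def)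
  have "compact ?K" by (intro compact_diff) auto
  then have "bounded (deriv F ` ?K)"
    using holomorphic_on_imp_continuous_on[OF holomorphic_on_subset[OF holomorphic_deriv[OF F open_annulus] K]]
    by (intro compact_imp_bounded compact_continuous_image)
  then obtain B where B: "\<And>t. t \<in> ?K \<Longrightarrow> norm (deriv F t) \<le> B" unfolding bounded_iff by (metis image_eqI)
  have B0: "0 \<le> B" using B[of "of_real R"] s by (auto intro: order_trans[OF norm_ge_zero])
  have "norm (F (of_real c * t) - F t) \<le> B * R * (1 - c)" if t: "norm t = R" "r0 / R \<le> c" "c \<le> 1" for t c
  proof -
    have "0 < r0 / R" using s by simp
    then have c0: "0 < c" "r0 \<le> c * R" using t s by (linarith, simp add: divide_le_eq)
    have seg: "closed_segment (of_real c * t) t \<subseteq> ?K"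
    proof
      fix z assume "z \<in> closed_segment (of_real c * t) t"
      then obtain u where u: "0 \<le> u" "u \<le> 1" "z = (1 - u) *\<^sub>R (of_real c * t) + u *\<^sub>R t"
        by (auto simp: closed_segment_def)
      define w where "w = (1 - u) * c + u"
      have "z = of_real w * t" by (simp add: u(3) w_def scaleR_conv_of_real algebra_simps)
      then have "norm z = \<bar>w\<bar> * R" using t by (simp add: norm_mult)
      moreover have "c \<le> w" "w \<le> 1"
      proof -
        have "0 \<le> u * (1 - c)" "0 \<le> (1 - u) * (1 - c)" using u t by auto
        then show "c \<le> w" "w \<le> 1" by (auto simp: w_def algebra_simps)
      qed
      ultimately have "c * R \<le> norm z" "norm z \<le> R" using c0 s by (auto simp: mult_le_cancel_right1)
      then show "z \<in> ?K" using c0 by auto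
    qed
    have "norm (F (of_real c * t) - F t) \<le> B * norm (of_real c * t - t)"
    proof (rule field_differentiable_bound[of "closed_segment (of_real c * t) t" F "deriv F"])
      fix z assume "z \<in> closed_segment (of_real c * t) t"
      then have z: "z \<in> ?K" using seg by blast
      then show "(F has_field_derivative deriv F z) (at z within closed_segment (of_real c * t) t)"
        using holomorphic_derivI[OF F open_annulus] K by blast
      show "norm (deriv F z) \<le> B" using B z by blast
    qed auto
    also have "norm (of_real c * t - t) = R * (1 - c)"
    proof -
      have "of_real c * t - t = of_real (c - 1) * t" by (simp add: algebra_simps)
      then have "norm (of_real c * t - t) = \<bar>c - 1\<bar> * R" by (simp only: norm_mult norm_of_real t(1))
      then show ?thesis using t(3) by simp
    qed
    finally show ?thesis by (simp add: mult.assoc)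
  qed
  then show ?thesis using B0 s by (intro exI[of _ "B * R"]) auto
qed

text \<open>From the quadratic term of the exponential series.\<close>

lemma square_mult_exp_le: "0 \<le> y \<Longrightarrow> y^2 * exp (- y / 2) \<le> (8::real)"
proof -
  assume y: "0 \<le> y"
  have "(y / 2)^2 / 2 \<le> exp (y / 2)" using exp_lower_Taylor_quadratic[of "y / 2"] y by simp
  then have "y^2 \<le> 8 * exp (y / 2)" by (simp add: power2_eq_square)
  then have "y^2 * exp (- y / 2) \<le> 8 * exp (y / 2) * exp (- y / 2)" by (rule mult_right_mono) simp
  then show ?thesis by (simp add: mult.assoc flip: exp_add)
qed

text \<open>Here \<open>u\<close> and \<open>p\<close> are the moduli of the symbol and of the polynomial at a boundary point; the
  perturbations of order \<open>1/k\<close> come from moving to the circle of radius \<open>R (1 - 1/k)\<close>. Where \<open>p\<close> is not small,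
  \<open>u\<^sup>k\<close> is exponentially small in \<open>k (1 - u\<^sup>2)\<close>; the power \<open>2 n\<close> of \<open>p\<close> is dominated by
  \<open>(1 - u\<^sup>2)\<^sup>2\<close>, and the product of the two is of order \<open>1/k\<^sup>2\<close>. The two additional
  factors make the perturbation itself of this order even if \<open>n = 0\<close>.\<close>

lemma perturbed_product_bound:
  fixes p u B c C1 C2 :: real
  assumes u: "0 \<le> u" "u \<le> 1" and p: "0 \<le> p" "p \<le> B" "0 < B" and c: "0 < c" "c * (p / B) ^ n \<le> 1 - u^2"
    and C: "0 \<le> C1" "0 \<le> C2" and k: "1 \<le> (k::nat)"
  shows "(p + C2 / k) ^ (2 * n + 2) * (u + C1 / k) ^ k \<le>
    2 ^ (2 * n + 2) * (B ^ (2 * n + 2) * 8 / c^2 + C2 ^ (2 * n + 2)) * exp C1 / real k ^ 2"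
proof -
  define N where "N = 2 * n + 2"
  define d where "d = 1 - u^2"
  have d: "0 \<le> d" using u by (simp add: d_def power_le_one)
  have k0: "0 < real k" using k by simp
  have u2: "u \<le> 1 - d / 2"
  proof -
    have "1 - d / 2 - u = (1 - u)^2 / 2" by (simp add: d_def power2_eq_square field_simps)
    moreover have "0 \<le> (1 - u)^2 / 2" by simp
    ultimately show ?thesis by linarith
  qed
  have "(u + C1 / k) ^ k \<le> exp (- d / 2 + C1 / k) ^ k"
  proof (rule power_mono)
    have "u + C1 / k \<le> 1 + (- d / 2 + C1 / k)" using u2 by simp
    also have "\<dots> \<le> exp (- d / 2 + C1 / k)" by (rule exp_ge_add_one_self)
    finally show "u + C1 / k \<le> exp (- d / 2 + C1 / k)" .
  qed (use u C in auto)
  also have "\<dots> = exp C1 * exp (- (k * d) / 2)"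
  proof -
    have "real k * (- d / 2 + C1 / k) = C1 + (- (k * d) / 2)" using k0 by (simp add: field_simps)
    then show ?thesis by (simp add: exp_of_nat_mult[symmetric] exp_add[symmetric])
  qed
  finally have U: "(u + C1 / k) ^ k \<le> exp C1 * exp (- (k * d) / 2)" .
  have "(p + C2 / k) ^ N \<le> (2 * max p (C2 / k)) ^ N"
    using p C by (intro power_mono) auto
  also have "\<dots> = 2 ^ N * max p (C2 / k) ^ N" by (rule power_mult_distrib)
  also have "\<dots> \<le> 2 ^ N * (p ^ N + (C2 / k) ^ N)"
    using p C by (intro mult_left_mono) (auto simp: max_def)
  finally have P: "(p + C2 / k) ^ N \<le> 2 ^ N * (p ^ N + (C2 / k) ^ N)" .
  have pN: "p ^ N \<le> B ^ N * (d^2 / c^2)"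
  proof -
    have "(p / B) ^ N \<le> (p / B) ^ (2 * n)" using p by (intro power_decreasing) (auto simp: N_def)
    also have "\<dots> = ((p / B) ^ n) ^ 2" by (simp add: power_mult[symmetric] mult.commute)
    also have "\<dots> \<le> (d / c) ^ 2" using c p by (intro power_mono) (auto simp: d_def field_simps)
    finally have "p ^ N / B ^ N \<le> d^2 / c^2" by (simp add: power_divide)
    then show ?thesis using p by (simp add: divide_le_eq mult.commute)
  qed
  have CN: "(C2 / k) ^ N \<le> C2 ^ N / real k ^ 2"
  proof -
    have "real k ^ 2 \<le> real k ^ N" using k by (intro power_increasing) (auto simp: N_def)
    then show ?thesis using C k0 by (simp add: power_divide frac_le)
  qed
  have "exp (- (k * d) / 2) \<le> 1" using d k0 by simp
  then have e2: "C2 ^ N / real k ^ 2 * exp (- (k * d) / 2) \<le> C2 ^ N / real k ^ 2"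
    by (rule mult_left_le) (use C in simp)
  have e1: "B ^ N * (d^2 / c^2) * exp (- (k * d) / 2) \<le> B ^ N * 8 / c^2 / real k ^ 2"
  proof -
    have "(k * d)^2 * exp (- (k * d) / 2) \<le> 8" using d k0 by (intro square_mult_exp_le) auto
    then have "d^2 * exp (- (k * d) / 2) \<le> 8 / real k ^ 2" using k0 by (simp add: field_simps power_mult_distrib)
    then have "(B ^ N / c^2) * (d^2 * exp (- (k * d) / 2)) \<le> (B ^ N / c^2) * (8 / real k ^ 2)"
      using p by (intro mult_left_mono) auto
    then show ?thesis by (simp add: mult_ac)
  qed
  have "(p + C2 / k) ^ N * (u + C1 / k) ^ k \<le>
      2 ^ N * (B ^ N * (d^2 / c^2) + C2 ^ N / real k ^ 2) * (exp C1 * exp (- (k * d) / 2))"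
  proof (rule mult_mono[OF _ U])
    show "(p + C2 / k) ^ N \<le> 2 ^ N * (B ^ N * (d^2 / c^2) + C2 ^ N / real k ^ 2)"
      by (rule order_trans[OF P]) (intro mult_left_mono add_mono pN CN, simp)
  qed (use p C u k0 in auto)
  also have "\<dots> = 2 ^ N * exp C1 * (B ^ N * (d^2 / c^2) * exp (- (k * d) / 2) + C2 ^ N / real k ^ 2 * exp (- (k * d) / 2))"
    by (simp only: algebra_simps)
  also have "\<dots> \<le> 2 ^ N * exp C1 * (B ^ N * 8 / c^2 / real k ^ 2 + C2 ^ N / real k ^ 2)"
    by (intro mult_left_mono add_mono e1 e2) simp
  also have "\<dots> = 2 ^ N * (B ^ N * 8 / c^2 + C2 ^ N) * exp C1 / real k ^ 2"
    by (simp only: add_divide_distrib[symmetric]) (simp add: mult_ac)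
  finally show ?thesis unfolding N_def .
qed

section \<open>Bounded orbits and generalised eigenfunctions\<close>

context growth begin

lemma cauchy_cmult:
  assumes s: "0 < s" "s < r" "r < R" and H: "symmetric_on_annulus s H" and f: "tempered f"
  shows "cauchy H (\<lambda>x. c * f x) x r = c * cauchy H f x r"
    and "cauchy (\<lambda>t. c * H t) f x r = c * cauchy H f x r"
  using cauchy_diff_cmult[OF s H f f, of "1 - c" x] cauchy_symbol_diff_cmult[OF s H H f, of "1 - c" x]
  by (simp_all add: algebra_simps)

lemma symmetric_symbol:
  assumes "0 < s" "\<And>n. norm (\<kappa> n) \<le> C * (s / sqrt q) ^ n"
  shows "symmetric_on_annulus s (symbol \<kappa>)"
  using holomorphic_symbol[OF assms] by (simp add: symmetric_on_annulus_def symbol_def joukowski_inverse)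

text \<open>Going back \<open>k\<close> steps in the orbit is paid for by \<open>k\<close> factors of the normalised symbol.\<close>

lemma cauchy_iterate:
  fixes f :: "int \<Rightarrow> 'a \<Rightarrow> complex"
  assumes s: "0 < s" "s < r" "r < R" and K: "\<And>n. norm (\<kappa> n) \<le> C * (s / sqrt q) ^ n"
    and H: "symmetric_on_annulus s H" and f: "\<And>k. tempered (f k)" and A: "A \<noteq> 0"
    and orbit: "\<And>k. conv \<kappa> (f k) = (\<lambda>x. A * f (k + 1) x)"
  shows "cauchy H (f j) x r = cauchy (\<lambda>t. (symbol \<kappa> t / A) ^ k * H t) (f (j - int k)) x r"
proof (induction k)
  case (Suc k)
  let ?H = "\<lambda>t. (symbol \<kappa> t / A) ^ k * H t"
  let ?j = "j - int (Suc k)"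
  have sym: "symmetric_on_annulus s ?H"
    unfolding divide_inverse using s K
    by (intro symmetric_mult symmetric_power symmetric_const H symmetric_symbol) auto
  have "A * cauchy ?H (f (j - int k)) x r = cauchy ?H (conv \<kappa> (f ?j)) x r"
    using cauchy_cmult(1)[OF s sym f] orbit[of ?j] by simp
  also have "\<dots> = cauchy (\<lambda>t. symbol \<kappa> t * ?H t) (f ?j) x r"
    by (rule cauchy_conv[OF s K f sym])
  also have "\<dots> = cauchy (\<lambda>t. A * ((symbol \<kappa> t / A) ^ Suc k * H t)) (f ?j) x r"
    using A by (simp add: mult.assoc)
  also have "\<dots> = A * cauchy (\<lambda>t. (symbol \<kappa> t / A) ^ Suc k * H t) (f ?j) x r"
  proof (rule cauchy_cmult(2)[OF s _ f])
    show "symmetric_on_annulus s (\<lambda>t. (symbol \<kappa> t / A) ^ Suc k * H t)"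
      unfolding divide_inverse using s K
      by (intro symmetric_mult symmetric_power symmetric_const H symmetric_symbol) auto
  qed
  finally show ?case using A Suc.IH by simp
qed simp

text \<open>The functional calculus represents the left-hand side on the circle of radius \<open>R (1 - 1/k)\<close>,
  with the symbol \<open>U\<^sup>k F\<^sup>N\<close> acting on \<open>f\<^bsub>-k\<^esub>\<close>. The symbol is of order \<open>1/k\<^sup>2\<close>, the
  resolvent of order \<open>k\<close>, and \<open>k\<close> is arbitrary.\<close>

lemma bounded_orbit_annihilated:
  fixes f :: "int \<Rightarrow> 'a \<Rightarrow> complex"
  assumes s: "0 < s" "s < R" and K: "\<And>n. norm (\<kappa> n) \<le> C * (s / sqrt q) ^ n"
    and f: "\<And>k. sphere_bound M (f k)" and A: "A \<noteq> 0"
    and orbit: "\<And>k. conv \<kappa> (f k) = (\<lambda>x. A * f (k + 1) x)"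
    and le: "\<And>t. norm t = R \<Longrightarrow> norm (symbol \<kappa> t) \<le> norm A"
    and ex: "norm t1 = R" "norm (symbol \<kappa> t1) < norm A"
    and P: "\<And>t. norm t = R \<Longrightarrow> norm (symbol \<kappa> t) = norm A \<Longrightarrow> poly P (lap_value t) = 0"
  shows "\<exists>N. poly_lap (P ^ N) (f 0) = (\<lambda>x. 0)"
proof -
  define U where "U t = symbol \<kappa> t / A" for t
  define F where "F t = poly P (lap_value t)" for t
  have s1: "s < 1" using s R_less_1 by simp
  have symU: "symmetric_on_annulus s U"
    unfolding U_def[abs_def] divide_inverse using s K
    by (intro symmetric_mult symmetric_const symmetric_symbol) auto
  have symF: "symmetric_on_annulus s F"
    unfolding F_def[abs_def] using s by (intro symmetric_poly_lap_value) simp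
  have hol: "U holomorphic_on annulus s (1 / s)" "F holomorphic_on annulus s (1 / s)"
    using symU symF by (auto simp: symmetric_on_annulus_def)
  have R2: "R^2 \<le> 1" using R_pos R_less_1 by (simp add: power_le_one)
  have sub: "annulus s (R^2 / s) \<subseteq> annulus s (1 / s)"
    using s divide_right_mono[OF R2, of s] by (auto simp: annulus_def)
  have U1: "norm (U t) \<le> 1" if "norm t = R" for t
    using le[OF that] A by (simp add: U_def norm_divide)
  have "\<exists>c>0. \<exists>n. \<exists>B>0. \<forall>t. norm t = R \<longrightarrow>
      norm (F t) \<le> B \<and> c * (norm (F t) / B) ^ n \<le> 1 - norm (U t) ^ 2"
  proof (rule lojasiewicz_circle[OF s])
    show "U holomorphic_on annulus s (R^2 / s)" "F holomorphic_on annulus s (R^2 / s)"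
      using hol sub by (auto intro: holomorphic_on_subset)
    show "norm (U t1) < 1" using ex A by (simp add: U_def norm_divide)
    show "F t = 0" if "norm t = R" "norm (U t) = 1" for t
      using P[OF that(1)] that A by (simp add: F_def U_def norm_divide)
  qed (use U1 ex in auto)
  then obtain c n B where L: "0 < c" "0 < B" "\<And>t. norm t = R \<Longrightarrow> norm (F t) \<le> B"
    "\<And>t. norm t = R \<Longrightarrow> c * (norm (F t) / B) ^ n \<le> 1 - norm (U t) ^ 2" by blast
  obtain r0 where r0: "s < r0" "r0 < R" using s dense by blast
  have R1s: "R < 1 / s" using R_less_1 s s1 less_trans[of R 1 "1 / s"] by simp
  obtain C1 where C1: "0 \<le> C1" "\<And>t c. norm t = R \<Longrightarrow> r0 / R \<le> c \<Longrightarrow> c \<le> 1 \<Longrightarrow>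
      norm (U (of_real c * t) - U t) \<le> C1 * (1 - c)"
    using radial_lipschitz[OF hol(1) s(1) r0 R1s] by blast
  obtain C2 where C2: "0 \<le> C2" "\<And>t c. norm t = R \<Longrightarrow> r0 / R \<le> c \<Longrightarrow> c \<le> 1 \<Longrightarrow>
      norm (F (of_real c * t) - F t) \<le> C2 * (1 - c)"
    using radial_lipschitz[OF hol(2) s(1) r0 R1s] by blast
  obtain W where W: "0 \<le> W" "\<And>t. r0 \<le> norm t \<Longrightarrow> norm t \<le> R \<Longrightarrow> norm (weight t) \<le> W"
  proof -
    let ?K = "cball 0 R - ball 0 r0 :: complex set"
    have "?K \<subseteq> annulus 0 (sqrt q)" using s r0 R_less_sqrt_q by (auto simp: annulus_def)
    then have "bounded (weight ` ?K)"
      by (intro compact_imp_bounded compact_continuous_image holomorphic_on_imp_continuous_on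
          holomorphic_on_subset[OF holomorphic_weight] compact_diff) auto
    then obtain W where "\<And>t. t \<in> ?K \<Longrightarrow> norm (weight t) \<le> W" unfolding bounded_iff by (metis image_eqI)
    then show ?thesis using that[of "max W 0"] by fastforce
  qed
  \<comment> \<open>The exponent for which \<open>perturbed_product_bound\<close> gives the order \<open>1/k\<^sup>2\<close>.\<close>
  define N where "N = 2 * n + 2"
  define C3 where "C3 = 2 ^ N * (B ^ N * 8 / c^2 + C2 ^ N) * exp C1"
  have C30: "0 \<le> C3" using L C2 by (simp add: C3_def)
  have M0: "0 \<le> M" using f[of 0] by (rule sphere_bound_nonneg)
  have tf: "tempered (f k)" for k using f tempered_def by blast
  have bound: "norm (poly_lap (P ^ N) (f 0) x) \<le> C3 * W * M / real k"
    if k: "nat \<lceil>R / (R - r0)\<rceil> + 1 \<le> k" for k x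
  proof -
    have k0: "0 < real k" "1 \<le> k" using k by auto
    have "R / (R - r0) < real k" using k by linarith
    then have Rk: "R / real k < R - r0" using k0 r0 by (simp add: field_simps)
    define \<theta> where "\<theta> = 1 - 1 / real k"
    have "R * \<theta> = R - R / real k" by (simp add: \<theta>_def right_diff_distrib)
    then have "r0 < R * \<theta>" using Rk by linarith
    define r where "r = R * \<theta>"
    have r: "r0 < r" "r < R" using \<open>r0 < R * \<theta>\<close> R_pos k0 by (auto simp: r_def \<theta>_def)
    have sr: "0 < s" "s < r" "r < R" using s r r0 by auto
    have \<theta>: "r0 / R \<le> \<theta>" "\<theta> \<le> 1" "0 < \<theta>"
    proof -
      show "r0 / R \<le> \<theta>" using r R_pos by (simp add: r_def divide_le_eq mult.commute)
      show "\<theta> \<le> 1" using k0 by (simp add: \<theta>_def)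
      show "0 < \<theta>" using sr R_pos by (auto simp: r_def zero_less_mult_iff dest: less_trans)
    qed
    let ?H = "\<lambda>t. U t ^ k * F t ^ N"
    have symH: "symmetric_on_annulus s ?H" by (intro symmetric_mult symmetric_power symU symF)
    have H: "norm (?H t * weight t) \<le> C3 / real k^2 * W" if t: "norm t = r" for t
    proof -
      define t0 where "t0 = t / of_real \<theta>"
      have t0: "norm t0 = R" "t = of_real \<theta> * t0" using t \<theta> by (auto simp: t0_def r_def norm_divide)
      have u: "norm (U t) \<le> norm (U t0) + C1 / k"
        using C1(2)[OF t0(1) \<theta>(1,2)] norm_triangle_ineq2[of "U t" "U t0"] by (simp add: t0(2) \<theta>_def)
      have p: "norm (F t) \<le> norm (F t0) + C2 / k"
        using C2(2)[OF t0(1) \<theta>(1,2)] norm_triangle_ineq2[of "F t" "F t0"] by (simp add: t0(2) \<theta>_def)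
      have "norm (?H t) = norm (F t) ^ N * norm (U t) ^ k" by (simp add: norm_mult norm_power mult.commute)
      also have "\<dots> \<le> (norm (F t0) + C2 / k) ^ N * (norm (U t0) + C1 / k) ^ k"
        using u p C1 C2 k0 by (intro mult_mono power_mono) auto
      also have "\<dots> \<le> C3 / real k^2"
        unfolding C3_def N_def
        by (intro perturbed_product_bound) (use L U1 t0 C1 C2 k0 in auto)
      finally show ?thesis
        unfolding norm_mult[of "?H t"] using W(1) W(2)[of t] t r C30 by (intro mult_mono) auto
    qed
    have "poly_lap (P ^ N) (f 0) x = cauchy (\<lambda>_. 1) (poly_lap (P ^ N) (f 0)) x r"
      by (rule cauchy_one[OF sr, symmetric]) (intro tempered_poly_lap tf)
    also have "\<dots> = cauchy (\<lambda>t. poly (P ^ N) (lap_value t) * 1) (f 0) x r"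
      by (rule cauchy_poly_lap[OF sr symmetric_const tf])
    also have "(\<lambda>t. poly (P ^ N) (lap_value t) * 1) = (\<lambda>t. F t ^ N)" by (simp add: F_def)
    also have "cauchy (\<lambda>t. F t ^ N) (f 0) x r = cauchy ?H (f (0 - int k)) x r"
      unfolding U_def by (rule cauchy_iterate[where f = f and \<kappa> = \<kappa> and A = A, OF sr K symmetric_power[OF symF] tf A orbit])
    finally have "norm (poly_lap (P ^ N) (f 0) x) \<le> C3 / real k^2 * W * M / (1 - r / R)"
      using norm_cauchy_le[OF sr symH f H] by simp
    also have "1 - r / R = 1 / real k" using R_pos by (simp add: r_def \<theta>_def)
    also have "C3 / real k^2 * W * M / (1 / real k) = C3 * W * M / real k"
      using k0 by (simp add: power2_eq_square)
    finally show ?thesis .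
  qed
  have "poly_lap (P ^ N) (f 0) x = 0" for x
  proof -
    have "(\<lambda>k. C3 * W * M / real k) \<longlonglongrightarrow> 0" by (rule lim_const_over_n)
    moreover have "\<forall>\<^sub>F k in sequentially. norm (poly_lap (P ^ N) (f 0) x) \<le> C3 * W * M / real k"
      by (rule eventually_mono[OF eventually_ge_at_top]) (rule bound)
    ultimately have "norm (poly_lap (P ^ N) (f 0) x) \<le> 0"
      using sequentially_bot by (rule tendsto_lowerbound)
    then show ?thesis by simp
  qed
  then show ?thesis by blast
qed

lemma green_L:
  assumes f: "tempered f" and t: "norm t < R" "t \<noteq> 0"
  shows "green (L f) x t = lap_value t * green f x t +
    of_real (sqrt q) / of_nat (q + 1) / t * (1 - t^2 / of_nat q) * f x"
proof -
  have "green (L f) x t = green f x t - inverse (of_nat (q + 1)) * green (ssum (Suc 0) f) x t"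
    using green_add[OF f tempered_cmult[OF tempered_ssum_1[OF f], of "- inverse (of_nat (q + 1))"] t(1), of x]
      green_cmult[OF tempered_ssum_1[OF f] t(1), of "- inverse (of_nat (q + 1))" x]
    by (simp add: L_eq[abs_def] del: of_nat_add of_nat_Suc)
  then show ?thesis
    unfolding green_resolvent[OF f t] lap_value_def
    by (simp add: divide_inverse algebra_simps del: of_nat_add of_nat_Suc)
qed

lemma norm_lap_value_radial:
  assumes "norm t0 = R" "1 / 2 \<le> \<theta>" "\<theta> \<le> 1"
  shows "norm (lap_value (of_real \<theta> * t0) - lap_value t0) \<le> (sqrt q * (1 + 2 / R)) * (1 - \<theta>)"
proof -
  have t0: "t0 \<noteq> 0" using assms R_pos by auto
  have th: "0 < \<theta>" using assms by simp
  have "lap_value (of_real \<theta> * t0) - lap_value t0 =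
      of_real (sqrt q) / of_nat (q + 1) * (of_real (1 - \<theta>) * (t0 - inverse (of_real \<theta> * t0)))"
  proof -
    have "joukowski t0 - joukowski (of_real \<theta> * t0) =
        of_real (sqrt q) * (of_real (1 - \<theta>) * (t0 - inverse (of_real \<theta> * t0)))"
      using t0 th by (simp add: joukowski_def field_simps)
    moreover have "lap_value (of_real \<theta> * t0) - lap_value t0 =
        (joukowski t0 - joukowski (of_real \<theta> * t0)) / of_nat (q + 1)"
      by (simp add: lap_value_def diff_divide_distrib del: of_nat_add of_nat_Suc)
    ultimately show ?thesis by (simp only: times_divide_eq_left)
  qed
  moreover have "norm (of_real (sqrt q) / of_nat (q + 1) * (of_real (1 - \<theta>) * (t0 - inverse (of_real \<theta> * t0)))) =
      sqrt q / real (q + 1) * ((1 - \<theta>) * norm (t0 - inverse (of_real \<theta> * t0)))"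
    unfolding norm_mult norm_divide norm_of_nat norm_of_real using assms by simp
  moreover have "sqrt q / real (q + 1) * ((1 - \<theta>) * norm (t0 - inverse (of_real \<theta> * t0))) \<le>
      sqrt q * ((1 - \<theta>) * (1 + 2 / R))"
  proof (intro mult_mono)
    show "sqrt q / real (q + 1) \<le> sqrt q" by (simp add: divide_le_eq algebra_simps)
    have "norm (t0 - inverse (of_real \<theta> * t0)) \<le> norm t0 + norm (inverse (of_real \<theta> * t0))"
      by (rule norm_triangle_ineq4)
    also have "norm (inverse (of_real \<theta> * t0)) \<le> 2 / R"
    proof -
      have "1 / \<theta> \<le> 2" using assms th by (simp add: divide_le_eq)
      then have "1 / \<theta> / R \<le> 2 / R" using R_pos by (intro divide_right_mono) auto
      moreover have "norm (inverse (of_real \<theta> * t0)) = 1 / \<theta> / R"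
        unfolding norm_inverse norm_mult norm_of_real assms(1) using th by (simp add: field_simps)
      ultimately show ?thesis by (simp only:)
    qed
    finally show "norm (t0 - inverse (of_real \<theta> * t0)) \<le> 1 + 2 / R" using assms R_less_1 by simp
  qed (use assms R_pos in auto)
  ultimately have "norm (lap_value (of_real \<theta> * t0) - lap_value t0) \<le> sqrt q * ((1 - \<theta>) * (1 + 2 / R))"
    by (simp only:)
  then show ?thesis by (simp only: mult_ac)
qed

text \<open>Let \<open>l = lap_value t\<^sub>0\<close>. Two applications of the resolvent equation express \<open>(L - l) h\<close> through
  \<open>(l - lap_value t)\<^sup>2 green h x t\<close> and terms that tend to zero as \<open>t\<close> approaches
  \<open>t\<^sub>0\<close> radially. The former tends to zero as well, since the square is of second order in
  \<open>1 - |t|/R\<close> and \<open>green\<close> is at most of order \<open>-1\<close>.\<close>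

lemma no_generalized_eigenfunctions:
  assumes h: "tempered h" and t0: "norm t0 = R"
    and gen: "poly_lap ([:- lap_value t0, 1:]^2) h = (\<lambda>x. 0)"
  shows "poly_lap [:- lap_value t0, 1:] h = (\<lambda>x. 0)"
proof
  fix x
  let ?l = "lap_value t0"
  define h1 where "h1 = (\<lambda>x. L h x - ?l * h x)"
  have h1: "poly_lap [:- ?l, 1:] h = h1" by (rule ext) (simp add: h1_def)
  have "poly_lap [:- ?l, 1:] h1 = (\<lambda>x. 0)" using gen unfolding power2_eq_square poly_lap_mult h1 .
  then have Lh1: "L h1 = (\<lambda>x. ?l * h1 x)" by (simp add: fun_eq_iff)
  have th1: "tempered h1" unfolding h1_def by (intro tempered_diff tempered_cmult tempered_L h)
  define k where "k t = of_real (sqrt q) / of_nat (q + 1) / t * (1 - t^2 / of_nat q)" for t :: complex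
  have t00: "t0 \<noteq> 0" using t0 R_pos by auto
  obtain C where C: "sphere_bound C h" using h by (auto simp: tempered_def)
  define B where "B = sqrt q * (1 + 2 / R)"
  \<comment> \<open>A radial approach, so that \<open>|t - t\<^sub>0| = R - |t|\<close>; the shift by 2 keeps \<open>T j\<close> in the outer half.\<close>
  define T where "T j = of_real (1 - 1 / real (j + 2)) * t0" for j :: nat
  have eq: "k t * h1 x = (?l - lap_value t) * (k t * h x) - (?l - lap_value t)^2 * green h x t"
    if t: "norm t < R" "t \<noteq> 0" for t
  proof -
    have "green h1 x t = green (L h) x t - ?l * green h x t"
      using green_add[OF tempered_L[OF h] tempered_cmult[OF h, of "- ?l"] t(1), of x] green_cmult[OF h t(1), of "- ?l" x]
      by (simp add: h1_def)
    then have g1: "green h1 x t = (lap_value t - ?l) * green h x t + k t * h x"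
      unfolding green_L[OF h t] k_def by (simp add: algebra_simps)
    have "?l * green h1 x t = lap_value t * green h1 x t + k t * h1 x"
      using green_L[OF th1 t, of x] green_cmult[OF th1 t(1), of ?l x] unfolding Lh1 k_def by simp
    then have "k t * h1 x = (?l - lap_value t) * green h1 x t" by (simp add: algebra_simps)
    then show ?thesis unfolding g1 by (simp add: algebra_simps power2_eq_square)
  qed
  have T: "norm (T j) < R" "T j \<noteq> 0" "norm (T j) = R * (1 - 1 / real (j + 2))" for j
  proof -
    have th: "0 < 1 - 1 / real (j + 2)" by simp
    then show n: "norm (T j) = R * (1 - 1 / real (j + 2))" using t0 unfolding T_def norm_mult norm_of_real by simp
    show "T j \<noteq> 0" using th t00 unfolding T_def by (simp only: mult_eq_0_iff of_real_eq_0_iff) auto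
    show "norm (T j) < R" unfolding n using R_pos by simp
  qed
  have lim_inv: "(\<lambda>j. 1 / real (j + 2)) \<longlonglongrightarrow> 0"
    using LIMSEQ_ignore_initial_segment[OF lim_const_over_n[of 1], of 2] by simp
  have "T \<longlonglongrightarrow> of_real (1 - 0) * t0"
    unfolding T_def[abs_def] by (intro tendsto_intros lim_inv)
  then have Tl: "T \<longlonglongrightarrow> t0" by simp
  have rad: "norm (?l - lap_value (T j)) \<le> B * (1 / real (j + 2))" for j
  proof -
    have "norm (lap_value (T j) - ?l) \<le> B * (1 - (1 - 1 / real (j + 2)))"
      unfolding T_def B_def by (rule norm_lap_value_radial[OF t0]) (simp_all add: field_simps)
    then show ?thesis by (simp add: norm_minus_commute)
  qed
  have d0: "(\<lambda>j. ?l - lap_value (T j)) \<longlonglongrightarrow> 0"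
  proof (rule Lim_null_comparison)
    show "\<forall>\<^sub>F j in sequentially. norm (?l - lap_value (T j)) \<le> B * (1 / real (j + 2))" using rad by simp
    show "(\<lambda>j. B * (1 / real (j + 2))) \<longlonglongrightarrow> 0" using tendsto_mult_right_zero[OF lim_inv] .
  qed
  have g0: "(\<lambda>j. (?l - lap_value (T j))^2 * green h x (T j)) \<longlonglongrightarrow> 0"
  proof (rule Lim_null_comparison)
    have "norm ((?l - lap_value (T j))^2 * green h x (T j)) \<le> B^2 * C * (1 / real (j + 2))" for j
    proof -
      have "norm (green h x (T j)) \<le> C / (1 - norm (T j) / R)" by (rule norm_green_le[OF C T(1)])
      also have "1 - norm (T j) / R = 1 / real (j + 2)" unfolding T(3) using R_pos by simp
      finally have "norm ((?l - lap_value (T j))^2 * green h x (T j)) \<le>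
          (B * (1 / real (j + 2)))^2 * (C / (1 / real (j + 2)))"
        unfolding norm_mult norm_power using rad[of j] by (intro mult_mono power_mono) auto
      also have "\<dots> = B^2 * C * (1 / real (j + 2))"
      proof -
        have "(B * (1 / J))^2 * (C / (1 / J)) = B^2 * C * (1 / J)" if "J \<noteq> 0" for J :: real
          using that by (simp add: power2_eq_square)
        from this[of "real (j + 2)"] show ?thesis by simp
      qed
      finally show ?thesis .
    qed
    then show "\<forall>\<^sub>F j in sequentially. norm ((?l - lap_value (T j))^2 * green h x (T j)) \<le> B^2 * C * (1 / real (j + 2))"
      by simp
    show "(\<lambda>j. B^2 * C * (1 / real (j + 2))) \<longlonglongrightarrow> 0" using tendsto_mult_right_zero[OF lim_inv] .
  qed
  have kl: "(\<lambda>j. k (T j)) \<longlonglongrightarrow> k t0"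
    unfolding k_def using t00 q_pos by (intro tendsto_intros Tl) auto
  have "(\<lambda>j. (?l - lap_value (T j)) * (k (T j) * h x) - (?l - lap_value (T j))^2 * green h x (T j))
      \<longlonglongrightarrow> 0 * (k t0 * h x) - 0"
    by (intro tendsto_diff tendsto_mult d0 kl g0 tendsto_const)
  then have "(\<lambda>j. k (T j) * h1 x) \<longlonglongrightarrow> 0" unfolding eq[OF T(1,2)] by simp
  moreover have "(\<lambda>j. k (T j) * h1 x) \<longlonglongrightarrow> k t0 * h1 x" by (intro tendsto_intros kl)
  ultimately have "k t0 * h1 x = 0" by (rule LIMSEQ_unique[symmetric])
  moreover have "k t0 \<noteq> 0"
  proof -
    have "norm t0 < sqrt q" using t0 R_less_sqrt_q by simp
    then have "t0^2 \<noteq> of_nat q" by (rule square_ne_q)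
    then show ?thesis
      using t00 q_pos by (simp add: k_def del: of_nat_add of_nat_Suc)
  qed
  ultimately show "poly_lap [:- ?l, 1:] h x = 0" unfolding h1 by simp
qed

end

section \<open>Weak Lebesgue spaces\<close>

text \<open>The weak norm without extended values; finiteness of the level sets is part of the bound.\<close>

definition weak_bound :: "ereal \<Rightarrow> real \<Rightarrow> ('a \<Rightarrow> complex) \<Rightarrow> bool" where
  "weak_bound r M f \<longleftrightarrow>
     (if r = \<infinity> then \<forall>x. cmod (f x) \<le> M
      else \<forall>t>0. finite {x. t < cmod (f x)} \<and>
             t * real (card {x. t < cmod (f x)}) powr (1 / real_of_ereal r) \<le> M)"

lemma weak_norm_le_iff:
  assumes "0 \<le> M" shows "weak_norm r f \<le> ennreal M \<longleftrightarrow> weak_bound r M f"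
proof (cases "r = \<infinity>")
  case True
  then show ?thesis using assms by (simp add: weak_norm_def weak_bound_def SUP_le_iff)
next
  case False
  have "ennreal t * (if finite {x. t < cmod (f x)}
          then ennreal (real (card {x. t < cmod (f x)}) powr (1 / real_of_ereal r)) else \<infinity>) \<le> ennreal M \<longleftrightarrow>
        finite {x. t < cmod (f x)} \<and> t * real (card {x. t < cmod (f x)}) powr (1 / real_of_ereal r) \<le> M"
    if "0 < t" for t
    using that assms by (auto simp: ennreal_mult_top top_unique simp flip: ennreal_mult)
  then show ?thesis using False by (simp add: weak_norm_def weak_bound_def SUP_le_iff Ball_def)
qed

lemma weak_L_iff: "f \<in> weak_L r \<longleftrightarrow> (\<exists>M\<ge>0. weak_bound r M f)"
proof
  assume "f \<in> weak_L r"
  then obtain M where "0 \<le> M" "weak_norm r f = ennreal M"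
    unfolding weak_L_def by (cases "weak_norm r f") auto
  then show "\<exists>M\<ge>0. weak_bound r M f" using weak_norm_le_iff[of M r f] by auto
next
  assume "\<exists>M\<ge>0. weak_bound r M f"
  then obtain M where M: "weak_norm r f \<le> ennreal M" using weak_norm_le_iff by blast
  show "f \<in> weak_L r" unfolding weak_L_def using le_less_trans[OF M ennreal_less_top] by simp
qed

lemma weak_bound_finiteI:
  assumes "\<And>t. 0 < t \<Longrightarrow> \<exists>T. finite T \<and> {x. t < cmod (f x)} \<subseteq> T \<and> t * real (card T) powr (1 / s) \<le> M" "0 < s"
  shows "weak_bound (ereal s) M f"
  unfolding weak_bound_def
proof (simp, intro allI impI)
  fix t :: real assume t: "0 < t"
  obtain T where T: "finite T" "{x. t < cmod (f x)} \<subseteq> T" "t * real (card T) powr (1 / s) \<le> M"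
    using assms(1)[OF t] by blast
  have "card {x. t < cmod (f x)} \<le> card T" using T by (intro card_mono)
  then have "t * real (card {x. t < cmod (f x)}) powr (1 / s) \<le> t * real (card T) powr (1 / s)"
    using t assms(2) by (intro mult_left_mono powr_mono2) auto
  then show "finite {x. t < cmod (f x)} \<and> t * real (card {x. t < cmod (f x)}) powr (1 / s) \<le> M"
    using T finite_subset by auto
qed

lemma weak_bound_finiteD:
  assumes "weak_bound (ereal s) M f" "0 < t"
  shows "finite {x. t < cmod (f x)}" "t * real (card {x. t < cmod (f x)}) powr (1 / s) \<le> M"
  using assms by (simp_all add: weak_bound_def)

text \<open>Otherwise \<open>X\<close> would lie in a level set that is too large.\<close>

lemma weak_bound_min:
  assumes f: "weak_bound (ereal s) M f" and s: "0 < s" and X: "finite X" "X \<noteq> {}" and M: "0 \<le> M"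
  shows "\<exists>x\<in>X. cmod (f x) \<le> M * real (card X) powr (- 1 / s)"
proof (rule ccontr)
  assume "\<not> ?thesis"
  then have gt: "\<And>x. x \<in> X \<Longrightarrow> M * real (card X) powr (- 1 / s) < cmod (f x)" by force
  let ?m = "Min ((\<lambda>x. cmod (f x)) ` X)"
  have k: "0 < real (card X)" using X by (simp add: card_gt_0_iff)
  have "M * real (card X) powr (- 1 / s) < ?m" using X gt by simp
  then obtain t where t: "M * real (card X) powr (- 1 / s) < t" "t < ?m" using dense by blast
  have t0: "0 < t" using t(1) M by (smt (verit) mult_nonneg_nonneg powr_ge_zero)
  have sub: "X \<subseteq> {x. t < cmod (f x)}" using X t(2) by auto
  have "t * real (card X) powr (1 / s) \<le> t * real (card {x. t < cmod (f x)}) powr (1 / s)"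
    using sub s t0 weak_bound_finiteD(1)[OF f t0] by (intro mult_left_mono powr_mono2) (auto intro: card_mono)
  also have "\<dots> \<le> M" by (rule weak_bound_finiteD(2)[OF f t0])
  finally have "t * real (card X) powr (1 / s) * real (card X) powr (- 1 / s) \<le> M * real (card X) powr (- 1 / s)"
    by (rule mult_right_mono) simp
  then have "t \<le> M * real (card X) powr (- 1 / s)"
    using k by (simp add: mult.assoc flip: powr_add)
  then show False using t by simp
qed

text \<open>Removing one after another the points where \<open>f\<close> is smallest on the remaining set bounds the decreasing
  rearrangement of \<open>|f|\<close>.\<close>

lemma sum_powr_weak_bound:
  assumes f: "weak_bound (ereal s) M f" and s: "0 < s" and M: "0 \<le> M" and a: "0 \<le> a" and X: "finite X"
  shows "(\<Sum>x\<in>X. cmod (f x) powr a) \<le> (\<Sum>k=1..card X. (M * real k powr (- 1 / s)) powr a)"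
  using X
proof (induction "card X" arbitrary: X)
  case 0
  then show ?case by simp
next
  case (Suc n)
  then have "X \<noteq> {}" by auto
  then obtain x where x: "x \<in> X" "cmod (f x) \<le> M * real (card X) powr (- 1 / s)"
    using weak_bound_min[OF f s Suc.prems _ M] by blast
  have c: "card (X - {x}) = n" using x Suc by simp
  have "(\<Sum>x\<in>X. cmod (f x) powr a) = cmod (f x) powr a + (\<Sum>x\<in>X - {x}. cmod (f x) powr a)"
    using Suc.prems x by (simp add: sum.remove)
  also have "\<dots> \<le> (M * real (card X) powr (- 1 / s)) powr a +
      (\<Sum>k=1..card (X - {x}). (M * real k powr (- 1 / s)) powr a)"
  proof (rule add_mono)
    show "cmod (f x) powr a \<le> (M * real (card X) powr (- 1 / s)) powr a"
      using x a by (intro powr_mono2) auto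
    show "(\<Sum>x\<in>X - {x}. cmod (f x) powr a) \<le> (\<Sum>k=1..card (X - {x}). (M * real k powr (- 1 / s)) powr a)"
      using Suc.hyps(1)[of "X - {x}"] c Suc.prems by simp
  qed
  also have "\<dots> = (\<Sum>k=1..card X. (M * real k powr (- 1 / s)) powr a)"
    unfolding c Suc.hyps(2)[symmetric] by simp
  finally show ?case .
qed

lemma sum_powr_neg_le:
  assumes p: "1 < p"
  shows "(\<Sum>k=1..N. real k powr (1 / p - 1)) \<le> p * real N powr (1 / p)"
proof (induction N)
  case (Suc N)
  have "real (Suc N) powr (1 / p - 1) \<le> p * (real (Suc N) powr (1 / p) - real N powr (1 / p))"
  proof (cases "N = 0")
    case True then show ?thesis using p by simp
  next
    case False
    have "\<exists>z. real N < z \<and> z < real (Suc N) \<and>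
        real (Suc N) powr (1 / p) - real N powr (1 / p) = (real (Suc N) - real N) * (1 / p * z powr (1 / p - 1))"
      using False by (intro MVT2) (auto intro!: derivative_eq_intros simp: powr_diff)
    then obtain z where z: "real N < z" "z < real (Suc N)"
      "real (Suc N) powr (1 / p) - real N powr (1 / p) = 1 / p * z powr (1 / p - 1)" by auto
    have "real (Suc N) powr (1 / p - 1) \<le> z powr (1 / p - 1)"
      using z False p by (intro powr_mono2') auto
    then show ?thesis unfolding z(3) using p by simp
  qed
  then show ?case using Suc by (simp add: algebra_simps)
qed simp

lemma sum_inverse_le: "1 \<le> N \<Longrightarrow> (\<Sum>k=1..N. 1 / real k) \<le> 1 + ln (real N)"
proof (induction N rule: dec_induct)
  case (step N)
  have "ln (real N / real (Suc N)) \<le> real N / real (Suc N) - 1"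
    using step by (intro ln_le_minus_one) auto
  also have "\<dots> = - 1 / real (Suc N)" by (simp add: field_simps)
  finally have "1 / real (Suc N) \<le> ln (real (Suc N)) - ln (real N)"
    using step by (simp add: ln_div)
  then show ?case using step by simp
qed simp

lemma conj_exponent_finite:
  assumes "1 < p" shows "conj_exponent p = ereal (p / (p - 1))" "1 / (p / (p - 1)) = 1 - 1 / p" "0 < p / (p - 1)"
  using assms by (auto simp: conj_exponent_def field_simps)

lemma weak_L_add:
  assumes r: "r = \<infinity> \<or> (\<exists>s\<ge>1. r = ereal s)" and "f \<in> weak_L r" "g \<in> weak_L r"
  shows "(\<lambda>x. f x + g x) \<in> weak_L r"
proof -
  obtain M N where M: "0 \<le> M" "weak_bound r M f" and N: "0 \<le> N" "weak_bound r N g"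
    using assms(2,3) by (auto simp: weak_L_iff)
  show ?thesis
  proof (cases "r = \<infinity>")
    case True
    then have "weak_bound r (M + N) (\<lambda>x. f x + g x)"
      using M N unfolding weak_bound_def by simp (meson add_mono norm_triangle_le)
    then show ?thesis using M N unfolding weak_L_iff by (intro exI[of _ "M + N"]) simp
  next
    case False
    then obtain s where s: "1 \<le> s" "r = ereal s" using r by auto
    have "weak_bound (ereal s) (4 * (M + N)) (\<lambda>x. f x + g x)"
    proof (rule weak_bound_finiteI)
      fix t :: real assume t: "0 < t"
      let ?F = "{x. t / 2 < cmod (f x)}" and ?G = "{x. t / 2 < cmod (g x)}"
      let ?a = "real (card ?F)" and ?b = "real (card ?G)"
      have F: "finite ?F" "t / 2 * ?a powr (1 / s) \<le> M" and G: "finite ?G" "t / 2 * ?b powr (1 / s) \<le> N"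
        using weak_bound_finiteD[of s M f "t / 2"] weak_bound_finiteD[of s N g "t / 2"] M N s t by auto
      have "{x. t < cmod (f x + g x)} \<subseteq> ?F \<union> ?G"
      proof
        fix x assume "x \<in> {x. t < cmod (f x + g x)}"
        then have x: "t < cmod (f x) + cmod (g x)" using norm_triangle_ineq[of "f x" "g x"] by simp
        show "x \<in> ?F \<union> ?G"
        proof (rule ccontr)
          assume "x \<notin> ?F \<union> ?G"
          then have "cmod (f x) \<le> t / 2" "cmod (g x) \<le> t / 2" by auto
          then show False using x by simp
        qed
      qed
      moreover have "t * real (card (?F \<union> ?G)) powr (1 / s) \<le> 4 * (M + N)"
      proof -
        have "real (card (?F \<union> ?G)) powr (1 / s) \<le> (2 * max ?a ?b) powr (1 / s)"
          using card_Un_le[of ?F ?G] s by (intro powr_mono2) auto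
        also have "\<dots> = 2 powr (1 / s) * max ?a ?b powr (1 / s)" by (simp add: powr_mult)
        also have "\<dots> \<le> 2 * (?a powr (1 / s) + ?b powr (1 / s))"
        proof (rule mult_mono)
          show "2 powr (1 / s) \<le> (2::real)" using s powr_mono[of "1 / s" 1 2] by simp
          show "max ?a ?b powr (1 / s) \<le> ?a powr (1 / s) + ?b powr (1 / s)" by (simp add: max_def)
        qed auto
        finally have "t * real (card (?F \<union> ?G)) powr (1 / s) \<le> t * (2 * (?a powr (1 / s) + ?b powr (1 / s)))"
          using t by (intro mult_left_mono) auto
        also have "\<dots> = 4 * (t / 2 * ?a powr (1 / s) + t / 2 * ?b powr (1 / s))" by (simp add: algebra_simps)
        also have "\<dots> \<le> 4 * (M + N)" using F G by (intro mult_left_mono add_mono) auto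
        finally show ?thesis .
      qed
      ultimately show "\<exists>T. finite T \<and> {x. t < cmod (f x + g x)} \<subseteq> T \<and> t * real (card T) powr (1 / s) \<le> 4 * (M + N)"
        using F G by (intro exI[of _ "?F \<union> ?G"]) auto
    qed (use s in simp)
    then show ?thesis using M N s(2) unfolding weak_L_iff by (intro exI[of _ "4 * (M + N)"]) simp
  qed
qed

lemma weak_L_cmult:
  assumes r: "r = \<infinity> \<or> (\<exists>s\<ge>1. r = ereal s)" and "f \<in> weak_L r"
  shows "(\<lambda>x. c * f x) \<in> weak_L r"
proof -
  obtain M where M: "0 \<le> M" "weak_bound r M f" using assms(2) by (auto simp: weak_L_iff)
  have "weak_bound r (cmod c * M) (\<lambda>x. c * f x)"
  proof (cases "r = \<infinity>")
    case True
    then show ?thesis using M by (simp add: weak_bound_def norm_mult mult_left_mono)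
  next
    case False
    then obtain s where s: "1 \<le> s" "r = ereal s" using r by auto
    show ?thesis unfolding s(2)
    proof (rule weak_bound_finiteI)
      fix t :: real assume t: "0 < t"
      show "\<exists>T. finite T \<and> {x. t < cmod (c * f x)} \<subseteq> T \<and> t * real (card T) powr (1 / s) \<le> cmod c * M"
      proof (cases "c = 0")
        case True
        then show ?thesis using t s by (intro exI[of _ "{}"]) auto
      next
        case False
        let ?T = "{x. t / cmod c < cmod (f x)}"
        have T: "finite ?T" "t / cmod c * real (card ?T) powr (1 / s) \<le> M"
          using weak_bound_finiteD[of s M f "t / cmod c"] M s t False by auto
        then have "t * real (card ?T) powr (1 / s) \<le> cmod c * M" using False by (simp add: field_simps)
        moreover have "{x. t < cmod (c * f x)} \<subseteq> ?T" using False by (auto simp: norm_mult field_simps)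
        ultimately show ?thesis using T by blast
      qed
    qed (use s in simp)
  qed
  then show ?thesis using M unfolding weak_L_iff by (intro exI[of _ "cmod c * M"]) simp
qed

locale tree_exponent = hom_tree +
  fixes p :: real
  assumes p: "1 \<le> p" "p < 2"
begin

abbreviation "R \<equiv> real q powr (1 / 2 - 1 / p)"

sublocale growth q E R
proof
  show "0 < R" using q_ge_2 by simp
  have "1 / 2 - 1 / p < 0" using p by (simp add: field_simps)
  then show "R < 1" using q_ge_2 by (simp add: powr_less_one)
qed

abbreviation "r \<equiv> conj_exponent p"

lemma r_cases: "r = \<infinity> \<or> (\<exists>s\<ge>1. r = ereal s)"
proof (cases "p = 1")
  case False
  then have "r = ereal (p / (p - 1))" "1 \<le> p / (p - 1)" using p by (auto simp: conj_exponent_def field_simps)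
  then show ?thesis by blast
qed (simp add: conj_exponent_def)

lemma root_ratio: "sqrt q / R = real q powr (1 / p)"
proof -
  have "sqrt q = real q powr (1 / 2)" by (simp add: powr_half_sqrt)
  then show ?thesis by (simp flip: powr_diff)
qed

lemma card_sphere_le: "real (card (tsphere x n)) \<le> 2 * real q ^ n"
proof (cases n)
  case (Suc m)
  have "real (q + 1) * real q ^ m \<le> (2 * real q) * real q ^ m" using q_ge_2 by (intro mult_right_mono) auto
  then show ?thesis unfolding Suc card_sphere of_nat_mult of_nat_power power_Suc by (simp only: mult.assoc)
qed (simp add: sphere_0)

text \<open>A sphere of radius \<open>n\<close> has about \<open>q\<^sup>n\<close> points, on which the decreasing rearrangement is at
  most \<open>M k\<^bsup>-1/p'\<^esup>\<close>. Its sum is of order \<open>q\<^bsup>n/p\<^esup>\<close>, and \<open>q\<^bsup>1/p\<^esup> = \<surd>q / R\<close>.\<close>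

lemma weak_bound_sphere_bound:
  assumes f: "weak_bound r M f" and M: "0 \<le> M"
  shows "sphere_bound (4 * M) f"
  unfolding sphere_bound_def root_ratio
proof (intro allI)
  fix x n
  let ?N = "real (card (tsphere x n))"
  have S: "ssum n (\<lambda>y. cmod (f y)) x \<le> M * p * ?N powr (1 / p)"
  proof (cases "p = 1")
    case True
    then have "cmod (f y) \<le> M" for y using f by (simp add: weak_bound_def conj_exponent_def)
    then have "ssum n (\<lambda>y. cmod (f y)) x \<le> (\<Sum>y\<in>tsphere x n. M)" unfolding ssum_def by (intro sum_mono)
    then show ?thesis using True by (simp add: mult.commute)
  next
    case False
    then have p1: "1 < p" using p by simp
    have "ssum n (\<lambda>y. cmod (f y)) x = (\<Sum>y\<in>tsphere x n. cmod (f y) powr 1)" by (simp add: ssum_def)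
    also have "\<dots> \<le> (\<Sum>k=1..card (tsphere x n). (M * real k powr (- 1 / (p / (p - 1)))) powr 1)"
      using f M conj_exponent_finite[OF p1] by (intro sum_powr_weak_bound) auto
    also have "\<dots> = M * (\<Sum>k=1..card (tsphere x n). real k powr (1 / p - 1))"
    proof -
      have "- 1 / (p / (p - 1)) = 1 / p - 1" using p1 by (simp add: field_simps)
      then show ?thesis using M by (simp add: sum_distrib_left)
    qed
    also have "\<dots> \<le> M * (p * ?N powr (1 / p))" using M by (intro mult_left_mono sum_powr_neg_le p1)
    finally show ?thesis by (simp add: mult.assoc)
  qed
  also have "M * p * ?N powr (1 / p) \<le> M * 2 * (2 * (real q powr (1 / p)) ^ n)"
  proof (intro mult_mono)
    have "?N powr (1 / p) \<le> (2 * real q ^ n) powr (1 / p)" using card_sphere_le p by (intro powr_mono2) auto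
    also have "\<dots> = 2 powr (1 / p) * (real q powr (1 / p)) ^ n"
      using q_pos by (simp add: powr_mult powr_powr mult.commute flip: powr_realpow)
    also have "\<dots> \<le> 2 * (real q powr (1 / p)) ^ n"
      using p powr_mono[of "1 / p" 1 2] by (intro mult_right_mono) auto
    finally show "?N powr (1 / p) \<le> 2 * (real q powr (1 / p)) ^ n" .
  qed (use M p in auto)
  finally show "ssum n (\<lambda>y. cmod (f y)) x \<le> 4 * M * (real q powr (1 / p)) ^ n" by simp
qed

lemma weak_L_tempered: "f \<in> weak_L r \<Longrightarrow> tempered f"
  using weak_bound_sphere_bound unfolding weak_L_iff tempered_def by blast

text \<open>Where a sum over neighbours exceeds \<open>t\<close>, some neighbour exceeds \<open>t / (q + 1)\<close>, and each vertex is a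
  neighbour of only \<open>q + 1\<close> others.\<close>

lemma weak_L_ssum_1:
  assumes "f \<in> weak_L r" shows "ssum (Suc 0) f \<in> weak_L r"
proof -
  obtain M where M: "0 \<le> M" "weak_bound r M f" using assms by (auto simp: weak_L_iff)
  define N where "N = real (q + 1)"
  have N: "1 \<le> N" by (simp add: N_def)
  have "weak_bound r (N^2 * M) (ssum (Suc 0) f)"
  proof (cases "r = \<infinity>")
    case True
    have "cmod (ssum (Suc 0) f x) \<le> N^2 * M" for x
    proof -
      have "cmod (ssum (Suc 0) f x) \<le> (\<Sum>y | E x y. M)"
        unfolding ssum_1 using M True by (intro sum_norm_le) (simp add: weak_bound_def)
      also have "\<dots> = N * M" by (simp add: card_nbrs N_def)
      also have "\<dots> \<le> N^2 * M" using N M by (intro mult_right_mono) (auto simp: power2_eq_square)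
      finally show ?thesis .
    qed
    then show ?thesis using True by (simp add: weak_bound_def)
  next
    case False
    then obtain s where s: "1 \<le> s" "r = ereal s" using r_cases by auto
    show ?thesis unfolding s(2)
    proof (rule weak_bound_finiteI)
      fix t :: real assume t: "0 < t"
      let ?F = "{x. t / N < cmod (f x)}"
      let ?T = "\<Union>y\<in>?F. {x. E y x}"
      have F: "finite ?F" "t / N * real (card ?F) powr (1 / s) \<le> M"
        using weak_bound_finiteD[of s M f "t / N"] M s t N by auto
      have "card ?T \<le> (\<Sum>y\<in>?F. card {x. E y x})" by (rule card_UN_le[OF F(1)])
      then have cT: "real (card ?T) \<le> N * real (card ?F)"
        by (simp add: card_nbrs N_def mult.commute flip: of_nat_mult of_nat_Suc)
      have "{x. t < cmod (ssum (Suc 0) f x)} \<subseteq> ?T"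
      proof
        fix x assume x: "x \<in> {x. t < cmod (ssum (Suc 0) f x)}"
        show "x \<in> ?T"
        proof (rule ccontr)
          assume "x \<notin> ?T"
          then have "\<And>y. E x y \<Longrightarrow> cmod (f y) \<le> t / N" using E_sym by force
          then have "cmod (ssum (Suc 0) f x) \<le> (\<Sum>y | E x y. t / N)" unfolding ssum_1 by (intro sum_norm_le) simp
          also have "\<dots> = t" using N by (simp add: card_nbrs N_def)
          finally show False using x by simp
        qed
      qed
      moreover have "t * real (card ?T) powr (1 / s) \<le> N^2 * M"
      proof -
        have "real (card ?T) powr (1 / s) \<le> (N * real (card ?F)) powr (1 / s)"
          using cT s by (intro powr_mono2) auto
        also have "\<dots> = N powr (1 / s) * real (card ?F) powr (1 / s)" using N by (simp add: powr_mult)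
        also have "\<dots> \<le> N * real (card ?F) powr (1 / s)"
          using N s powr_mono[of "1 / s" 1 N] by (intro mult_right_mono) auto
        finally have "t * real (card ?T) powr (1 / s) \<le> t * (N * real (card ?F) powr (1 / s))"
          using t by (intro mult_left_mono) auto
        also have "\<dots> = N^2 * (t / N * real (card ?F) powr (1 / s))" using N by (simp add: power2_eq_square)
        also have "\<dots> \<le> N^2 * M" using F by (intro mult_left_mono) auto
        finally show ?thesis .
      qed
      moreover have "finite ?T" using F finite_nbrs by blast
      ultimately show "\<exists>T. finite T \<and> {x. t < cmod (ssum (Suc 0) f x)} \<subseteq> T \<and> t * real (card T) powr (1 / s) \<le> N^2 * M"
        by blast
    qed (use s in simp)
  qed
  then show ?thesis using M N unfolding weak_L_iff by (intro exI[of _ "N^2 * M"]) simp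
qed

lemma weak_L_0: "(\<lambda>x. 0) \<in> weak_L r"
  unfolding weak_L_iff by (intro exI[of _ 0]) (auto simp: weak_bound_def)

lemma weak_L_L: "f \<in> weak_L r \<Longrightarrow> L f \<in> weak_L r"
proof -
  assume f: "f \<in> weak_L r"
  have "L f = (\<lambda>x. f x + (- inverse (of_nat (q + 1))) * ssum (Suc 0) f x)"
    by (rule ext) (simp add: L_eq del: of_nat_add)
  then show ?thesis
    using weak_L_add[OF r_cases f weak_L_cmult[OF r_cases weak_L_ssum_1[OF f]]] by (simp only:)
qed

lemma weak_L_poly_lap: "f \<in> weak_L r \<Longrightarrow> poly_lap P f \<in> weak_L r"
proof (induction P arbitrary: f)
  case 0
  then show ?case using weak_L_0 by (simp add: poly_lap_0[abs_def])
next
  case (pCons a P)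
  then show ?case
    unfolding poly_lap_pCons[abs_def] by (intro weak_L_add weak_L_cmult r_cases pCons.IH weak_L_L)
qed

end

section \<open>Rays, the Poisson kernel and spherical functions\<close>

context hom_tree begin

text \<open>The spheres around a vertex partition the tree, and each of them is finite.\<close>

lemma infsum_over_spheres:
  fixes g :: "'a \<Rightarrow> complex"
  assumes "summable (\<lambda>n. \<Sum>y\<in>tsphere x n. norm (g y))"
  shows "(\<Sum>\<^sub>\<infinity>y. g y) = (\<Sum>n. \<Sum>y\<in>tsphere x n. g y)"
proof -
  let ?S = "Sigma UNIV (tsphere x)"
  have bij: "bij_betw snd ?S UNIV"
    unfolding bij_betw_def inj_on_def by (force simp: tsphere_def image_iff)
  have abs: "(\<lambda>z. norm (g (snd z))) summable_on ?S"
  proof (rule summable_on_SigmaI)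
    fix n :: nat
    show "((\<lambda>y. norm (g (snd (n, y)))) has_sum (\<Sum>y\<in>tsphere x n. norm (g y))) (tsphere x n)"
      by (simp add: has_sum_finite)
  next
    show "(\<lambda>n. \<Sum>y\<in>tsphere x n. norm (g y)) summable_on UNIV"
      using assms by (subst summable_on_UNIV_nonneg_real_iff) (auto intro: sum_nonneg)
  qed auto
  then have sm: "(\<lambda>z. g (snd z)) summable_on ?S" by (rule abs_summable_summable)
  have "(\<Sum>\<^sub>\<infinity>y. g y) = (\<Sum>\<^sub>\<infinity>z\<in>?S. g (snd z))"
    using infsum_reindex_bij_betw[OF bij, of g] by simp
  also have "\<dots> = (\<Sum>\<^sub>\<infinity>n. \<Sum>\<^sub>\<infinity>y\<in>tsphere x n. g y)"
    using infsum_Sigma_banach[OF sm] by simp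
  also have "\<dots> = (\<Sum>\<^sub>\<infinity>n. \<Sum>y\<in>tsphere x n. g y)" by simp
  also have "\<dots> = (\<Sum>n. \<Sum>y\<in>tsphere x n. g y)"
  proof -
    have "summable (\<lambda>n. norm (\<Sum>y\<in>tsphere x n. g y))"
      by (rule summable_norm_le[OF assms]) (simp add: norm_sum)
    then show ?thesis
      by (intro infsumI norm_summable_imp_has_sum summable_sums) (auto dest: summable_norm_cancel)
  qed
  finally show ?thesis .
qed

end

locale boundary = hom_tree +
  fixes b :: 'a and \<nu> :: "(nat \<Rightarrow> 'a) measure"
  assumes bm: "boundary_measure q E b \<nu>"
begin

abbreviation "Rays \<equiv> rays E b"
abbreviation "len x \<equiv> d b x"
abbreviation "par x \<equiv> parent b x"
abbreviation "sec x \<equiv> sector E b x"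
abbreviation "cheight x \<omega> \<equiv> d b (confluence E b x \<omega>)"

lemma ray:
  assumes "\<omega> \<in> Rays"
  shows ray_0: "\<omega> 0 = b" and len_ray: "len (\<omega> n) = n"
    and ray_child: "\<omega> (Suc n) \<in> children b (\<omega> n)" and par_ray: "par (\<omega> (Suc n)) = \<omega> n"
proof -
  have D: "\<omega> 0 = b" "\<And>m n. m \<le> n \<Longrightarrow> d (\<omega> m) (\<omega> n) = n - m"
    using assms by (auto simp: rays_def)
  show "\<omega> 0 = b" by (rule D(1))
  show l: "len (\<omega> n) = n" for n using D(2)[of 0 n] D(1) by simp
  have e: "E (\<omega> n) (\<omega> (Suc n))" for n using D(2)[of n "Suc n"] d_eq_1[of "\<omega> n" "\<omega> (Suc n)"] by simp
  show c: "\<omega> (Suc n) \<in> children b (\<omega> n)" using e l by (simp add: children_def)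
  show "par (\<omega> (Suc n)) = \<omega> n" using parent_child[OF c] .
qed

lemma height_max:
  assumes w: "\<omega> \<in> Rays"
  shows "cheight x \<omega> + d (\<omega> (cheight x \<omega>)) x = len x"
    and "j + d (\<omega> j) x = len x \<Longrightarrow> j \<le> cheight x \<omega>"
proof -
  let ?P = "\<lambda>y. y \<in> range \<omega> \<and> d b y + d y x = d b x"
  have 0: "?P b" using ray_0[OF w] by (auto intro: range_eqI[of _ _ 0])
  have "\<forall>y. ?P y \<longrightarrow> d b y < Suc (len x)" by auto
  then have A: "?P (confluence E b x \<omega>)" "\<And>y. ?P y \<Longrightarrow> d b y \<le> d b (confluence E b x \<omega>)"
    using arg_max_nat_lemma[of ?P b "d b" "Suc (len x)"] 0 unfolding confluence_def by auto
  then obtain j where "confluence E b x \<omega> = \<omega> j" by auto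
  then show "cheight x \<omega> + d (\<omega> (cheight x \<omega>)) x = len x"
    using A(1) len_ray[OF w] by simp
  show "j \<le> cheight x \<omega>" if "j + d (\<omega> j) x = len x" for j
    using A(2)[of "\<omega> j"] that len_ray[OF w] by auto
qed

lemma height_root: "\<omega> \<in> Rays \<Longrightarrow> cheight b \<omega> = 0"
  using height_max(1)[of \<omega> b] by simp

text \<open>A ray belongs to the sector of \<open>x\<close> when it passes through \<open>x\<close>, necessarily at time \<open>|x|\<close>. Thus
  sectors are level sets of the coordinate functions on rays.\<close>

lemma sec_eq: "sec x = {\<omega> \<in> Rays. \<omega> (len x) = x}"
proof -
  have "cheight x \<omega> = len x \<longleftrightarrow> \<omega> (len x) = x" if w: "\<omega> \<in> Rays" for \<omega>
  proof
    assume h: "cheight x \<omega> = len x"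
    then have "d (\<omega> (cheight x \<omega>)) x = 0" using height_max(1)[OF w, of x] by linarith
    then show "\<omega> (len x) = x" unfolding h by simp
  next
    assume "\<omega> (len x) = x"
    then have "len x \<le> cheight x \<omega>" using height_max(2)[OF w, of "len x" x] by simp
    then show "cheight x \<omega> = len x" using height_max(1)[OF w, of x] by simp
  qed
  then show ?thesis unfolding sector_def by auto
qed

text \<open>Leaving the ray is irrevocable: the confluent of \<open>x\<close> with the ray is \<open>x\<close> itself if the ray passes
  through it and otherwise that of its parent.\<close>

lemma height_child:
  assumes w: "\<omega> \<in> Rays" and x: "x \<noteq> b"
  shows "cheight x \<omega> = (if \<omega> (len x) = x then len x else cheight (par x) \<omega>)"
proof (cases "\<omega> (len x) = x")
  case True
  then have "\<omega> \<in> sec x" using w by (simp add: sec_eq)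
  then show ?thesis using True by (simp add: sector_def)
next
  case False
  have lp: "Suc (len (par x)) = len x" using d_parent[OF x] .
  have ep: "E (par x) x" using E_parent[OF x] .
  have iff: "j + d (\<omega> j) x = len x \<longleftrightarrow> j + d (\<omega> j) (par x) = len (par x)" for j
  proof
    assume j: "j + d (\<omega> j) x = len x"
    have "\<omega> j \<noteq> x" using False len_ray[OF w, of j] by auto
    then obtain n where n: "d (\<omega> j) x = Suc n" by (cases "d (\<omega> j) x") auto
    obtain z where z: "d (\<omega> j) z = n" "E z x" using d_Suc_obtain[OF n] by blast
    have "len z \<le> j + n" using d_triangle[of b z "\<omega> j"] z len_ray[OF w, of j] by simp
    then have "z = par x" using parentI[OF z(2), of b] j n by simp
    then show "j + d (\<omega> j) (par x) = len (par x)" using z j n lp by simp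
  next
    assume j: "j + d (\<omega> j) (par x) = len (par x)"
    have "d (\<omega> j) x \<le> Suc (d (\<omega> j) (par x))" using d_nbr(1)[OF ep] .
    moreover have "len x \<le> j + d (\<omega> j) x" using d_triangle[of b x "\<omega> j"] len_ray[OF w, of j] by simp
    ultimately show "j + d (\<omega> j) x = len x" using j lp by simp
  qed
  have "cheight x \<omega> \<le> cheight (par x) \<omega>"
    using height_max(2)[OF w, of "cheight x \<omega>" "par x"] height_max(1)[OF w, of x] iff by simp
  moreover have "cheight (par x) \<omega> \<le> cheight x \<omega>"
    using height_max(2)[OF w, of "cheight (par x) \<omega>" x] height_max(1)[OF w, of "par x"] iff by simp
  ultimately show ?thesis using False by simp
qed

text \<open>The power of the Poisson kernel, with the exponent \<open>1/2 + iz\<close> abbreviated by \<open>\<beta>\<close>.\<close>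

definition ker :: "complex \<Rightarrow> 'a \<Rightarrow> (nat \<Rightarrow> 'a) \<Rightarrow> complex" where
  "ker \<beta> x \<omega> = of_real (poisson_kernel q E b x \<omega>) powr \<beta>"

lemma ker_eq: "ker \<beta> x \<omega> = (of_nat q powr \<beta>) powi (2 * int (cheight x \<omega>) - int (len x))"
proof -
  let ?k = "2 * int (cheight x \<omega>) - int (len x)"
  have q: "0 < real q" using q_ge_2 by simp
  have pos: "0 < real q powi ?k" using q by simp
  have "ln (real q powi ?k) = of_int ?k * ln (real q)"
    using q by (simp add: ln_powr flip: powr_real_of_int')
  moreover have "Ln (of_nat q) = of_real (ln (real q))" using q Ln_of_real[of "real q"] by simp
  moreover have "Ln (of_real (real q powi ?k)) = of_real (ln (real q powi ?k))" using pos by (rule Ln_of_real)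
  ultimately have "ker \<beta> x \<omega> = exp (of_int ?k * (\<beta> * of_real (ln (real q))))"
    using pos q by (simp add: ker_def poisson_kernel_def powr_def mult_ac del: of_real_power_int)
  also have "\<dots> = exp (\<beta> * of_real (ln (real q))) powi ?k" by (rule exp_power_int[symmetric])
  also have "exp (\<beta> * of_real (ln (real q))) = of_nat q powr \<beta>"
    using q \<open>Ln (of_nat q) = of_real (ln (real q))\<close> by (simp add: powr_def)
  finally show ?thesis .
qed

lemma base_nonzero: "(of_nat q :: complex) powr \<beta> \<noteq> 0"
  using q_ge_2 by simp

lemma ker_root: "\<omega> \<in> Rays \<Longrightarrow> ker \<beta> b \<omega> = 1"
  by (simp add: ker_eq height_root)

lemma ker_on_ray:
  assumes "\<omega> \<in> sec x" shows "ker \<beta> x \<omega> = (of_nat q powr \<beta>) ^ len x"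
proof -
  have "cheight x \<omega> = len x" using assms by (simp add: sector_def)
  then have "2 * int (cheight x \<omega>) - int (len x) = int (len x)" by simp
  then show ?thesis unfolding ker_eq by simp
qed

lemma sec_par: "x \<noteq> b \<Longrightarrow> \<omega> \<in> sec x \<Longrightarrow> \<omega> \<in> sec (par x)"
  using d_parent[of x b] par_ray[of \<omega> "len (par x)"] by (auto simp: sec_eq)

lemma ker_off_ray:
  assumes w: "\<omega> \<in> Rays" and x: "x \<noteq> b" and off: "\<omega> \<notin> sec x"
  shows "ker \<beta> (par x) \<omega> = of_nat q powr \<beta> * ker \<beta> x \<omega>"
proof -
  have "cheight x \<omega> = cheight (par x) \<omega>" using height_child[OF w x] off w by (simp add: sec_eq)
  then have "2 * int (cheight (par x) \<omega>) - int (len (par x)) = 1 + (2 * int (cheight x \<omega>) - int (len x))"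
    using d_parent[OF x] by simp
  then show ?thesis unfolding ker_eq
    by (simp only: power_int_add[OF disjI1[OF base_nonzero]] power_int_1_right)
qed

text \<open>The difference between the kernel at a vertex of level \<open>n\<close> on the ray, \<open>a\<^sup>n\<close>, and the value
  \<open>a\<^bsup>n - 2\<^esup>\<close> that continues the decay from its parent.\<close>

definition jump :: "complex \<Rightarrow> nat \<Rightarrow> complex" where
  "jump a n = a ^ n - a ^ n / a^2"

text \<open>Away from the ray the kernel is divided by \<open>a\<close> with every step; a vertex on the ray contributes a
  jump. Integrated against \<open>F\<close>, this recovers the integral of \<open>F\<close> over the sector of \<open>x\<close> from
  its Poisson transform at \<open>x\<close> and at the parent.\<close>

lemma ker_recursion:
  assumes w: "\<omega> \<in> Rays" and x: "x \<noteq> b"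
  shows "ker \<beta> x \<omega> = inverse (of_nat q powr \<beta>) * ker \<beta> (par x) \<omega> +
    (if \<omega> \<in> sec x then jump (of_nat q powr \<beta>) (len x) else 0)"
proof (cases "\<omega> \<in> sec x")
  case True
  have "len x = Suc (len (par x))" using d_parent[OF x] by simp
  then show ?thesis
    using True ker_on_ray[OF True] ker_on_ray[OF sec_par[OF x True]] base_nonzero[of \<beta>]
    by (simp add: jump_def field_simps power2_eq_square)
next
  case False
  then show ?thesis using ker_off_ray[OF w x False] base_nonzero[of \<beta>] by simp
qed

lemma sum_children_sec:
  assumes w: "\<omega> \<in> Rays"
  shows "(\<Sum>y\<in>children b x. if \<omega> \<in> sec y then c else 0) = (if \<omega> \<in> sec x then c else (0::complex))"
proof (cases "\<omega> \<in> sec x")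
  case True
  then have x: "\<omega> (len x) = x" by (simp add: sec_eq)
  have c: "\<omega> (Suc (len x)) \<in> children b x" using ray_child[OF w, of "len x"] x by simp
  have "\<omega> \<in> sec y \<longleftrightarrow> y = \<omega> (Suc (len x))" if "y \<in> children b x" for y
    using that w by (auto simp: sec_eq children_def)
  then have "(\<Sum>y\<in>children b x. if \<omega> \<in> sec y then c else 0) =
      (\<Sum>y\<in>children b x. if y = \<omega> (Suc (len x)) then c else 0)" by (intro sum.cong) auto
  then show ?thesis using c True by simp
next
  case False
  have "\<omega> \<notin> sec y" if "y \<in> children b x" for y
    using sec_par[OF children_ne[OF that]] parent_child[OF that] False by auto
  then show ?thesis using False by simp
qed

text \<open>Each vertex has exactly one neighbour in the direction of the end of the ray, where the kernel is
  multiplied by \<open>a\<close>, and \<open>q\<close> others, where it is divided by \<open>a\<close>.\<close>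

lemma ker_eigenfunction:
  fixes \<beta> :: complex
  assumes w: "\<omega> \<in> Rays"
  defines "a \<equiv> of_nat q powr \<beta>"
  shows "ssum (Suc 0) (\<lambda>x. ker \<beta> x \<omega>) x = (a + of_nat q / a) * ker \<beta> x \<omega>"
proof -
  have a0: "a \<noteq> 0" unfolding a_def by (rule base_nonzero)
  have "(\<Sum>y\<in>children b x. ker \<beta> y \<omega>) =
      (\<Sum>y\<in>children b x. inverse a * ker \<beta> x \<omega> + (if \<omega> \<in> sec y then jump a (Suc (len x)) else 0))"
  proof (rule sum.cong[OF refl])
    fix y assume y: "y \<in> children b x"
    then have "len y = Suc (len x)" by (simp add: children_def)
    then show "ker \<beta> y \<omega> = inverse a * ker \<beta> x \<omega> + (if \<omega> \<in> sec y then jump a (Suc (len x)) else 0)"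
      using ker_recursion[OF w children_ne[OF y], of \<beta>] parent_child[OF y] by (simp add: a_def)
  qed
  also have "\<dots> = of_nat (card (children b x)) * (inverse a * ker \<beta> x \<omega>) +
      (if \<omega> \<in> sec x then jump a (Suc (len x)) else 0)"
    by (simp add: sum.distrib sum_children_sec[OF w])
  finally have C: "(\<Sum>y\<in>children b x. ker \<beta> y \<omega>) = of_nat (card (children b x)) * (inverse a * ker \<beta> x \<omega>) +
      (if \<omega> \<in> sec x then jump a (Suc (len x)) else 0)" .
  show ?thesis
  proof (cases "x = b")
    case True
    have "\<omega> \<in> sec b" using w ray_0[OF w] by (simp add: sec_eq)
    then have "ssum (Suc 0) (\<lambda>x. ker \<beta> x \<omega>) b = of_nat (q + 1) * inverse a + (a - inverse a)"
      using C unfolding True ssum_1 nbrs_root card_children ker_root[OF w]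
      using a0 by (simp add: jump_def power2_eq_square inverse_eq_divide)
    then show ?thesis unfolding True ker_root[OF w] by (simp add: divide_inverse algebra_simps)
  next
    case False
    have "ssum (Suc 0) (\<lambda>x. ker \<beta> x \<omega>) x = ker \<beta> (par x) \<omega> + of_nat q * (inverse a * ker \<beta> x \<omega>) +
      (if \<omega> \<in> sec x then jump a (Suc (len x)) else 0)"
      unfolding ssum_1 sum_nbrs[OF False] C card_children using False by simp
    moreover have "ker \<beta> (par x) \<omega> + (if \<omega> \<in> sec x then jump a (Suc (len x)) else 0) = a * ker \<beta> x \<omega>"
    proof (cases "\<omega> \<in> sec x")
      case True
      have "len x = Suc (len (par x))" using d_parent[OF False] by simp
      then show ?thesis
        using True ker_on_ray[OF True, of \<beta>] ker_on_ray[OF sec_par[OF False True], of \<beta>] a0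
        by (simp add: jump_def a_def[symmetric] field_simps power2_eq_square)
    next
      case off: False
      then show ?thesis using ker_off_ray[OF w False off, of \<beta>] by (simp add: a_def)
    qed
    ultimately show ?thesis by (simp add: divide_inverse algebra_simps)
  qed
qed

lemma ssum_ker: "\<omega> \<in> Rays \<Longrightarrow> ssum n (\<lambda>x. ker \<beta> x \<omega>) b =
    sph_poly n (of_nat q powr \<beta> + of_nat q / of_nat q powr \<beta>)"
  using ssum_eigenfunction[of "\<lambda>x. ker \<beta> x \<omega>" "of_nat q powr \<beta> + of_nat q / of_nat q powr \<beta>", OF ker_eigenfunction]
  by (simp add: ker_root)

lemma prob_\<nu>: "prob_space \<nu>" and space_\<nu>: "space \<nu> = Rays"
  and sets_\<nu>: "sets \<nu> = sigma_sets Rays {U. openin (boundary_topology E b) U}"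
  and measure_sec': "1 \<le> len x \<Longrightarrow> measure \<nu> (sec x) = 1 / (real (q + 1) * real q ^ (len x - 1))"
  using bm unfolding boundary_measure_def by auto

sublocale prob_space \<nu> by (rule prob_\<nu>)

lemma sec_measurable [measurable]: "sec x \<in> sets \<nu>"
  unfolding sets_\<nu> boundary_topology_def
  by (intro sigma_sets.Basic CollectI topology_generated_by_Basis) simp

lemma sec_root: "sec b = Rays"
  by (auto simp: sec_eq ray_0)

lemma integrable_ker: "integrable \<nu> (ker \<beta> x)"
proof (induction "len x" arbitrary: x)
  case 0
  then have "x = b" using d_eq_0 by metis
  have "integrable \<nu> (\<lambda>_. 1 :: complex)" by simp
  then show ?case unfolding \<open>x = b\<close>
    by (rule Bochner_Integration.integrable_cong[THEN iffD1, rotated -1]) (auto simp: space_\<nu> ker_root)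
next
  case (Suc n)
  then have x: "x \<noteq> b" by auto
  then have "integrable \<nu> (ker \<beta> (par x))" using Suc d_parent[OF x] by simp
  then have "integrable \<nu> (\<lambda>\<omega>. inverse (of_nat q powr \<beta>) * ker \<beta> (par x) \<omega> +
      jump (of_nat q powr \<beta>) (len x) * indicator (sec x) \<omega>)"
    by (intro Bochner_Integration.integrable_add integrable_mult_right integrable_mult_right
        integrable_real_indicator[THEN integrable_of_real, of "sec x", simplified of_real_indicator])
      (auto simp: less_top[symmetric])
  then show ?case
    by (rule Bochner_Integration.integrable_cong[THEN iffD1, rotated -1])
      (auto simp: space_\<nu> ker_recursion[OF _ x] indicator_def)
qed

lemma spherical_eq: "spherical q E b \<nu> z x = (LINT \<omega>|\<nu>. ker (1 / 2 + \<i> * z) x \<omega>)"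
  by (simp add: spherical_def poisson_transform_def ker_def)

lemma powr_half_add: "of_nat q powr (1 / 2 + \<i> * z) = of_real (sqrt q) * of_nat q powr (\<i> * z)"
proof -
  have "(of_nat q :: complex) powr (1 / 2) = of_real (real q powr (1 / 2))"
    using powr_of_real[of "real q" "1/2"] by simp
  then show ?thesis by (simp add: powr_add powr_half_sqrt)
qed

lemma ssum_spherical:
  "ssum n (spherical q E b \<nu> z) b = sph_poly n (joukowski (of_nat q powr (\<i> * z)))"
proof -
  let ?\<beta> = "1 / 2 + \<i> * z"
  have "ssum n (spherical q E b \<nu> z) b = (LINT \<omega>|\<nu>. ssum n (\<lambda>x. ker ?\<beta> x \<omega>) b)"
    unfolding ssum_def spherical_eq by (simp add: Bochner_Integration.integral_sum integrable_ker)
  also have "\<dots> = (LINT \<omega>|\<nu>. sph_poly n (of_nat q powr ?\<beta> + of_nat q / of_nat q powr ?\<beta>))"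
    by (rule Bochner_Integration.integral_cong) (auto simp: space_\<nu> ssum_ker)
  also have "\<dots> = sph_poly n (of_nat q powr ?\<beta> + of_nat q / of_nat q powr ?\<beta>)"
    by (simp add: prob_space)
  also have "of_nat q powr ?\<beta> + of_nat q / of_nat q powr ?\<beta> = joukowski (of_nat q powr (\<i> * z))"
  proof -
    have "of_real (sqrt q) * of_real (sqrt q) = (of_nat q :: complex)" by (simp flip: of_real_mult)
    moreover have "of_real (sqrt q) \<noteq> (0::complex)" using q_ge_2 by simp
    ultimately show ?thesis
      unfolding powr_half_add joukowski_def by (simp add: field_simps)
  qed
  finally show ?thesis .
qed

text \<open>For real \<open>z\<close> the kernel has modulus \<open>p\<^bsup>1/2\<^esup>\<close>. This majorant makes the sum in the spherical
  transform absolutely convergent.\<close>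

lemma norm_spherical_le:
  assumes z: "Im z = 0" shows "cmod (spherical q E b \<nu> z x) \<le> Re (spherical q E b \<nu> 0 x)"
proof -
  have q: "1 \<le> real q" using q_ge_2 by simp
  have n: "cmod (ker (1 / 2 + \<i> * z) x \<omega>) = Re (ker (1 / 2 + \<i> * 0) x \<omega>)" for \<omega>
  proof -
    have "0 < poisson_kernel q E b x \<omega>" using q by (simp add: poisson_kernel_def)
    then show ?thesis
      unfolding ker_def using z powr_of_real[of "poisson_kernel q E b x \<omega>" "1/2"]
      by (simp add: norm_powr_real_powr)
  qed
  have "cmod (spherical q E b \<nu> z x) \<le> (LINT \<omega>|\<nu>. cmod (ker (1 / 2 + \<i> * z) x \<omega>))"
    unfolding spherical_eq by (rule integral_norm_bound)
  also have "\<dots> = Re (spherical q E b \<nu> 0 x)"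
    unfolding n spherical_eq by (rule integral_Re[OF integrable_ker])
  finally show ?thesis .
qed

end

locale tree_boundary = tree_exponent q E p + boundary q E b \<nu> for q E p b \<nu>
begin

text \<open>Integrating the eigenfunction property of the Poisson kernel gives the spherical sums of the
  spherical function. The unordered sum over the tree is then evaluated by spheres. Real \<open>z\<close>
  suffice, because the equality of holomorphic functions on the unit circle determines the symbol.\<close>

lemma spherical_transform_eq_symbol:
  assumes z: "Im z = 0" and K: "summable (\<lambda>n. norm (\<kappa> n) * ((real n + 1) * sqrt q ^ n))"
  shows "spherical_transform q E b \<nu> \<kappa> z = symbol \<kappa> (of_nat q powr (\<i> * z))"
proof -
  let ?\<phi> = "spherical q E b \<nu>"
  have "summable (\<lambda>n. \<Sum>y\<in>tsphere b n. norm (\<kappa> (d b y) * ?\<phi> z y))"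
  proof (rule summable_norm_le[OF summable_mult[OF K, of 2]])
    fix n
    have "(\<Sum>y\<in>tsphere b n. norm (\<kappa> (d b y) * ?\<phi> z y)) \<le> (\<Sum>y\<in>tsphere b n. norm (\<kappa> n) * Re (?\<phi> 0 y))"
      unfolding norm_mult using norm_spherical_le[OF z]
      by (intro sum_mono mult_mono) (auto simp: tsphere_def)
    also have "\<dots> = norm (\<kappa> n) * Re (ssum n (?\<phi> 0) b)" by (simp add: ssum_def sum_distrib_left)
    also have "\<dots> \<le> norm (\<kappa> n) * (2 * (real n + 1) * sqrt q ^ n)"
    proof (rule mult_left_mono)
      show "Re (ssum n (?\<phi> 0) b) \<le> 2 * (real n + 1) * sqrt q ^ n"
        unfolding ssum_spherical using norm_sph_poly_le[of "of_nat q powr (\<i> * 0) :: complex" 1 n] q_ge_2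
        by (intro order_trans[OF complex_Re_le_cmod]) simp
    qed simp
    also have "\<dots> = 2 * (norm (\<kappa> n) * ((real n + 1) * sqrt q ^ n))" by (simp only: mult_ac)
    finally show "norm (\<Sum>y\<in>tsphere b n. norm (\<kappa> (d b y) * ?\<phi> z y)) \<le> 2 * (norm (\<kappa> n) * ((real n + 1) * sqrt q ^ n))"
      by (simp only: real_norm_def abs_of_nonneg sum_nonneg norm_ge_zero)
  qed
  then have "spherical_transform q E b \<nu> \<kappa> z = (\<Sum>n. \<Sum>y\<in>tsphere b n. \<kappa> (d b y) * ?\<phi> z y)"
    unfolding spherical_transform_def by (rule infsum_over_spheres)
  also have "(\<lambda>n. \<Sum>y\<in>tsphere b n. \<kappa> (d b y) * ?\<phi> z y) = (\<lambda>n. \<kappa> n * ssum n (?\<phi> z) b)"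
    unfolding ssum_def sum_distrib_left by (intro ext sum.cong) (auto simp: tsphere_def)
  finally show ?thesis by (simp add: ssum_spherical symbol_def)
qed

end

section \<open>Martingales on the boundary\<close>

text \<open>Jensen's inequality for the convex function \<open>u \<mapsto> u\<^sup>s\<close>.\<close>

lemma weighted_mean_powr_le:
  fixes w u :: "'i \<Rightarrow> real"
  assumes I: "finite I" and w: "\<And>i. i \<in> I \<Longrightarrow> 0 < w i" "sum w I = 1"
    and u: "\<And>i. i \<in> I \<Longrightarrow> 0 \<le> u i" and s: "1 \<le> s"
  shows "(\<Sum>i\<in>I. w i * u i) powr s \<le> (\<Sum>i\<in>I. w i * u i powr s)"
proof -
  let ?J = "{i\<in>I. 0 < u i}"
  have uI: "u i = 0" if "i \<in> I - ?J" for i using u that by force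
  have sum1: "(\<Sum>i\<in>I. w i * u i) = (\<Sum>i\<in>?J. w i * u i)"
    by (rule sum.mono_neutral_right) (use I uI in auto)
  have sum2: "(\<Sum>i\<in>I. w i * u i powr s) = (\<Sum>i\<in>?J. w i * u i powr s)"
    by (rule sum.mono_neutral_right) (use I uI s in auto)
  show ?thesis
  proof (cases "?J = {}")
    case True
    then show ?thesis unfolding sum1 sum2 True by simp
  next
    case False
    define W where "W = sum w ?J"
    have W0: "0 < W" unfolding W_def using False I w by (intro sum_pos) auto
    have "sum w ?J \<le> sum w I" using I w(1) by (intro sum_mono2) (auto intro: less_imp_le)
    then have W1: "W \<le> 1" using w by (simp add: W_def)
    have "(\<Sum>i\<in>?J. (w i / W) *\<^sub>R u i) powr s \<le> (\<Sum>i\<in>?J. (w i / W) * u i powr s)"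
    proof (rule convex_on_sum[OF _ False powr_convex])
      show "(\<Sum>i\<in>?J. w i / W) = 1" using W0 by (simp add: W_def flip: sum_divide_distrib)
    qed (use I w(1) W0 s in \<open>auto intro: less_imp_le\<close>)
    moreover have "(\<Sum>i\<in>?J. (w i / W) *\<^sub>R u i) = (\<Sum>i\<in>?J. w i * u i) / W"
      by (simp add: sum_divide_distrib)
    moreover have "(\<Sum>i\<in>?J. (w i / W) * u i powr s) = (\<Sum>i\<in>?J. w i * u i powr s) / W"
      by (simp add: sum_divide_distrib)
    ultimately have le: "((\<Sum>i\<in>?J. w i * u i) / W) powr s \<le> (\<Sum>i\<in>?J. w i * u i powr s) / W" by simp
    have nn: "0 \<le> (\<Sum>i\<in>?J. w i * u i)" using w(1) u by (intro sum_nonneg mult_nonneg_nonneg) (auto intro: less_imp_le)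
    have nn2: "0 \<le> (\<Sum>i\<in>?J. w i * u i powr s) / W"
      using w(1) W0 by (intro divide_nonneg_pos sum_nonneg mult_nonneg_nonneg) (auto intro: less_imp_le)
    have "(\<Sum>i\<in>?J. w i * u i) powr s = (W * ((\<Sum>i\<in>?J. w i * u i) / W)) powr s" using W0 by simp
    also have "\<dots> = W powr s * ((\<Sum>i\<in>?J. w i * u i) / W) powr s"
      using W0 nn by (intro powr_mult)
    also have "\<dots> \<le> W * ((\<Sum>i\<in>?J. w i * u i powr s) / W)"
    proof (rule mult_mono[OF _ le])
      show "W powr s \<le> W" using powr_mono'[of 1 s W] W0 W1 s by simp
    qed (use W0 in auto)
    also have "\<dots> = (\<Sum>i\<in>?J. w i * u i powr s)" using W0 by simp
    finally show ?thesis unfolding sum1 sum2 .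
  qed
qed

lemma fatou_bound:
  fixes u :: "nat \<Rightarrow> 'a \<Rightarrow> real"
  assumes u: "\<And>i. integrable M (u i)" "\<And>i x. 0 \<le> u i x" "\<And>i. integral\<^sup>L M (u i) \<le> C"
    and v: "v \<in> borel_measurable M" "\<And>x. 0 \<le> v x" and lim: "AE x in M. (\<lambda>i. u i x) \<longlonglongrightarrow> v x"
  shows "integrable M v" "integral\<^sup>L M v \<le> C"
proof -
  have "0 \<le> integral\<^sup>L M (u 0)" using u(2) by simp
  then have C0: "0 \<le> C" using u(3)[of 0] by simp
  have "(\<integral>\<^sup>+x. ennreal (v x) \<partial>M) = (\<integral>\<^sup>+x. liminf (\<lambda>i. ennreal (u i x)) \<partial>M)"
  proof (rule nn_integral_cong_AE)
    show "AE x in M. ennreal (v x) = liminf (\<lambda>i. ennreal (u i x))"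
      using lim
    proof eventually_elim
      case (elim x)
      then show ?case by (intro lim_imp_Liminf[symmetric]) (auto intro: tendsto_ennrealI)
    qed
  qed
  also have "\<dots> \<le> liminf (\<lambda>i. \<integral>\<^sup>+x. ennreal (u i x) \<partial>M)"
    using u(1) by (intro nn_integral_liminf) auto
  also have "\<dots> \<le> liminf (\<lambda>i. ennreal C)"
  proof (rule Liminf_mono, rule always_eventually, rule allI)
    fix i
    have "(\<integral>\<^sup>+x. ennreal (u i x) \<partial>M) = ennreal (integral\<^sup>L M (u i))"
      using u by (intro nn_integral_eq_integral) auto
    then show "(\<integral>\<^sup>+x. ennreal (u i x) \<partial>M) \<le> ennreal C" using u(3) by (simp add: ennreal_leI)
  qed
  also have "\<dots> = ennreal C" by (simp add: Liminf_const)
  finally have le: "(\<integral>\<^sup>+x. ennreal (v x) \<partial>M) \<le> ennreal C" .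
  then show int: "integrable M v"
    using v by (intro integrableI_nonneg) (auto intro: le_less_trans)
  have "ennreal (integral\<^sup>L M v) \<le> ennreal C"
    using le nn_integral_eq_integral[OF int] v(2) by simp
  then show "integral\<^sup>L M v \<le> C" using C0 by (simp add: ennreal_le_iff)
qed

context boundary begin

abbreviation "nu x \<equiv> measure \<nu> (sec x)"

lemma nu_root: "nu b = 1"
  unfolding sec_root using prob_space by (simp add: space_\<nu>)

lemma nu_children: "y \<in> children b x \<Longrightarrow> real (card (children b x)) * nu y = nu x"
proof -
  assume y: "y \<in> children b x"
  then have ly: "len y = Suc (len x)" by (simp add: children_def)
  show "real (card (children b x)) * nu y = nu x"
  proof (cases "x = b")
    case True
    then show ?thesis using ly by (simp add: measure_sec' card_children nu_root)
  next
    case False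
    then obtain m where m: "len x = Suc m" by (metis d_eq_0 not0_implies_Suc)
    then show ?thesis using ly False q_ge_2 by (simp add: measure_sec' card_children)
  qed
qed

lemma nu_pos: "0 < nu x"
  using q_ge_2 by (cases "x = b") (auto simp: nu_root measure_sec' Suc_le_eq)

lemma sum_nu_children: "(\<Sum>y\<in>children b x. nu y) = nu x"
proof -
  have c: "card (children b x) \<noteq> 0" using q_ge_2 by (simp add: card_children)
  have "nu y = nu x / real (card (children b x))" if "y \<in> children b x" for y
    using nu_children[OF that] c by (simp add: field_simps)
  then have "(\<Sum>y\<in>children b x. nu y) = (\<Sum>y\<in>children b x. nu x / real (card (children b x)))"
    by (rule sum.cong[OF refl])
  then show ?thesis using c by simp
qed

lemma nu_bounds: "nu x * real q ^ len x \<le> 1" "1 \<le> 2 * real q ^ len x * nu x"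
proof -
  have "nu x * real q ^ len x \<le> 1 \<and> 1 \<le> 2 * real q ^ len x * nu x"
  proof (cases "x = b")
    case True then show ?thesis by (simp add: nu_root)
  next
    case False
    then obtain m where m: "len x = Suc m" by (metis d_eq_0 not0_implies_Suc)
    then have nu: "nu x = 1 / (real (q + 1) * real q ^ m)" by (simp add: measure_sec')
    have "0 < real q ^ m" using q_ge_2 by simp
    then show ?thesis unfolding nu m using q_ge_2 by (simp add: divide_simps)
  qed
  then show "nu x * real q ^ len x \<le> 1" "1 \<le> 2 * real q ^ len x * nu x" by auto
qed

text \<open>A function of the \<open>n\<close>-th vertex of a ray is constant on each sector of level \<open>n\<close>.\<close>

lemma level_integral:
  fixes \<psi> :: "'a \<Rightarrow> 'b::{banach, second_countable_topology}"
  shows "has_bochner_integral \<nu> (\<lambda>\<omega>. \<psi> (\<omega> n)) (\<Sum>x\<in>tsphere b n. nu x *\<^sub>R \<psi> x)"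
proof -
  have "has_bochner_integral \<nu> (\<lambda>\<omega>. \<Sum>x\<in>tsphere b n. indicator (sec x) \<omega> *\<^sub>R \<psi> x) (\<Sum>x\<in>tsphere b n. nu x *\<^sub>R \<psi> x)"
    by (intro has_bochner_integral_sum has_bochner_integral_indicator sec_measurable) (simp add: less_top[symmetric])
  moreover have "(\<Sum>x\<in>tsphere b n. indicator (sec x) \<omega> *\<^sub>R \<psi> x) = \<psi> (\<omega> n)" if w: "\<omega> \<in> space \<nu>" for \<omega>
  proof -
    have wR: "\<omega> \<in> Rays" using w by (simp add: space_\<nu>)
    have "(\<Sum>x\<in>tsphere b n. indicator (sec x) \<omega> *\<^sub>R \<psi> x) = (\<Sum>x\<in>tsphere b n. if x = \<omega> n then \<psi> x else 0)"
      using wR by (intro sum.cong) (auto simp: sec_eq tsphere_def indicator_def)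
    moreover have "\<omega> n \<in> tsphere b n" using len_ray[OF wR] by (simp add: tsphere_def)
    ultimately show ?thesis by simp
  qed
  ultimately show ?thesis by (subst has_bochner_integral_cong[where g = "\<lambda>\<omega>. \<Sum>x\<in>tsphere b n. indicator (sec x) \<omega> *\<^sub>R \<psi> x"]) auto
qed

lemma integrable_level: "integrable \<nu> (\<lambda>\<omega>. (\<psi> (\<omega> n) :: 'b::{banach, second_countable_topology}))"
  using level_integral integrable.intros by blast

lemma integral_level: "(LINT \<omega>|\<nu>. (\<psi> (\<omega> n) :: 'b::{banach, second_countable_topology})) = (\<Sum>x\<in>tsphere b n. nu x *\<^sub>R \<psi> x)"
  using level_integral by (rule has_bochner_integral_integral_eq)

lemma ancestor_ray: "\<omega> \<in> Rays \<Longrightarrow> ((parent b) ^^ k) (\<omega> (m + k)) = \<omega> m"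
  by (induction k) (auto simp: funpow_swap1 par_ray funpow_Suc_right simp del: funpow.simps)

end

text \<open>A complex finitely additive measure on the algebra generated by the sectors. Its densities with
  respect to \<open>\<nu>\<close> on successive levels form a martingale, and this is formulated without conditional
  expectations by testing against functions of the \<open>n\<close>-th vertex.\<close>

locale martingale = boundary +
  fixes mass :: "'a \<Rightarrow> complex"
  assumes mass_children: "(\<Sum>y\<in>children b x. mass y) = mass x"
begin

definition dens :: "'a \<Rightarrow> complex" where "dens x = mass x / of_real (nu x)"

lemma nu_dens: "nu x *\<^sub>R dens x = mass x"
  using nu_pos[of x] by (simp add: dens_def scaleR_conv_of_real)

abbreviation "Fm n \<omega> \<equiv> dens (\<omega> n)"

lemma martingale_step: "(LINT \<omega>|\<nu>. \<psi> (\<omega> n) * Fm (Suc n) \<omega>) = (LINT \<omega>|\<nu>. \<psi> (\<omega> n) * Fm n \<omega>)"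
proof -
  have "(LINT \<omega>|\<nu>. \<psi> (\<omega> n) * Fm (Suc n) \<omega>) = (LINT \<omega>|\<nu>. \<psi> (par (\<omega> (Suc n))) * Fm (Suc n) \<omega>)"
    by (rule Bochner_Integration.integral_cong) (auto simp: space_\<nu> par_ray)
  also have "\<dots> = (\<Sum>y\<in>tsphere b (Suc n). nu y *\<^sub>R (\<psi> (par y) * dens y))"
    using integral_level[of "\<lambda>y. \<psi> (par y) * dens y" "Suc n"] by simp
  also have "\<dots> = (\<Sum>y\<in>tsphere b (Suc n). \<psi> (par y) * mass y)"
    by (simp add: nu_dens[symmetric])
  also have "\<dots> = (\<Sum>x\<in>tsphere b n. \<Sum>y\<in>children b x. \<psi> (par y) * mass y)" by (rule sum_sphere_Suc)
  also have "\<dots> = (\<Sum>x\<in>tsphere b n. nu x *\<^sub>R (\<psi> x * dens x))"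
  proof (rule sum.cong[OF refl])
    fix x
    have "(\<Sum>y\<in>children b x. \<psi> (par y) * mass y) = (\<Sum>y\<in>children b x. \<psi> x * mass y)"
      by (intro sum.cong) (auto simp: parent_child)
    also have "\<dots> = \<psi> x * mass x" by (simp add: mass_children flip: sum_distrib_left)
    finally show "(\<Sum>y\<in>children b x. \<psi> (par y) * mass y) = nu x *\<^sub>R (\<psi> x * dens x)" by (simp add: nu_dens[symmetric])
  qed
  also have "\<dots> = (LINT \<omega>|\<nu>. \<psi> (\<omega> n) * Fm n \<omega>)"
    using integral_level[of "\<lambda>y. \<psi> y * dens y" n] by simp
  finally show ?thesis .
qed

lemma martingale_property: "(LINT \<omega>|\<nu>. \<psi> (\<omega> m) * Fm (m + k) \<omega>) = (LINT \<omega>|\<nu>. \<psi> (\<omega> m) * Fm m \<omega>)"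
proof (induction k)
  case (Suc k)
  let ?\<chi> = "\<lambda>y. \<psi> (((parent b) ^^ k) y)"
  have \<chi>: "?\<chi> (\<omega> (m + k)) = \<psi> (\<omega> m)" if "\<omega> \<in> space \<nu>" for \<omega>
    using that ancestor_ray[of \<omega> k m] by (simp add: space_\<nu>)
  have "(LINT \<omega>|\<nu>. \<psi> (\<omega> m) * Fm (m + Suc k) \<omega>) = (LINT \<omega>|\<nu>. ?\<chi> (\<omega> (m + k)) * Fm (Suc (m + k)) \<omega>)"
    by (rule Bochner_Integration.integral_cong) (auto simp: \<chi>)
  also have "\<dots> = (LINT \<omega>|\<nu>. ?\<chi> (\<omega> (m + k)) * Fm (m + k) \<omega>)" by (rule martingale_step)
  also have "\<dots> = (LINT \<omega>|\<nu>. \<psi> (\<omega> m) * Fm (m + k) \<omega>)"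
    by (rule Bochner_Integration.integral_cong) (auto simp: \<chi>)
  finally show ?case using Suc by simp
qed simp

lemma sector_integral:
  assumes "len x \<le> n" shows "(LINT \<omega>|\<nu>. indicator (sec x) \<omega> * Fm n \<omega>) = mass x"
proof -
  obtain k where n: "n = len x + k" using assms le_iff_add by auto
  let ?\<psi> = "\<lambda>y. if y = x then 1 else 0 :: complex"
  have "(LINT \<omega>|\<nu>. indicator (sec x) \<omega> * Fm n \<omega>) = (LINT \<omega>|\<nu>. ?\<psi> (\<omega> (len x)) * Fm (len x + k) \<omega>)"
    unfolding n by (rule Bochner_Integration.integral_cong) (auto simp: space_\<nu> sec_eq indicator_def)
  also have "\<dots> = (LINT \<omega>|\<nu>. ?\<psi> (\<omega> (len x)) * Fm (len x) \<omega>)" by (rule martingale_property)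
  also have "\<dots> = (\<Sum>y\<in>tsphere b (len x). nu y *\<^sub>R (?\<psi> y * dens y))"
    using integral_level[of "\<lambda>y. ?\<psi> y * dens y" "len x"] by simp
  also have "\<dots> = (\<Sum>y\<in>tsphere b (len x). if y = x then mass x else 0)"
    by (intro sum.cong) (auto simp: nu_dens)
  also have "x \<in> tsphere b (len x)" by (simp add: tsphere_def)
  then have "(\<Sum>y\<in>tsphere b (len x). if y = x then mass x else 0) = mass x" by simp
  finally show ?thesis .
qed

definition energy :: "nat \<Rightarrow> real" where
  "energy n = (LINT \<omega>|\<nu>. cmod (Fm n \<omega>) ^ 2)"

lemma integrable_two_levels:
  "integrable \<nu> (\<lambda>\<omega>. h (\<omega> m) (\<omega> (m + k)) :: 'b::{banach, second_countable_topology})"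
proof -
  have "integrable \<nu> (\<lambda>\<omega>. (\<lambda>y. h (((parent b) ^^ k) y) y) (\<omega> (m + k)))" by (rule integrable_level)
  then show ?thesis
    by (rule Bochner_Integration.integrable_cong[THEN iffD1, rotated -1]) (auto simp: space_\<nu> ancestor_ray)
qed

text \<open>The increments of a martingale are orthogonal to its past.\<close>

lemma energy_increment:
  "(LINT \<omega>|\<nu>. cmod (Fm (m + k) \<omega> - Fm m \<omega>) ^ 2) = energy (m + k) - energy m"
proof -
  let ?c = "\<lambda>\<omega>. cnj (Fm m \<omega>) * Fm (m + k) \<omega>"
  have ic: "integrable \<nu> ?c" by (rule integrable_two_levels[of "\<lambda>x y. cnj (dens x) * dens y"])
  have "(LINT \<omega>|\<nu>. ?c \<omega>) = (LINT \<omega>|\<nu>. cnj (Fm m \<omega>) * Fm m \<omega>)"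
    by (rule martingale_property[of "\<lambda>x. cnj (dens x)"])
  also have "\<dots> = (LINT \<omega>|\<nu>. complex_of_real (cmod (Fm m \<omega>) ^ 2))"
    by (intro Bochner_Integration.integral_cong refl) (simp add: complex_norm_square mult.commute del: of_real_power)
  also have "\<dots> = of_real (energy m)" unfolding energy_def by (rule integral_complex_of_real)
  finally have c: "(LINT \<omega>|\<nu>. Re (?c \<omega>)) = energy m" using integral_Re[OF ic] by simp
  have "(LINT \<omega>|\<nu>. cmod (Fm (m + k) \<omega> - Fm m \<omega>) ^ 2) =
      (LINT \<omega>|\<nu>. cmod (Fm (m + k) \<omega>) ^ 2 + cmod (Fm m \<omega>) ^ 2 - 2 * Re (?c \<omega>))"
    by (intro Bochner_Integration.integral_cong refl)
      (simp add: cmod_power2, simp add: power2_eq_square algebra_simps)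
  also have "\<dots> = (LINT \<omega>|\<nu>. cmod (Fm (m + k) \<omega>) ^ 2 + cmod (Fm m \<omega>) ^ 2) - (LINT \<omega>|\<nu>. 2 * Re (?c \<omega>))"
    by (intro Bochner_Integration.integral_diff Bochner_Integration.integrable_add integrable_mult_right
        integrable_Re[OF ic] integrable_level[of "\<lambda>x. cmod (dens x) ^ 2"])
  also have "(LINT \<omega>|\<nu>. cmod (Fm (m + k) \<omega>) ^ 2 + cmod (Fm m \<omega>) ^ 2) = energy (m + k) + energy m"
    unfolding energy_def
    by (intro Bochner_Integration.integral_add integrable_level[of "\<lambda>x. cmod (dens x) ^ 2"])
  also have "(LINT \<omega>|\<nu>. 2 * Re (?c \<omega>)) = 2 * energy m"
    unfolding c[symmetric] by (rule integral_mult_right_zero)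
  finally show ?thesis by simp
qed

text \<open>Instead of the Cauchy-Schwarz inequality, \<open>2 e u \<le> e\<^sup>2 + u\<^sup>2\<close> is integrated.\<close>

lemma L1_increment_le:
  assumes "0 < e" "energy (m + k) - energy m \<le> e^2"
  shows "(LINT \<omega>|\<nu>. cmod (Fm (m + k) \<omega> - Fm m \<omega>)) \<le> e"
proof -
  let ?u = "\<lambda>\<omega>. cmod (Fm (m + k) \<omega> - Fm m \<omega>)"
  have i1: "integrable \<nu> ?u" by (rule integrable_two_levels[of "\<lambda>x y. cmod (dens y - dens x)"])
  have i2: "integrable \<nu> (\<lambda>\<omega>. ?u \<omega> ^ 2)" by (rule integrable_two_levels[of "\<lambda>x y. cmod (dens y - dens x) ^ 2"])
  have "(LINT \<omega>|\<nu>. ?u \<omega>) \<le> (LINT \<omega>|\<nu>. e / 2 + ?u \<omega> ^ 2 * (1 / (2 * e)))"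
  proof (rule integral_mono[OF i1])
    fix \<omega>
    have "0 \<le> (?u \<omega> - e)^2" by simp
    then show "?u \<omega> \<le> e / 2 + ?u \<omega> ^ 2 * (1 / (2 * e))"
      using assms(1) by (simp add: field_simps power2_eq_square)
  qed (intro Bochner_Integration.integrable_add integrable_mult_left i2, simp)
  also have "\<dots> = e / 2 + (energy (m + k) - energy m) * (1 / (2 * e))"
    using i2 by (simp add: energy_increment[symmetric] prob_space)
  also have "\<dots> \<le> e / 2 + e^2 * (1 / (2 * e))" using assms by (intro add_left_mono mult_right_mono) auto
  also have "\<dots> = e" using assms(1) by (simp add: power2_eq_square)
  finally show ?thesis .
qed

text \<open>Bounded increasing energies are Cauchy, hence so is the martingale in \<open>L\<^sup>1\<close>; an almost surely
  convergent subsequence supplies the limit function. The integral over a sector passes to the limit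
  because it is constant from some level on. The fourth conclusion is Fatou's lemma along the
  subsequence; with a power for \<open>\<theta>\<close> it puts the limit into \<open>L\<^bsup>p'\<^esup>\<close>.\<close>

lemma limit_exists:
  assumes V: "\<And>n. energy n \<le> V"
  obtains F where "F \<in> borel_measurable \<nu>" "integrable \<nu> F"
    "\<And>x. (LINT \<omega>|\<nu>. indicator (sec x) \<omega> * F \<omega>) = mass x"
    "\<And>\<theta> C. continuous_on UNIV \<theta> \<Longrightarrow> (\<And>t. 0 \<le> \<theta> t) \<Longrightarrow>
      (\<And>n. (LINT \<omega>|\<nu>. \<theta> (cmod (Fm n \<omega>))) \<le> C) \<Longrightarrow> integrable \<nu> (\<lambda>\<omega>. \<theta> (cmod (F \<omega>)) :: real)"
    "\<And>C. (\<And>x. cmod (dens x) \<le> C) \<Longrightarrow> AE \<omega> in \<nu>. cmod (F \<omega>) \<le> C"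
proof -
  have inc: "incseq energy"
  proof (rule incseq_SucI)
    fix n
    have "0 \<le> (LINT \<omega>|\<nu>. cmod (Fm (n + 1) \<omega> - Fm n \<omega>) ^ 2)" by simp
    then show "energy n \<le> energy (Suc n)" unfolding energy_increment by simp
  qed
  obtain l where "energy \<longlonglongrightarrow> l" using incseq_convergent[OF inc, of V] V by blast
  then have "convergent energy" by (rule convergentI)
  then have Cau: "Cauchy energy" by (simp add: Cauchy_convergent_iff)
  have small: "\<exists>N. \<forall>i\<ge>N. \<forall>j\<ge>N. (LINT \<omega>|\<nu>. cmod (Fm i \<omega> - Fm j \<omega>)) \<le> e" if e: "0 < e" for e
  proof -
    obtain N where N: "\<And>i j. N \<le> i \<Longrightarrow> N \<le> j \<Longrightarrow> dist (energy i) (energy j) < e^2"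
      using Cau e unfolding Cauchy_def by (meson zero_less_power)
    have one: "(LINT \<omega>|\<nu>. cmod (Fm i \<omega> - Fm j \<omega>)) \<le> e" if "N \<le> j" "j \<le> i" for i j
    proof -
      have ji: "j \<le> i" using that by simp
      obtain k where k: "i = j + k" using le_Suc_ex[OF ji] by blast
      have "energy (j + k) - energy j \<le> e^2" using N[of i j] that k by (simp add: dist_real_def)
      then show ?thesis unfolding k by (rule L1_increment_le[OF e])
    qed
    have "(LINT \<omega>|\<nu>. cmod (Fm i \<omega> - Fm j \<omega>)) \<le> e" if "N \<le> i" "N \<le> j" for i j
      using one[of i j] one[of j i] that by (cases "j \<le> i") (auto simp: norm_minus_commute)
    then show ?thesis by blast
  qed
  have intF: "integrable \<nu> (Fm n)" for n by (rule integrable_level)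
  obtain \<rho> where \<rho>: "strict_mono \<rho>" "AE \<omega> in \<nu>. Cauchy (\<lambda>i. Fm (\<rho> i) \<omega>)"
  proof (rule cauchy_L1_AE_cauchy_subseq[of \<nu> Fm])
    show "integrable \<nu> (Fm n)" for n by (rule intF)
    fix e :: real assume "0 < e"
    then obtain N where "\<forall>i\<ge>N. \<forall>j\<ge>N. (LINT \<omega>|\<nu>. cmod (Fm i \<omega> - Fm j \<omega>)) \<le> e / 2" using small[of "e / 2"] by auto
    then show "\<exists>N. \<forall>i\<ge>N. \<forall>j\<ge>N. (LINT \<omega>|\<nu>. cmod (Fm i \<omega> - Fm j \<omega>)) < e"
      using \<open>0 < e\<close> by (intro exI[of _ N]) (smt (verit) field_sum_of_halves)
  qed
  define F where "F \<omega> = lim (\<lambda>i. Fm (\<rho> i) \<omega>)" for \<omega>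
  have meas: "F \<in> borel_measurable \<nu>"
    unfolding F_def[abs_def] using intF by (intro borel_measurable_lim_metric) auto
  have lim: "AE \<omega> in \<nu>. (\<lambda>i. Fm (\<rho> i) \<omega>) \<longlonglongrightarrow> F \<omega>"
    using \<rho>(2) by eventually_elim (simp add: F_def Cauchy_convergent_iff convergent_LIMSEQ_iff)
  have L1: "integrable \<nu> (\<lambda>\<omega>. cmod (F \<omega> - Fm (\<rho> j) \<omega>))" "(LINT \<omega>|\<nu>. cmod (F \<omega> - Fm (\<rho> j) \<omega>)) \<le> e"
    if N: "\<forall>i\<ge>N. \<forall>j\<ge>N. (LINT \<omega>|\<nu>. cmod (Fm i \<omega> - Fm j \<omega>)) \<le> e" and j: "N \<le> j" for e N j
  proof -
    let ?u = "\<lambda>i \<omega>. cmod (Fm (\<rho> (i + N)) \<omega> - Fm (\<rho> j) \<omega>)"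
    have ge: "N \<le> \<rho> (i + N)" "N \<le> \<rho> j" for i
      using seq_suble[OF \<rho>(1), of "i + N"] seq_suble[OF \<rho>(1), of j] j by auto
    have 1: "integrable \<nu> (?u i)" for i using intF by (intro integrable_norm Bochner_Integration.integrable_diff)
    have 2: "integral\<^sup>L \<nu> (?u i) \<le> e" for i using N ge by auto
    have 3: "AE \<omega> in \<nu>. (\<lambda>i. ?u i \<omega>) \<longlonglongrightarrow> cmod (F \<omega> - Fm (\<rho> j) \<omega>)"
      using lim by eventually_elim (intro tendsto_intros LIMSEQ_ignore_initial_segment)
    have 4: "(\<lambda>\<omega>. cmod (F \<omega> - Fm (\<rho> j) \<omega>)) \<in> borel_measurable \<nu>" using meas intF by simp
    show "integrable \<nu> (\<lambda>\<omega>. cmod (F \<omega> - Fm (\<rho> j) \<omega>))" "(LINT \<omega>|\<nu>. cmod (F \<omega> - Fm (\<rho> j) \<omega>)) \<le> e"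
      using fatou_bound[OF 1 _ 2 4 _ 3] by auto
  qed
  have int: "integrable \<nu> F"
  proof -
    obtain N where N: "\<forall>i\<ge>N. \<forall>j\<ge>N. (LINT \<omega>|\<nu>. cmod (Fm i \<omega> - Fm j \<omega>)) \<le> 1" using small[of 1] by auto
    have "integrable \<nu> (\<lambda>\<omega>. F \<omega> - Fm (\<rho> N) \<omega>)"
      using L1(1)[OF N order_refl] meas intF by (subst integrable_norm_iff[symmetric]) auto
    from Bochner_Integration.integrable_add[OF this intF[of "\<rho> N"]] show ?thesis by simp
  qed
  have sector: "(LINT \<omega>|\<nu>. indicator (sec x) \<omega> * F \<omega>) = mass x" for x
  proof -
    let ?d = "cmod ((LINT \<omega>|\<nu>. indicator (sec x) \<omega> * F \<omega>) - mass x)"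
    have im: "integrable \<nu> (\<lambda>\<omega>. indicator (sec x) \<omega> * h \<omega>)" if "integrable \<nu> h" for h :: "_ \<Rightarrow> complex"
    proof -
      have "integrable \<nu> (\<lambda>\<omega>. indicator (sec x) \<omega> *\<^sub>R h \<omega>)" using that by (intro integrable_mult_indicator) auto
      moreover have "(\<lambda>\<omega>. indicator (sec x) \<omega> *\<^sub>R h \<omega>) = (\<lambda>\<omega>. indicator (sec x) \<omega> * h \<omega>)"
        by (auto simp: indicator_def fun_eq_iff)
      ultimately show ?thesis by simp
    qed
    have "?d \<le> e" if e: "0 < e" for e
    proof -
      obtain N where N: "\<forall>i\<ge>N. \<forall>j\<ge>N. (LINT \<omega>|\<nu>. cmod (Fm i \<omega> - Fm j \<omega>)) \<le> e" using small[OF e] by auto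
      define j where "j = max N (len x)"
      have j: "N \<le> j" "len x \<le> \<rho> j" using seq_suble[OF \<rho>(1), of j] by (auto simp: j_def)
      have iD: "integrable \<nu> (\<lambda>\<omega>. F \<omega> - Fm (\<rho> j) \<omega>)" using int intF by simp
      have "(LINT \<omega>|\<nu>. indicator (sec x) \<omega> * F \<omega>) - mass x =
          (LINT \<omega>|\<nu>. indicator (sec x) \<omega> * F \<omega>) - (LINT \<omega>|\<nu>. indicator (sec x) \<omega> * Fm (\<rho> j) \<omega>)"
        using sector_integral[OF j(2)] by simp
      also have "\<dots> = (LINT \<omega>|\<nu>. indicator (sec x) \<omega> * F \<omega> - indicator (sec x) \<omega> * Fm (\<rho> j) \<omega>)"
        using im[OF int] im[OF intF[of "\<rho> j"]] by (rule Bochner_Integration.integral_diff[symmetric])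
      also have "\<dots> = (LINT \<omega>|\<nu>. indicator (sec x) \<omega> * (F \<omega> - Fm (\<rho> j) \<omega>))"
        by (simp only: right_diff_distrib)
      finally have "?d \<le> (LINT \<omega>|\<nu>. cmod (indicator (sec x) \<omega> * (F \<omega> - Fm (\<rho> j) \<omega>)))"
        by (simp only: integral_norm_bound)
      also have "\<dots> \<le> (LINT \<omega>|\<nu>. cmod (F \<omega> - Fm (\<rho> j) \<omega>))"
        using im[OF iD] iD
        by (intro integral_mono integrable_norm) (auto simp: norm_mult indicator_def)
      also have "\<dots> \<le> e" by (rule L1(2)[OF N j(1)])
      finally show ?thesis .
    qed
    then have "?d \<le> 0" by (rule field_le_epsilon[of _ 0, simplified])
    then show ?thesis by simp
  qed
  show ?thesis
  proof (rule that[OF meas int sector])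
    fix \<theta> :: "real \<Rightarrow> real" and C :: real
    assume th: "continuous_on UNIV \<theta>" "\<And>t. 0 \<le> \<theta> t" "\<And>n. (LINT \<omega>|\<nu>. \<theta> (cmod (Fm n \<omega>))) \<le> C"
    show "integrable \<nu> (\<lambda>\<omega>. \<theta> (cmod (F \<omega>)))"
    proof (rule fatou_bound(1)[where u = "\<lambda>i \<omega>. \<theta> (cmod (Fm (\<rho> i) \<omega>))" and C = C])
      show "integrable \<nu> (\<lambda>\<omega>. \<theta> (cmod (Fm (\<rho> i) \<omega>)))" for i
        by (rule integrable_level[of "\<lambda>x. \<theta> (cmod (dens x))"])
      show "(\<lambda>\<omega>. \<theta> (cmod (F \<omega>))) \<in> borel_measurable \<nu>"
        using borel_measurable_continuous_onI[OF th(1)] meas by simp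
      show "AE \<omega> in \<nu>. (\<lambda>i. \<theta> (cmod (Fm (\<rho> i) \<omega>))) \<longlonglongrightarrow> \<theta> (cmod (F \<omega>))"
        using lim
      proof eventually_elim
        case (elim \<omega>)
        have "isCont \<theta> (cmod (F \<omega>))" using th(1) by (simp add: continuous_on_eq_continuous_at)
        then show ?case by (rule isCont_tendsto_compose) (intro tendsto_norm elim)
      qed
    qed (use th in auto)
  next
    fix C assume C: "\<And>x. cmod (dens x) \<le> C"
    show "AE \<omega> in \<nu>. cmod (F \<omega>) \<le> C"
      using lim
    proof eventually_elim
      case (elim \<omega>)
      have "(\<lambda>i. cmod (Fm (\<rho> i) \<omega>)) \<longlonglongrightarrow> cmod (F \<omega>)" by (intro tendsto_norm elim)
      then show ?case by (rule LIMSEQ_le_const2) (use C in auto)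
    qed
  qed
qed

end

section \<open>Eigenfunctions as Poisson transforms\<close>

context tree_boundary begin

text \<open>The number \<open>q\<^bsup>1/p + i\<alpha>\<^esup>\<close>, the ratio by which the Poisson kernel with parameter \<open>\<alpha> + i\<delta>\<^bsub>p'\<^esub>\<close> grows along its
  ray.\<close>

definition base :: "real \<Rightarrow> complex" where
  "base \<alpha> = of_nat q powr (1 / 2 + \<i> * spec_param p \<alpha>)"

lemma delta_r: "delta r = 1 / 2 - 1 / p"
proof (cases "p = 1")
  case False
  then have p1: "1 < p" using p by simp
  show ?thesis unfolding conj_exponent_finite(1)[OF p1] using conj_exponent_finite(2)[OF p1] by (simp add: delta_def)
qed (simp add: conj_exponent_def delta_def)

lemma exponent_eq: "1 / 2 + \<i> * spec_param p \<alpha> = of_real (1 / p) + \<i> * of_real \<alpha>"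
  by (simp add: spec_param_def delta_r complex_eq_iff)

lemma norm_base: "cmod (base \<alpha>) = real q powr (1 / p)"
  unfolding base_def exponent_eq using norm_powr_real_powr[of "of_nat q" "of_real (1 / p) + \<i> * of_real \<alpha>"] q_ge_2
  by simp

lemma base_nz: "base \<alpha> \<noteq> 0"
  unfolding base_def by (rule base_nonzero)

lemma norm_base_ge: "2 \<le> cmod (base \<alpha>) ^ 2" "1 < cmod (base \<alpha>)"
proof -
  have "real q powr 1 \<le> real q powr (2 / p)" using p q_ge_2 by (intro powr_mono) (auto simp: field_simps)
  also have "real q powr (2 / p) = cmod (base \<alpha>) ^ 2"
    using q_ge_2 by (simp add: norm_base powr_powr flip: powr_realpow)
  finally show 2: "2 \<le> cmod (base \<alpha>) ^ 2" using q_ge_2 by simp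
  show "1 < cmod (base \<alpha>)"
  proof (rule ccontr)
    assume "\<not> ?thesis"
    then have "cmod (base \<alpha>) ^ 2 \<le> 1" by (intro power_le_one) auto
    then show False using 2 by simp
  qed
qed

lemma gamma_base: "gamma_sym q (spec_param p \<alpha>) = 1 - (base \<alpha> + of_nat q / base \<alpha>) / of_nat (q + 1)"
proof -
  have "of_nat q powr (1 / 2 - \<i> * spec_param p \<alpha>) = of_nat q powr (1 - (1 / 2 + \<i> * spec_param p \<alpha>))"
    by (simp add: algebra_simps)
  also have "\<dots> = of_nat q / base \<alpha>" unfolding base_def powr_diff using q_ge_2 by simp
  finally show ?thesis by (simp add: gamma_sym_def base_def)
qed

lemma norm_jump_ge: "cmod (base \<alpha>) ^ n / 2 \<le> cmod (jump (base \<alpha>) n)"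
proof -
  let ?a = "base \<alpha>"
  have "jump ?a n = ?a ^ n * (1 - 1 / ?a^2)" by (simp add: jump_def algebra_simps)
  then have "cmod (jump ?a n) = cmod ?a ^ n * cmod (1 - 1 / ?a^2)" by (simp add: norm_mult norm_power)
  moreover have "1 / 2 \<le> cmod (1 - 1 / ?a^2)"
  proof -
    have "cmod (1 / ?a^2) \<le> 1 / 2" using norm_base_ge(1)[of \<alpha>] by (simp add: norm_divide norm_power divide_simps)
    then show ?thesis using norm_triangle_ineq2[of 1 "1 / ?a^2"] by simp
  qed
  ultimately show ?thesis using mult_left_mono[of "1/2" "cmod (1 - 1 / ?a^2)" "cmod ?a ^ n"] by simp
qed

lemma jump_nz: "jump (base \<alpha>) n \<noteq> 0"
  using norm_jump_ge[of \<alpha> n] norm_base_ge(2)[of \<alpha>] by (metis divide_le_0_iff norm_zero not_less zero_less_power zero_less_one less_trans zero_less_numeral)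

text \<open>For a Poisson transform of \<open>F\<close> this is the integral of \<open>F\<close> over the sector of \<open>x\<close>, by solving
  the recursion of the kernel.\<close>

definition eigen_mass :: "real \<Rightarrow> ('a \<Rightarrow> complex) \<Rightarrow> 'a \<Rightarrow> complex" where
  "eigen_mass \<alpha> g x = (if x = b then g b else (g x - g (par x) / base \<alpha>) / jump (base \<alpha>) (len x))"

text \<open>The eigenvalue equation at \<open>x\<close> determines the sum of \<open>g\<close> over the children from \<open>g\<close> at \<open>x\<close> and at the
  parent. The constants in the jump are such that this is additivity.\<close>

lemma eigen_mass_children:
  assumes g: "L g = (\<lambda>x. gamma_sym q (spec_param p \<alpha>) * g x)"
  shows "(\<Sum>y\<in>children b x. eigen_mass \<alpha> g y) = eigen_mass \<alpha> g x"
proof -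
  let ?a = "base \<alpha>"
  have a0: "?a \<noteq> 0" by (rule base_nz)
  have A: "ssum (Suc 0) g x = (?a + of_nat q / ?a) * g x" for x
  proof -
    define N where "N = (of_nat (q + 1) :: complex)"
    have n: "N \<noteq> 0" unfolding N_def of_nat_eq_0_iff by simp
    have solve: "w = u - v" if "u - w = v" for u v w :: complex
      by (simp flip: that)
    have "L g x = (1 - (?a + of_nat q / ?a) / N) * g x"
      using g unfolding gamma_base N_def by (rule fun_cong)
    then have "g x - inverse N * ssum (Suc 0) g x = (1 - (?a + of_nat q / ?a) / N) * g x"
      unfolding L_eq N_def .
    from solve[OF this] have "inverse N * ssum (Suc 0) g x = (?a + of_nat q / ?a) / N * g x"
      by (simp add: left_diff_distrib)
    then have "N * (inverse N * ssum (Suc 0) g x) = N * ((?a + of_nat q / ?a) / N * g x)" by (rule arg_cong)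
    then show ?thesis using n by (simp flip: mult.assoc)
  qed
  have "(\<Sum>y\<in>children b x. eigen_mass \<alpha> g y) = (\<Sum>y\<in>children b x. (g y - g x / ?a) / jump ?a (Suc (len x)))"
    by (intro sum.cong refl) (auto simp: eigen_mass_def parent_child children_ne children_def)
  also have "\<dots> = ((\<Sum>y\<in>children b x. g y) - of_nat (card (children b x)) * (g x / ?a)) / jump ?a (Suc (len x))"
    by (simp add: sum_subtractf flip: sum_divide_distrib)
  finally have S: "(\<Sum>y\<in>children b x. eigen_mass \<alpha> g y) =
      ((\<Sum>y\<in>children b x. g y) - of_nat (card (children b x)) * (g x / ?a)) / jump ?a (Suc (len x))" .
  show ?thesis
  proof (cases "x = b")
    case True
    have "(\<Sum>y\<in>children b b. g y) = (?a + of_nat q / ?a) * g b"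
      using A[of b] by (simp add: ssum_1 nbrs_root)
    moreover have "(?a + of_nat q / ?a) * g b - of_nat (q + 1) * (g b / ?a) = jump ?a 1 * g b"
      using a0 by (simp add: jump_def field_simps power2_eq_square)
    ultimately show ?thesis
      using S jump_nz[of \<alpha> 1] by (simp add: True card_children eigen_mass_def del: of_nat_add of_nat_Suc)
  next
    case False
    have c: "(\<Sum>y\<in>children b x. g y) = (?a + of_nat q / ?a) * g x - g (par x)"
      using A[of x] by (simp add: ssum_1 sum_nbrs[OF False] eq_diff_eq add.commute)
    have "(?a + of_nat q / ?a) * g x - g (par x) - of_nat q * (g x / ?a) = ?a * (g x - g (par x) / ?a)"
      using a0 by (simp add: field_simps)
    moreover have "jump ?a (Suc (len x)) = ?a * jump ?a (len x)"
      by (simp add: jump_def algebra_simps)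
    ultimately show ?thesis
      using S False a0 jump_nz[of \<alpha> "len x"] by (simp add: c card_children eigen_mass_def)
  qed
qed

lemma eigenfunction_recursion:
  "x \<noteq> b \<Longrightarrow> g x = inverse (base \<alpha>) * g (par x) + jump (base \<alpha>) (len x) * eigen_mass \<alpha> g x"
proof -
  assume "x \<noteq> b"
  then have "jump (base \<alpha>) (len x) * eigen_mass \<alpha> g x = g x - g (par x) / base \<alpha>"
    using jump_nz[of \<alpha> "len x"] by (simp add: eigen_mass_def)
  then show ?thesis by (simp add: divide_inverse mult.commute)
qed

text \<open>The sector of \<open>x\<close> has measure about \<open>q\<^bsup>-|x|\<^esup>\<close> and the jump has modulus about \<open>q\<^bsup>|x|/p\<^esup>\<close>.\<close>

lemma density_le:
  "cmod (eigen_mass \<alpha> g x / of_real (nu x)) \<le>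
    4 * (real q powr (1 - 1 / p)) ^ len x * (cmod (g x) + cmod (g (par x)))"
proof -
  let ?a = "base \<alpha>" and ?n = "len x"
  have an: "0 < cmod ?a ^ ?n" using base_nz by simp
  have m: "cmod (eigen_mass \<alpha> g x) \<le> 2 / cmod ?a ^ ?n * (cmod (g x) + cmod (g (par x)))"
  proof (cases "x = b")
    case True
    then show ?thesis by (simp add: eigen_mass_def)
  next
    case False
    have "cmod (g x - g (par x) / ?a) \<le> cmod (g x) + cmod (g (par x)) / cmod ?a"
      using norm_triangle_ineq4[of "g x" "g (par x) / ?a"] by (simp add: norm_divide)
    also have "\<dots> \<le> cmod (g x) + cmod (g (par x))"
      using norm_base_ge(2)[of \<alpha>] by (simp add: divide_le_eq mult_left_le mult_le_cancel_left1)
    finally have n: "cmod (g x - g (par x) / ?a) \<le> cmod (g x) + cmod (g (par x))" .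
    have "cmod (eigen_mass \<alpha> g x) = cmod (g x - g (par x) / ?a) / cmod (jump ?a ?n)"
      using False by (simp add: eigen_mass_def norm_divide)
    also have "\<dots> \<le> (cmod (g x) + cmod (g (par x))) / (cmod ?a ^ ?n / 2)"
      using n norm_jump_ge[of \<alpha> ?n] an by (intro frac_le) auto
    finally show ?thesis by (simp add: mult.commute)
  qed
  have nu: "1 / nu x \<le> 2 * real q ^ ?n" using nu_bounds(2)[of x] nu_pos[of x] by (simp add: divide_le_eq)
  have "cmod (eigen_mass \<alpha> g x / of_real (nu x)) = cmod (eigen_mass \<alpha> g x) * (1 / nu x)"
    using nu_pos[of x] by (simp add: norm_divide)
  also have "\<dots> \<le> 2 / cmod ?a ^ ?n * (cmod (g x) + cmod (g (par x))) * (2 * real q ^ ?n)"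
    using m nu nu_pos[of x] an by (intro mult_mono) auto
  also have "\<dots> = 4 * (real q ^ ?n / cmod ?a ^ ?n) * (cmod (g x) + cmod (g (par x)))" by simp
  also have "real q ^ ?n / cmod ?a ^ ?n = (real q powr (1 - 1 / p)) ^ ?n"
    using q_ge_2 by (simp add: norm_base powr_diff power_divide)
  finally show ?thesis .
qed

text \<open>Both sides satisfy the same recursion from a vertex to its children and agree at the root.\<close>

lemma poisson_representation:
  assumes g: "L g = (\<lambda>x. gamma_sym q (spec_param p \<alpha>) * g x)"
    and F: "integrable \<nu> F" "\<And>x. (LINT \<omega>|\<nu>. indicator (sec x) \<omega> * F \<omega>) = eigen_mass \<alpha> g x"
  shows "g = poisson_transform q E b \<nu> (spec_param p \<alpha>) F"
proof
  fix x
  define \<beta> where "\<beta> = 1 / 2 + \<i> * spec_param p \<alpha>"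
  have a: "of_nat q powr \<beta> = base \<alpha>" by (simp add: \<beta>_def base_def)
  have iS: "integrable \<nu> (\<lambda>\<omega>. indicator (sec x) \<omega> * F \<omega>)" for x
  proof -
    have "integrable \<nu> (\<lambda>\<omega>. indicator (sec x) \<omega> *\<^sub>R F \<omega>)" using F(1) by (intro integrable_mult_indicator) auto
    moreover have "(\<lambda>\<omega>. indicator (sec x) \<omega> *\<^sub>R F \<omega>) = (\<lambda>\<omega>. indicator (sec x) \<omega> * F \<omega>)"
      by (auto simp: indicator_def fun_eq_iff)
    ultimately show ?thesis by simp
  qed
  have step: "ker \<beta> x \<omega> * F \<omega> = inverse (base \<alpha>) * (ker \<beta> (par x) \<omega> * F \<omega>) +
      jump (base \<alpha>) (len x) * (indicator (sec x) \<omega> * F \<omega>)" if "x \<noteq> b" "\<omega> \<in> space \<nu>" for x \<omega>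
    using ker_recursion[of \<omega> x \<beta>] that unfolding a space_\<nu> by (simp add: distrib_right indicator_def)
  have "integrable \<nu> (\<lambda>\<omega>. ker \<beta> x \<omega> * F \<omega>) \<and> (LINT \<omega>|\<nu>. ker \<beta> x \<omega> * F \<omega>) = g x"
  proof (induction "len x" arbitrary: x)
    case 0
    then have x: "x = b" using d_eq_0 by metis
    have eq: "ker \<beta> x \<omega> * F \<omega> = indicator (sec b) \<omega> * F \<omega>" if "\<omega> \<in> space \<nu>" for \<omega>
      using that x by (simp add: space_\<nu> ker_root sec_root)
    have "integrable \<nu> (\<lambda>\<omega>. ker \<beta> x \<omega> * F \<omega>)"
      using iS[of b] by (rule Bochner_Integration.integrable_cong[THEN iffD1, rotated -1]) (auto simp: eq)
    moreover have "(LINT \<omega>|\<nu>. ker \<beta> x \<omega> * F \<omega>) = (LINT \<omega>|\<nu>. indicator (sec b) \<omega> * F \<omega>)"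
      by (rule Bochner_Integration.integral_cong) (auto simp: eq)
    ultimately show ?case using F(2)[of b] by (simp add: x eigen_mass_def)
  next
    case (Suc n)
    then have x: "x \<noteq> b" by auto
    have IH: "integrable \<nu> (\<lambda>\<omega>. ker \<beta> (par x) \<omega> * F \<omega>)" "(LINT \<omega>|\<nu>. ker \<beta> (par x) \<omega> * F \<omega>) = g (par x)"
      using Suc.hyps(1)[of "par x"] Suc.hyps(2) d_parent[OF x] by auto
    let ?R = "\<lambda>\<omega>. inverse (base \<alpha>) * (ker \<beta> (par x) \<omega> * F \<omega>) + jump (base \<alpha>) (len x) * (indicator (sec x) \<omega> * F \<omega>)"
    have "integrable \<nu> ?R"
      by (intro Bochner_Integration.integrable_add integrable_mult_right IH(1) iS)
    then have "integrable \<nu> (\<lambda>\<omega>. ker \<beta> x \<omega> * F \<omega>)"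
      by (rule Bochner_Integration.integrable_cong[THEN iffD1, rotated -1]) (auto simp: step[OF x])
    moreover have "(LINT \<omega>|\<nu>. ker \<beta> x \<omega> * F \<omega>) = integral\<^sup>L \<nu> ?R"
      by (rule Bochner_Integration.integral_cong) (auto simp: step[OF x])
    moreover have "integral\<^sup>L \<nu> ?R = inverse (base \<alpha>) * g (par x) + jump (base \<alpha>) (len x) * eigen_mass \<alpha> g x"
      unfolding IH(2)[symmetric] F(2)[symmetric]
      by (subst Bochner_Integration.integral_add[OF integrable_mult_right[OF IH(1)] integrable_mult_right[OF iS]]) simp
    ultimately show ?case using eigenfunction_recursion[OF x, of g \<alpha>] by simp
  qed
  then show "g x = poisson_transform q E b \<nu> (spec_param p \<alpha>) F x"
    by (simp add: poisson_transform_def ker_def \<beta>_def)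
qed

text \<open>The \<open>s\<close>-th powers of the decreasing rearrangement are bounded by \<open>M\<^sup>s / k\<close>. So the sum over a
  ball grows only like the logarithm of its cardinality, that is, linearly in the radius.\<close>

lemma sum_ball_le:
  assumes f: "weak_bound (ereal s) M g" and s: "0 < s" and M: "0 \<le> M"
  shows "(\<Sum>n\<le>K. \<Sum>x\<in>tsphere b n. cmod (g x) powr s) \<le> M powr s * (1 + (real K + 2) * ln q)"
proof -
  let ?X = "\<Union>n\<le>K. tsphere b n"
  have fin: "finite ?X" by simp
  have "(\<Sum>n\<le>K. \<Sum>x\<in>tsphere b n. cmod (g x) powr s) = (\<Sum>x\<in>?X. cmod (g x) powr s)"
    by (rule sum.UNION_disjoint[symmetric]) (simp, simp, auto simp: tsphere_def)
  also have "\<dots> \<le> (\<Sum>k=1..card ?X. (M * real k powr (- 1 / s)) powr s)"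
    using f s M fin by (intro sum_powr_weak_bound) auto
  also have "\<dots> = M powr s * (\<Sum>k=1..card ?X. 1 / real k)"
    unfolding sum_distrib_left
    by (intro sum.cong refl) (use s M in \<open>auto simp: powr_mult powr_powr powr_minus_divide powr_divide\<close>)
  also have "\<dots> \<le> M powr s * (1 + (real K + 2) * ln q)"
  proof (rule mult_left_mono)
    have "b \<in> ?X" by (auto simp: tsphere_def)
    then have c1: "1 \<le> card ?X" using fin by (metis One_nat_def Suc_leI card_gt_0_iff empty_iff)
    have "real (card ?X) \<le> (\<Sum>n\<le>K. real (card (tsphere b n)))"
      using card_UN_le[of "{..K}" "tsphere b"] by (simp flip: of_nat_sum)
    also have "\<dots> \<le> (\<Sum>n\<le>K. 2 * real q ^ n)" by (intro sum_mono card_sphere_le)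
    also have "\<dots> \<le> real q ^ (K + 2)"
    proof -
      have "(\<Sum>n\<le>K. real q ^ n) \<le> real q ^ (K + 1)"
      proof (induction K)
        case (Suc K)
        have "(\<Sum>n\<le>Suc K. real q ^ n) \<le> 2 * real q ^ (K + 1)" using Suc by simp
        also have "\<dots> \<le> real q * real q ^ (K + 1)" using q_ge_2 by (intro mult_right_mono) auto
        finally show ?case by simp
      qed (use q_ge_2 in simp)
      then have "2 * (\<Sum>n\<le>K. real q ^ n) \<le> real q * real q ^ (K + 1)"
        using q_ge_2 by (intro mult_mono) (auto intro: sum_nonneg)
      then show ?thesis by (simp add: sum_distrib_left)
    qed
    finally have "ln (real (card ?X)) \<le> ln (real q ^ (K + 2))" using c1 by (subst ln_le_cancel_iff) (use q_ge_2 in auto)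
    also have "\<dots> = (real K + 2) * ln q" using q_ge_2 by (subst ln_realpow) auto
    finally show "(\<Sum>k=1..card ?X. 1 / real k) \<le> 1 + (real K + 2) * ln q" using sum_inverse_le[OF c1] by simp
  qed simp
  finally show ?thesis .
qed

text \<open>For \<open>p = 1\<close> the densities of \<open>eigen_mass\<close> are bounded outright. For \<open>p > 1\<close> let \<open>e n\<close> be the integral of the \<open>p'\<close>-th
  power of their moduli on level \<open>n\<close>. By \<open>density_le\<close> it is controlled by the sums of \<open>|g|\<^bsup>p'\<^esup>\<close> over
  two neighbouring spheres, which by themselves are only bounded by a multiple of \<open>n\<close>. But \<open>e\<close>
  is increasing by Jensen's inequality, so \<open>e n\<close> is at most an average of later values, and
  averages are bounded by \<open>sum_ball_le\<close>.\<close>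

lemma eigenfunction_poisson:
  assumes g: "L g = (\<lambda>x. gamma_sym q (spec_param p \<alpha>) * g x)" and weak: "g \<in> weak_L r"
  shows "\<exists>F\<in>boundary_L \<nu> r. g = poisson_transform q E b \<nu> (spec_param p \<alpha>) F"
proof -
  interpret martingale q E b \<nu> "eigen_mass \<alpha> g"
    by unfold_locales (rule eigen_mass_children[OF g])
  obtain M where M: "0 \<le> M" "weak_bound r M g" using weak by (auto simp: weak_L_iff)
  have dens: "cmod (dens x) \<le> 4 * (real q powr (1 - 1 / p)) ^ len x * (cmod (g x) + cmod (g (par x)))" for x
    unfolding dens_def by (rule density_le)
  show ?thesis
  proof (cases "p = 1")
    case True
    then have r: "r = \<infinity>" and gM: "cmod (g x) \<le> M" for x
      using M(2) by (auto simp: conj_exponent_def weak_bound_def)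
    have d: "cmod (dens x) \<le> 8 * M" for x
      using dens[of x] gM[of x] gM[of "par x"] q_ge_2 by (simp add: True)
    have V: "energy n \<le> (8 * M)^2" for n
    proof -
      have "energy n \<le> (LINT \<omega>|\<nu>. (8 * M)^2)"
        unfolding energy_def
        by (intro integral_mono integrable_level[of "\<lambda>x. cmod (dens x) ^ 2"] power_mono[OF d norm_ge_zero]) simp
      then show ?thesis by (simp add: prob_space)
    qed
    obtain F where F: "F \<in> borel_measurable \<nu>" "integrable \<nu> F"
      "\<And>x. (LINT \<omega>|\<nu>. indicator (sec x) \<omega> * F \<omega>) = eigen_mass \<alpha> g x"
      "\<And>C. (\<And>x. cmod (dens x) \<le> C) \<Longrightarrow> AE \<omega> in \<nu>. cmod (F \<omega>) \<le> C"
      by (rule limit_exists[of "(8 * M)^2", OF V]) blast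
    have "F \<in> boundary_L \<nu> r" using F(1) F(4)[OF d] r by (auto simp: boundary_L_def)
    then show ?thesis using poisson_representation[OF g F(2,3)] by blast
  next
    case False
    then have p1: "1 < p" using p by simp
    define s where "s = p / (p - 1)"
    have r: "r = ereal s" and s1: "1 / s = 1 - 1 / p" and s0: "0 < s" and s2: "2 \<le> s"
      using conj_exponent_finite[OF p1] p p1 by (auto simp: s_def field_simps)
    have wb: "weak_bound (ereal s) M g" using M(2) r by simp
    define G where "G n = (\<Sum>x\<in>tsphere b n. cmod (g x) powr s)" for n
    define e where "e n = (LINT \<omega>|\<nu>. cmod (Fm n \<omega>) powr s)" for n
    have e_sum: "e n = (\<Sum>x\<in>tsphere b n. nu x * cmod (dens x) powr s)" for n
      unfolding e_def using integral_level[of "\<lambda>x. cmod (dens x) powr s" n] by simp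
    have G0: "0 \<le> G n" for n unfolding G_def by (intro sum_nonneg) auto
    define c where "c = 8 powr s * (real q + 2)"
    have c0: "0 \<le> c" by (simp add: c_def)
    have dens_powr: "nu x * cmod (dens x) powr s \<le> 8 powr s * (cmod (g x) powr s + cmod (g (par x)) powr s)" for x
    proof -
      let ?m = "max (cmod (g x)) (cmod (g (par x)))"
      have "cmod (dens x) \<le> 8 * (real q powr (1 - 1 / p)) ^ len x * ?m"
      proof -
        have "4 * (real q powr (1 - 1 / p)) ^ len x * (cmod (g x) + cmod (g (par x))) \<le>
            4 * (real q powr (1 - 1 / p)) ^ len x * (2 * ?m)" by (intro mult_left_mono) auto
        from order_trans[OF dens[of x] this] show ?thesis by simp
      qed
      then have "cmod (dens x) powr s \<le> (8 * (real q powr (1 - 1 / p)) ^ len x * ?m) powr s"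
        using s0 by (intro powr_mono2) auto
      also have "\<dots> = 8 powr s * ((real q powr (1 - 1 / p)) ^ len x) powr s * ?m powr s"
        by (simp add: powr_mult)
      also have "((real q powr (1 - 1 / p)) ^ len x) powr s = real q ^ len x"
      proof -
        have "(real q powr (1 / s)) ^ len x = real q powr (real (len x) / s)"
          using q_ge_2 by (simp add: powr_powr flip: powr_realpow)
        then show ?thesis unfolding s1[symmetric] using s0 q_ge_2 by (simp add: powr_powr powr_realpow)
      qed
      finally have "nu x * cmod (dens x) powr s \<le> nu x * (8 powr s * real q ^ len x * ?m powr s)"
        using nu_pos[of x] by (intro mult_left_mono) auto
      also have "\<dots> = (nu x * real q ^ len x) * (8 powr s * ?m powr s)" by simp
      also have "\<dots> \<le> 1 * (8 powr s * ?m powr s)" using nu_bounds(1)[of x] by (intro mult_right_mono) auto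
      also have "\<dots> \<le> 8 powr s * (cmod (g x) powr s + cmod (g (par x)) powr s)"
        by (simp add: max_def)
      finally show ?thesis .
    qed
    have e_le: "e (Suc n) \<le> 8 powr s * (G (Suc n) + (real q + 1) * G n)" for n
    proof -
      have "e (Suc n) \<le> (\<Sum>x\<in>tsphere b (Suc n). 8 powr s * (cmod (g x) powr s + cmod (g (par x)) powr s))"
        unfolding e_sum by (intro sum_mono dens_powr)
      also have "\<dots> = 8 powr s * (G (Suc n) + (\<Sum>x\<in>tsphere b (Suc n). cmod (g (par x)) powr s))"
        by (simp add: G_def sum.distrib sum_distrib_left distrib_left)
      also have "(\<Sum>x\<in>tsphere b (Suc n). cmod (g (par x)) powr s) \<le> (real q + 1) * G n"
      proof -
        have "(\<Sum>x\<in>tsphere b (Suc n). cmod (g (par x)) powr s) =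
            (\<Sum>x\<in>tsphere b n. \<Sum>y\<in>children b x. cmod (g (par y)) powr s)" by (rule sum_sphere_Suc)
        also have "\<dots> = (\<Sum>x\<in>tsphere b n. real (card (children b x)) * cmod (g x) powr s)"
          by (intro sum.cong refl) (simp add: parent_child)
        also have "\<dots> \<le> (\<Sum>x\<in>tsphere b n. (real q + 1) * cmod (g x) powr s)"
          by (intro sum_mono mult_right_mono) (auto simp: card_children)
        finally show ?thesis by (simp add: G_def sum_distrib_left)
      qed
      finally show ?thesis by simp
    qed
    have "incseq e"
    proof (rule incseq_SucI)
      fix n
      show "e n \<le> e (Suc n)"
        unfolding e_sum sum_sphere_Suc
      proof (rule sum_mono)
        fix x
        let ?w = "\<lambda>y. nu y / nu x"
        have nx: "0 < nu x" by (rule nu_pos)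
        have "dens x = (\<Sum>y\<in>children b x. ?w y *\<^sub>R dens y)"
        proof -
          have "(\<Sum>y\<in>children b x. ?w y *\<^sub>R dens y) = (\<Sum>y\<in>children b x. eigen_mass \<alpha> g y / of_real (nu x))"
          proof (rule sum.cong[OF refl])
            fix y
            have "?w y *\<^sub>R dens y = (nu y *\<^sub>R dens y) /\<^sub>R nu x" by (simp add: divide_inverse mult.commute)
            then show "?w y *\<^sub>R dens y = eigen_mass \<alpha> g y / of_real (nu x)"
              unfolding nu_dens by (simp add: scaleR_conv_of_real divide_inverse mult.commute)
          qed
          also have "\<dots> = dens x" by (simp add: mass_children dens_def flip: sum_divide_distrib)
          finally show ?thesis by simp
        qed
        then have "cmod (dens x) \<le> (\<Sum>y\<in>children b x. ?w y * cmod (dens y))"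
          using norm_sum[of "\<lambda>y. ?w y *\<^sub>R dens y" "children b x"] nx nu_pos by (simp add: less_imp_le)
        then have "cmod (dens x) powr s \<le> (\<Sum>y\<in>children b x. ?w y * cmod (dens y)) powr s"
          using s0 by (intro powr_mono2) auto
        also have "\<dots> \<le> (\<Sum>y\<in>children b x. ?w y * cmod (dens y) powr s)"
        proof (rule weighted_mean_powr_le)
          show "(\<Sum>y\<in>children b x. ?w y) = 1"
            using sum_nu_children[of x] nx by (simp flip: sum_divide_distrib)
          show "0 < ?w y" for y using nu_pos[of y] nx by simp
        qed (use s2 in auto)
        also have "\<dots> = (\<Sum>y\<in>children b x. nu y * cmod (dens y) powr s) / nu x"
          by (simp add: sum_divide_distrib)
        finally show "nu x * cmod (dens x) powr s \<le> (\<Sum>y\<in>children b x. nu y * cmod (dens y) powr s)"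
          using nx by (simp add: le_divide_eq mult.commute)
      qed
    qed
    then have mono: "e m \<le> e n" if "m \<le> n" for m n using that by (simp add: incseq_def)
    define T where "T = M powr s * (1 + 5 * ln q)"
    have lnq: "0 \<le> ln (real q)" using q_ge_2 by simp
    have bound: "e n \<le> c * T" for n
    proof -
      define N where "N = max n 1"
      have N: "n \<le> N" "1 \<le> N" by (auto simp: N_def)
      \<comment> \<open>By monotonicity \<open>e n\<close> is at most the mean of \<open>e\<close> over the levels \<open>N + 1, ..., 2 N\<close>.\<close>
      have "real N * e n = (\<Sum>i=N..<2*N. e n)" by simp
      also have "\<dots> \<le> (\<Sum>i=N..<2*N. e (Suc i))" using N by (intro sum_mono mono) auto
      also have "\<dots> \<le> (\<Sum>i<2*N. e (Suc i))"
        by (intro sum_mono2) (auto simp: e_sum intro!: sum_nonneg mult_nonneg_nonneg)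
      also have "\<dots> \<le> (\<Sum>i<2*N. 8 powr s * (G (Suc i) + (real q + 1) * G i))" by (intro sum_mono e_le)
      also have "\<dots> = 8 powr s * ((\<Sum>i<2*N. G (Suc i)) + (real q + 1) * (\<Sum>i<2*N. G i))"
        by (simp add: sum_distrib_left sum.distrib distrib_left)
      also have "\<dots> \<le> 8 powr s * ((\<Sum>i\<le>2*N. G i) + (real q + 1) * (\<Sum>i\<le>2*N. G i))"
      proof (intro mult_left_mono add_mono)
        have "(\<Sum>i\<le>2*N. G i) = G 0 + (\<Sum>i<2*N. G (Suc i))" by (rule sum.atMost_shift)
        then show "(\<Sum>i<2*N. G (Suc i)) \<le> (\<Sum>i\<le>2*N. G i)" using G0[of 0] by simp
        show "(\<Sum>i<2*N. G i) \<le> (\<Sum>i\<le>2*N. G i)" using G0 by (intro sum_mono2) auto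
      qed auto
      also have "\<dots> = c * (\<Sum>i\<le>2*N. G i)" by (simp add: c_def algebra_simps)
      also have "\<dots> \<le> c * (M powr s * (1 + (real (2 * N) + 2) * ln q))"
        unfolding G_def using c0 by (intro mult_left_mono sum_ball_le[OF wb s0 M(1)])
      also have "\<dots> \<le> c * (real N * T)"
      proof (rule mult_left_mono[OF _ c0])
        have "1 + (real (2 * N) + 2) * ln q \<le> real N * (1 + 5 * ln q)"
        proof -
          have "(real (2 * N) + 2) * ln q \<le> (5 * real N) * ln q" using N lnq by (intro mult_right_mono) auto
          moreover have "1 \<le> real N" using N by simp
          ultimately show ?thesis by (simp add: algebra_simps)
        qed
        then have "M powr s * (1 + (real (2 * N) + 2) * ln q) \<le> M powr s * (real N * (1 + 5 * ln q))"
          by (rule mult_left_mono) simp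
        then show "M powr s * (1 + (real (2 * N) + 2) * ln q) \<le> real N * T" by (simp add: T_def mult_ac)
      qed
      finally have "real N * e n \<le> real N * (c * T)" by (simp add: mult_ac)
      then show ?thesis using N by simp
    qed
    have V: "energy n \<le> 1 + c * T" for n
    proof -
      have "energy n \<le> (LINT \<omega>|\<nu>. 1 + cmod (Fm n \<omega>) powr s)"
        unfolding energy_def
      proof (rule integral_mono)
        fix \<omega>
        show "cmod (Fm n \<omega>) ^ 2 \<le> 1 + cmod (Fm n \<omega>) powr s"
        proof (cases "cmod (Fm n \<omega>) \<le> 1")
          case True
          then have "cmod (Fm n \<omega>) ^ 2 \<le> 1" by (simp add: power_le_one)
          then show ?thesis by (simp add: add_increasing2)
        next
          case False
          then have "cmod (Fm n \<omega>) ^ 2 = cmod (Fm n \<omega>) powr 2" by (simp add: powr_numeral)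
          also have "\<dots> \<le> cmod (Fm n \<omega>) powr s" using False s2 by (intro powr_mono) auto
          finally show ?thesis by simp
        qed
      qed (rule integrable_level[of "\<lambda>x. cmod (dens x) ^ 2"], rule integrable_level[of "\<lambda>x. 1 + cmod (dens x) powr s"])
      also have "\<dots> = 1 + e n"
        unfolding e_def using integrable_level[of "\<lambda>x. cmod (dens x) powr s" n] by (simp add: prob_space)
      finally show ?thesis using bound[of n] by simp
    qed
    obtain F where F: "F \<in> borel_measurable \<nu>" "integrable \<nu> F"
      "\<And>x. (LINT \<omega>|\<nu>. indicator (sec x) \<omega> * F \<omega>) = eigen_mass \<alpha> g x"
      "\<And>\<theta> C. continuous_on UNIV \<theta> \<Longrightarrow> (\<And>t. 0 \<le> \<theta> t) \<Longrightarrow>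
        (\<And>n. (LINT \<omega>|\<nu>. \<theta> (cmod (Fm n \<omega>))) \<le> C) \<Longrightarrow> integrable \<nu> (\<lambda>\<omega>. \<theta> (cmod (F \<omega>)) :: real)"
      by (rule limit_exists[of "1 + c * T", OF V]) blast
    have "integrable \<nu> (\<lambda>\<omega>. \<bar>cmod (F \<omega>)\<bar> powr s)"
    proof (rule F(4))
      show "continuous_on UNIV (\<lambda>t::real. \<bar>t\<bar> powr s)" using s0 by (intro continuous_on_powr' continuous_intros) auto
      show "(LINT \<omega>|\<nu>. \<bar>cmod (Fm n \<omega>)\<bar> powr s) \<le> c * T" for n using bound[of n] by (simp add: e_def)
    qed simp
    then have "F \<in> boundary_L \<nu> r" using F(1) r by (simp add: boundary_L_def)
    then show ?thesis using poisson_representation[OF g F(2,3)] by blast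
  qed
qed

end

section \<open>Spectral parameters and the multiplier symbol\<close>

text \<open>The difference \<open>\<Sum> Q i - 1\<close> has degree less than \<open>card S\<close> and vanishes at all \<open>l j\<close>.\<close>

lemma lagrange_partition_of_unity:
  fixes l :: "'i \<Rightarrow> complex"
  assumes S: "finite S" "S \<noteq> {}" and inj: "inj_on l S"
  defines "Q \<equiv> \<lambda>i. smult (inverse (\<Prod>j\<in>S - {i}. l i - l j)) (\<Prod>j\<in>S - {i}. [:- l j, 1:])"
  shows "(\<Sum>i\<in>S. Q i) = 1"
    and "\<And>i j. i \<in> S \<Longrightarrow> j \<in> S \<Longrightarrow> poly (Q i) (l j) = (if i = j then 1 else 0)"
    and "\<And>i. i \<in> S \<Longrightarrow> \<exists>c. [:- l i, 1:] * Q i = smult c (\<Prod>j\<in>S. [:- l j, 1:])"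
proof -
  show val: "poly (Q i) (l j) = (if i = j then 1 else 0)" if "i \<in> S" "j \<in> S" for i j
  proof (cases "i = j")
    case True
    have "(\<Prod>k\<in>S - {i}. l i - l k) \<noteq> 0"
      using S inj that by (auto simp: inj_on_def)
    then show ?thesis using True by (simp add: Q_def poly_prod)
  next
    case False
    have "(\<Prod>k\<in>S - {i}. l j - l k) = 0"
      using S that False by (intro prod_zero) (auto intro: bexI[of _ j])
    then show ?thesis using False by (simp add: Q_def poly_prod)
  qed
  show "\<exists>c. [:- l i, 1:] * Q i = smult c (\<Prod>j\<in>S. [:- l j, 1:])" if "i \<in> S" for i
    unfolding Q_def using prod.remove[OF S(1) that, of "\<lambda>j. [:- l j, 1:]"]
    by (intro exI[of _ "inverse (\<Prod>j\<in>S - {i}. l i - l j)"]) (simp only: mult_smult_right)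
  let ?D = "(\<Sum>i\<in>S. Q i) - 1"
  have "degree (Q i) \<le> card S - 1" if "i \<in> S" for i
  proof -
    have "degree (\<Prod>j\<in>S - {i}. [:- l j, 1:]) \<le> (\<Sum>j\<in>S - {i}. degree [:- l j, 1:])"
      using degree_prod_sum_le[of "S - {i}" "\<lambda>j. [:- l j, 1:]"] S by (simp add: o_def)
    also have "\<dots> = card S - 1" using S that by simp
    finally show ?thesis unfolding Q_def using degree_smult_le order_trans by blast
  qed
  then have "degree (\<Sum>i\<in>S. Q i) \<le> card S - 1" by (intro degree_sum_le S) auto
  then have deg: "degree ?D \<le> card S - 1" by (intro degree_diff_le) auto
  have roots: "l ` S \<subseteq> {x. poly ?D x = 0}"
    using S by (auto simp: poly_sum val)
  show "(\<Sum>i\<in>S. Q i) = 1"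
  proof (rule ccontr)
    assume "(\<Sum>i\<in>S. Q i) \<noteq> 1"
    then have D: "?D \<noteq> 0" by simp
    have "card S = card (l ` S)" using inj by (simp add: card_image)
    also have "\<dots> \<le> card {x. poly ?D x = 0}" using roots poly_roots_finite[OF D] by (intro card_mono)
    also have "\<dots> \<le> degree ?D" by (rule card_poly_roots_bound[OF D])
    finally have "card S \<le> card S - 1" using deg by simp
    then show False using S by (metis card_gt_0_iff diff_less leD less_numeral_extra(1))
  qed
qed

context growth begin

text \<open>A power higher than the first contains a square, which \<open>no_generalized_eigenfunctions\<close> reduces.\<close>

lemma reduce_multiplicity:
  assumes f: "tempered f" and t: "norm t = R"
    and "poly_lap ([:- lap_value t, 1:] ^ n * Q) f = (\<lambda>x. 0)"
  shows "poly_lap ([:- lap_value t, 1:] * Q) f = (\<lambda>x. 0)"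
  using assms(3)
proof (induction n rule: induct_nat_012)
  case 0
  then have "poly_lap Q f = (\<lambda>x. 0)" by simp
  then show ?case unfolding poly_lap_mult by (auto simp: poly_lap_linear_factor L_eq ssum_def fun_eq_iff)
next
  case 1 then show ?case by simp
next
  case (ge2 n)
  let ?l = "[:- lap_value t, 1:]"
  let ?h = "poly_lap (?l ^ n * Q) f"
  have "?l ^ Suc (Suc n) * Q = ?l ^ 2 * (?l ^ n * Q)" by (simp only: power_Suc power2_eq_square mult_ac)
  then have "poly_lap (?l ^ 2) ?h = (\<lambda>x. 0)" using ge2.prems by (simp only: poly_lap_mult)
  then have "poly_lap ?l ?h = (\<lambda>x. 0)"
    by (intro no_generalized_eigenfunctions tempered_poly_lap f t)
  then have "poly_lap (?l ^ Suc n * Q) f = (\<lambda>x. 0)"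
    by (simp only: poly_lap_mult[symmetric] power_Suc mult.assoc)
  then show ?case by (rule ge2.IH(2))
qed

lemma reduce_all_multiplicities:
  assumes f: "tempered f" and S: "finite S" and t: "\<And>i. i \<in> S \<Longrightarrow> norm (t i) = R"
    and "poly_lap ((\<Prod>i\<in>S. [:- lap_value (t i), 1:]) ^ N * Q) f = (\<lambda>x. 0)"
  shows "poly_lap ((\<Prod>i\<in>S. [:- lap_value (t i), 1:]) * Q) f = (\<lambda>x. 0)"
  using S t assms(4)
proof (induction S arbitrary: Q)
  case (insert i S)
  let ?l = "[:- lap_value (t i), 1:]" and ?P = "\<Prod>i\<in>S. [:- lap_value (t i), 1:]"
  have "(\<Prod>i\<in>insert i S. [:- lap_value (t i), 1:]) = ?l * ?P"
    using insert.hyps by (rule prod.insert)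
  note P = this
  have "poly_lap (?l ^ N * (?P ^ N * Q)) f = (\<lambda>x. 0)"
    using insert.prems(2) unfolding P by (simp only: power_mult_distrib mult.assoc)
  then have "poly_lap (?l * (?P ^ N * Q)) f = (\<lambda>x. 0)"
    using insert.prems(1) by (intro reduce_multiplicity[OF f]) auto
  then have "poly_lap (?P ^ N * (?l * Q)) f = (\<lambda>x. 0)" by (simp only: mult.left_commute)
  then have "poly_lap (?P * (?l * Q)) f = (\<lambda>x. 0)" using insert by simp
  then show ?case unfolding P by (simp only: mult_ac)
qed simp

text \<open>The decay of the kernel makes the sum over the tree absolutely convergent, so it may be taken over spheres.\<close>

lemma conv_eq_radial_conv:
  assumes s: "0 < s" "s < R" and K: "\<And>n. norm (\<kappa> n) \<le> C * (s / sqrt q) ^ n" and f: "tempered f"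
  shows "radial_conv E f \<kappa> = conv \<kappa> f"
proof
  fix x
  have "summable (\<lambda>n. norm (\<kappa> n * complex_of_real (ssum n (\<lambda>y. norm (f y)) x)))"
  proof -
    have "tempered (\<lambda>y. complex_of_real (norm (f y)))"
      using f by (simp add: tempered_def sphere_bound_def)
    from summable_kernel_ssum[OF s K this, of x]
    show ?thesis by (simp add: ssum_def)
  qed
  moreover have "norm (\<kappa> n * complex_of_real (ssum n (\<lambda>y. norm (f y)) x)) =
      (\<Sum>y\<in>tsphere x n. norm (f y * \<kappa> (d x y)))" for n
  proof -
    have "(\<Sum>y\<in>tsphere x n. norm (f y * \<kappa> (d x y))) = (\<Sum>y\<in>tsphere x n. norm (\<kappa> n) * norm (f y))"
      by (intro sum.cong) (auto simp: tsphere_def norm_mult)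
    moreover have "\<bar>ssum n (\<lambda>y. norm (f y)) x\<bar> = ssum n (\<lambda>y. norm (f y)) x"
      by (intro abs_of_nonneg ssum_nonneg) simp
    ultimately show ?thesis by (simp add: norm_mult ssum_def sum_distrib_left del: of_real_sum)
  qed
  ultimately have "summable (\<lambda>n. \<Sum>y\<in>tsphere x n. norm (f y * \<kappa> (d x y)))" by simp
  then have "radial_conv E f \<kappa> x = (\<Sum>n. \<Sum>y\<in>tsphere x n. f y * \<kappa> (d x y))"
    unfolding radial_conv_def by (rule infsum_over_spheres)
  also have "(\<lambda>n. \<Sum>y\<in>tsphere x n. f y * \<kappa> (d x y)) = (\<lambda>n. \<kappa> n * ssum n f x)"
    unfolding ssum_def sum_distrib_left by (intro ext sum.cong) (auto simp: tsphere_def)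
  finally show "radial_conv E f \<kappa> x = conv \<kappa> f x" by (simp add: conv_def)
qed

end

context tree_boundary begin

lemma gamma_eq_lap_value: "gamma_sym q z = lap_value (of_nat q powr (\<i> * z))"
proof -
  let ?w = "of_nat q powr (\<i> * z) :: complex"
  have w: "?w \<noteq> 0" using q_ge_2 by simp
  have "of_nat q powr (1 / 2 - \<i> * z) = of_real (sqrt q) * inverse ?w"
    using powr_half_add[of "- z"] by (simp add: powr_minus)
  then have "of_nat q powr (1 / 2 + \<i> * z) + of_nat q powr (1 / 2 - \<i> * z) = joukowski ?w"
    unfolding powr_half_add joukowski_def by (simp add: distrib_left)
  then show ?thesis by (simp add: gamma_sym_def lap_value_def)
qed

lemma lap_value_inverse: "lap_value (inverse t) = lap_value t"
  by (simp add: lap_value_def joukowski_inverse)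

text \<open>The point \<open>q\<^bsup>iz\<^esup>\<close> of the circle \<open>|t| = R\<close> that has the same spectral value as the parameter
  \<open>z = \<alpha> + i\<delta>\<^bsub>p'\<^esub>\<close>, for which \<open>q\<^bsup>iz\<^esup>\<close> itself has modulus \<open>1/R\<close>.\<close>

definition tpar :: "real \<Rightarrow> complex" where "tpar \<alpha> = of_real (sqrt q) / base \<alpha>"

lemma R_eq: "R = sqrt q / real q powr (1 / p)"
  by (simp add: powr_diff powr_half_sqrt)

lemma norm_tpar: "norm (tpar \<alpha>) = R"
  unfolding tpar_def norm_divide norm_of_real norm_base R_eq by simp

lemma lap_value_tpar: "lap_value (tpar \<alpha>) = gamma_sym q (spec_param p \<alpha>)"
proof -
  have sq: "of_real (sqrt q) * of_real (sqrt q) = (of_nat q :: complex)" by (simp flip: of_real_mult)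
  have "joukowski (tpar \<alpha>) = of_real (sqrt q) * of_real (sqrt q) / base \<alpha> + base \<alpha>"
    using base_nz[of \<alpha>] q_ge_2 by (simp add: joukowski_def tpar_def distrib_left)
  then show ?thesis unfolding gamma_base lap_value_def sq by (simp add: add.commute)
qed

lemma base_polar: "base \<alpha> = of_real (real q powr (1 / p)) * exp (\<i> * of_real (\<alpha> * ln q))"
proof -
  have "of_nat q powr (of_real (1 / p)) = complex_of_real (real q powr (1 / p))"
    using powr_of_real[of "real q" "1 / p"] by simp
  moreover have "of_nat q powr (\<i> * of_real \<alpha>) = exp (\<i> * of_real (\<alpha> * ln q))"
    using q_ge_2 Ln_of_real[of "real q"] by (simp add: powr_def mult_ac)
  ultimately show ?thesis unfolding base_def exponent_eq powr_add by simp
qed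

abbreviation "period \<equiv> {\<alpha>. - tau q / 2 < \<alpha> \<and> \<alpha> \<le> tau q / 2}"

lemma period_iff: "\<alpha> \<in> period \<longleftrightarrow> - pi < \<alpha> * ln q \<and> \<alpha> * ln q \<le> pi"
proof -
  have "0 < ln (real q)" using q_ge_2 by simp
  then show ?thesis by (simp add: tau_def field_simps)
qed

lemma tpar_inj: "inj_on tpar period"
proof (rule inj_onI)
  fix \<alpha> \<beta> assume ab: "\<alpha> \<in> period" "\<beta> \<in> period" "tpar \<alpha> = tpar \<beta>"
  have "base \<alpha> = base \<beta>" using ab(3) base_nz[of \<alpha>] base_nz[of \<beta>] q_ge_2 by (simp add: tpar_def)
  then have "exp (\<i> * of_real (\<alpha> * ln q)) = exp (\<i> * of_real (\<beta> * ln q))"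
    unfolding base_polar using q_ge_2 by simp
  moreover have "\<bar>\<alpha> * ln q - \<beta> * ln q\<bar> < 2 * pi"
    using ab(1,2) unfolding period_iff by linarith
  ultimately have "\<i> * complex_of_real (\<alpha> * ln q) = \<i> * of_real (\<beta> * ln q)"
    using exp_complex_eqI[of "\<i> * of_real (\<alpha> * ln q)" "\<i> * of_real (\<beta> * ln q)"]
    by (simp only: Im_i_times Re_complex_of_real)
  then have "Im (\<i> * complex_of_real (\<alpha> * ln q)) = Im (\<i> * of_real (\<beta> * ln q))" by (rule arg_cong)
  then have "\<alpha> * ln q = \<beta> * ln q" unfolding Im_i_times Re_complex_of_real .
  then show "\<alpha> = \<beta>" using q_ge_2 by simp
qed

lemma tpar_surj:
  assumes t: "norm t = R" shows "\<exists>\<alpha>\<in>period. t = tpar \<alpha>"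
proof -
  define \<alpha> where "\<alpha> = Arg (cnj t) / ln q"
  have lnq: "0 < ln (real q)" using q_ge_2 by simp
  have al: "\<alpha> * ln q = Arg (cnj t)" using lnq by (simp add: \<alpha>_def)
  have t0: "t \<noteq> 0" using t R_pos by auto
  have "cnj t = of_real R * exp (\<i> * of_real (\<alpha> * ln q))"
    unfolding al using Arg_eq[of "cnj t"] t0 t by simp
  then have "t = cnj (of_real R * exp (\<i> * of_real (\<alpha> * ln q)))" by (metis complex_cnj_cnj)
  also have "\<dots> = of_real R / exp (\<i> * of_real (\<alpha> * ln q))"
  proof -
    have "cnj (exp (\<i> * of_real (\<alpha> * ln q))) = inverse (exp (\<i> * of_real (\<alpha> * ln q)))"
      by (simp only: exp_cnj complex_cnj_mult complex_cnj_i complex_cnj_complex_of_real mult_minus_left exp_minus)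
    then show ?thesis by (simp only: complex_cnj_mult complex_cnj_complex_of_real divide_inverse)
  qed
  also have "\<dots> = tpar \<alpha>"
  proof -
    have "complex_of_real R = of_real (sqrt q) / of_real (real q powr (1 / p))" by (simp only: R_eq of_real_divide)
    then show ?thesis unfolding tpar_def base_polar by simp
  qed
  finally have "t = tpar \<alpha>" .
  moreover have "\<alpha> \<in> period" unfolding period_iff al using mpi_less_Arg Arg_le_pi by blast
  ultimately show ?thesis by blast
qed

text \<open>Equal values occur only at \<open>t\<close> and \<open>1/t\<close>, and the latter has modulus \<open>1/R \<noteq> R\<close>.\<close>

lemma lap_value_inj_on_circle:
  assumes "norm t = R" "norm u = R" "lap_value t = lap_value u" shows "t = u"
proof -
  have t0: "t \<noteq> 0" "u \<noteq> 0" using assms R_pos by auto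
  have n: "of_nat (q + 1) \<noteq> (0::complex)" unfolding of_nat_eq_0_iff by simp
  have "joukowski t = joukowski u"
    using assms(3) n unfolding lap_value_def by (simp del: of_nat_add of_nat_Suc)
  then have eq: "t + inverse t = u + inverse u" using q_ge_2 by (simp add: joukowski_def)
  then have "(t - u) * (t * u - 1) = 0" using t0 by (simp add: field_simps)
  moreover have "t * u \<noteq> 1"
  proof
    assume "t * u = 1"
    then have "R * R = 1" using assms by (metis norm_mult norm_one)
    moreover have "R * R < 1" using R_pos R_less_1 mult_strict_mono[of R 1 R 1] by simp
    ultimately show False by simp
  qed
  ultimately show ?thesis by simp
qed

lemma gamma_spec_inj: "inj_on (\<lambda>\<alpha>. gamma_sym q (spec_param p \<alpha>)) period"
  using tpar_inj lap_value_inj_on_circle[OF norm_tpar norm_tpar]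
  unfolding inj_on_def lap_value_tpar[symmetric] by blast

abbreviation "closed_annulus \<equiv> {t::complex. R \<le> norm t \<and> norm t \<le> 1 / R}"

lemma norm_q_powr: "norm (of_nat q powr (\<i> * z)) = exp (- Im z * ln q)"
proof -
  have "norm (of_nat q powr (\<i> * z)) = real q powr Re (\<i> * z)"
    using norm_powr_real_powr[of "of_nat q" "\<i> * z"] q_ge_2 by simp
  then show ?thesis using q_ge_2 by (simp add: powr_def)
qed

lemma strip_iff: "z \<in> strip p \<longleftrightarrow> of_nat q powr (\<i> * z) \<in> closed_annulus"
proof -
  have lnq: "0 < ln (real q)" using q_ge_2 by simp
  have dp: "\<bar>delta (ereal p)\<bar> = 1 / p - 1 / 2" using p by (simp add: delta_def field_simps)
  have R: "R = exp ((1 / 2 - 1 / p) * ln q)" using q_ge_2 by (simp add: powr_def)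
  have Ri: "1 / R = exp ((1 / p - 1 / 2) * ln q)"
  proof -
    have "(1 / p - 1 / 2) * ln q = - ((1 / 2 - 1 / p) * ln q)" by (simp add: algebra_simps)
    then show ?thesis unfolding R by (simp only: exp_minus inverse_eq_divide)
  qed
  have "R \<le> norm (of_nat q powr (\<i> * z) :: complex) \<longleftrightarrow> 1 / 2 - 1 / p \<le> - Im z"
    unfolding norm_q_powr R exp_le_cancel_iff mult_le_cancel_right using lnq by linarith
  moreover have "norm (of_nat q powr (\<i> * z) :: complex) \<le> 1 / R \<longleftrightarrow> - Im z \<le> 1 / p - 1 / 2"
    unfolding norm_q_powr Ri exp_le_cancel_iff mult_le_cancel_right using lnq by linarith
  ultimately show ?thesis unfolding strip_def dp by (auto simp: abs_le_iff)
qed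

lemma q_powr_surj:
  assumes "t \<noteq> 0" shows "\<exists>z. of_nat q powr (\<i> * z) = t"
proof
  have lnq: "ln (real q) \<noteq> 0" using q_ge_2 by simp
  have "Ln (of_nat q) = of_real (ln (real q))" using q_ge_2 Ln_of_real[of "real q"] by simp
  then show "of_nat q powr (\<i> * (- \<i> * Ln t / of_real (ln q))) = t"
    using q_ge_2 lnq assms by (simp add: powr_def)
qed

lemma gamma_strip: "gamma_sym q ` strip p = lap_value ` closed_annulus"
proof (intro subset_antisym subsetI)
  fix y assume "y \<in> gamma_sym q ` strip p"
  then show "y \<in> lap_value ` closed_annulus" using strip_iff gamma_eq_lap_value by auto
next
  fix y assume "y \<in> lap_value ` closed_annulus"
  then obtain t where t: "t \<in> closed_annulus" "y = lap_value t" by blast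
  then have "t \<noteq> 0" using R_pos by auto
  then obtain z where "of_nat q powr (\<i> * z) = t" using q_powr_surj by blast
  then show "y \<in> gamma_sym q ` strip p" using t strip_iff gamma_eq_lap_value by (intro image_eqI[of _ _ z]) auto
qed

lemma compact_closed_annulus: "compact closed_annulus"
proof -
  have "closed_annulus = cball 0 (1 / R) - ball 0 R" by auto
  moreover have "compact (cball (0::complex) (1 / R) - ball 0 R)" by (intro compact_diff) auto
  ultimately show ?thesis by simp
qed

lemma continuous_lap_value: "0 \<notin> A \<Longrightarrow> continuous_on A lap_value"
  by (auto simp: lap_value_def[abs_def] joukowski_def divide_inverse intro!: continuous_intros)

lemma holomorphic_lap_value: "0 \<notin> A \<Longrightarrow> lap_value holomorphic_on A"
  by (auto simp: lap_value_def[abs_def] joukowski_def divide_inverse intro!: holomorphic_intros)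

text \<open>By compactness the preimage of \<open>D\<close> contains a neighbourhood of the closed annulus, and the
  symmetry \<open>t \<mapsto> 1/t\<close> transfers it from the inner to the outer boundary.\<close>

lemma annulus_into_domain:
  assumes D: "open D" "lap_value ` closed_annulus \<subseteq> D"
  shows "\<exists>s. 0 < s \<and> s < R \<and> lap_value ` annulus s (1 / s) \<subseteq> D"
proof -
  let ?U = "(- {0}) \<inter> lap_value -` D"
  have "open ?U" by (rule continuous_open_preimage[OF continuous_lap_value _ D(1)]) auto
  moreover have "closed_annulus \<subseteq> ?U"
  proof
    fix t assume t: "t \<in> closed_annulus"
    then have "t \<noteq> 0" using R_pos by (auto simp del: powr_gt_zero)
    moreover have "lap_value t \<in> D" using D(2) t by (rule subsetD[OF _ imageI])
    ultimately show "t \<in> ?U" by (intro IntI ComplI vimageI2) simp_all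
  qed
  ultimately obtain e where e: "e > 0" "(\<Union>x\<in>closed_annulus. ball x e) \<subseteq> ?U"
    by (rule compact_subset_open_imp_ball_epsilon_subset[OF compact_closed_annulus])
  obtain s where s: "max 0 (R - e) < s" "s < R" using dense[of "max 0 (R - e)" R] e R_pos by auto
  have small: "lap_value t \<in> D" if t: "s < norm t" "norm t \<le> 1" for t
  proof (cases "R \<le> norm t")
    case True
    moreover have "1 < 1 / R" using one_less_inverse[OF R_pos R_less_1] by (simp only: inverse_eq_divide)
    then have "norm t \<le> 1 / R" using t by linarith
    ultimately have "t \<in> closed_annulus" by (intro CollectI conjI)
    then show ?thesis using D(2) by blast
  next
    case False
    define u where "u = of_real (R / norm t) * t"
    have t0: "0 < norm t" using s t by linarith
    then have nu: "norm u = R" using R_pos unfolding u_def norm_mult norm_of_real by simp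
    have "u - t = of_real (R / norm t - 1) * t" by (simp add: u_def algebra_simps)
    then have "norm (u - t) = \<bar>R / norm t - 1\<bar> * norm t" by (simp only: norm_mult norm_of_real)
    also have "\<dots> = R - norm t" using False t0 by (simp add: abs_of_nonneg field_simps)
    also have "\<dots> < e" using s t by linarith
    finally have "t \<in> ball u e" by (simp add: dist_norm)
    moreover have "R \<le> 1 / R" using R_pos R_less_1 mult_le_one[of R R] by (simp add: le_divide_eq)
    then have "u \<in> closed_annulus" using nu by simp
    ultimately show ?thesis using e(2) by blast
  qed
  have "lap_value t \<in> D" if t: "t \<in> annulus s (1 / s)" for t
  proof (cases "norm t \<le> 1")
    case True then show ?thesis using small t by (simp add: annulus_def)
  next
    case False
    have t0: "0 < norm t" using False by linarith
    have s0: "0 < s" using s by simp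
    have "norm t * s < 1" using t s0 by (simp add: annulus_def less_divide_eq)
    then have "s < 1 / norm t" using t0 by (simp add: less_divide_eq mult.commute)
    then have "s < norm (inverse t)" unfolding norm_inverse by (simp only: inverse_eq_divide)
    moreover have "norm (inverse t) \<le> 1" unfolding norm_inverse using False by (simp only: inverse_le_1_iff) simp
    ultimately show ?thesis using small[of "inverse t"] by (simp add: lap_value_inverse)
  qed
  then show ?thesis using s by (intro exI[of _ s]) auto
qed

text \<open>The bound \<open>|\<kappa> n| \<le> C q\<^bsup>-n/p\<^esup>\<close>, part of rapid decay, suffices to identify the symbol on the
  unit circle. The functional calculus needs a strictly better exponential rate, and the
  holomorphic extension of the symbol to a larger annulus provides it.\<close>

lemma multiplier_kernel_symbol:
  assumes D: "open D" "gamma_sym q ` strip p \<subseteq> D" and hol: "\<Psi> holomorphic_on D"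
    and mk: "multiplier_kernel q E b \<nu> p \<Psi> \<kappa>"
  shows "\<exists>s C. 0 < s \<and> s < R \<and> (\<forall>n. norm (\<kappa> n) \<le> C * (s / sqrt q) ^ n) \<and>
    (\<forall>t\<in>annulus s (1 / s). symbol \<kappa> t = \<Psi> (lap_value t))"
proof -
  obtain s where s: "0 < s" "s < R" "lap_value ` annulus s (1 / s) \<subseteq> D"
    using annulus_into_domain[OF D(1)] D(2) unfolding gamma_strip by blast
  define G where "G t = \<Psi> (lap_value t)" for t
  have holG: "G holomorphic_on annulus s (1 / s)"
    using holomorphic_on_compose_gen[OF holomorphic_lap_value hol s(3)] s(1)
    unfolding G_def[abs_def] o_def by (simp add: zero_notin_annulus)
  have sch: "(\<lambda>x. \<kappa> (d b x)) \<in> schwartz q E b p" using mk by (simp add: multiplier_kernel_def)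
  have "bdd_above (range (\<lambda>x. (1 + real (d b x)) ^ 0 * real q powr (real (d b x) / p) * cmod (\<kappa> (d b x))))"
    using sch[unfolded schwartz_def mem_Collect_eq, rule_format, of 0] .
  then obtain C0 where C0: "\<And>x. real q powr (real (d b x) / p) * cmod (\<kappa> (d b x)) \<le> C0"
    unfolding bdd_above_def by auto
  have kap: "norm (\<kappa> n) * ((real n + 1) * sqrt q ^ n) \<le> C0 * ((real n + 1) * (R / 1) ^ n)" for n
  proof -
    obtain x where "x \<in> tsphere b n" using sphere_nonempty by blast
    then have "real q powr (real n / p) * cmod (\<kappa> n) \<le> C0" using C0[of x] by (simp add: tsphere_def)
    moreover have "real q powr (real n / p) = (sqrt q / R) ^ n"
      unfolding root_ratio using q_ge_2 by (simp add: powr_powr mult.commute flip: powr_realpow)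
    ultimately have "(sqrt q / R) ^ n * cmod (\<kappa> n) \<le> C0" by simp
    then have "((sqrt q / R) ^ n * cmod (\<kappa> n)) * ((real n + 1) * R ^ n) \<le> C0 * ((real n + 1) * R ^ n)"
      using R_pos by (intro mult_right_mono) auto
    moreover have "((sqrt q / R) ^ n * cmod (\<kappa> n)) * ((real n + 1) * R ^ n) = norm (\<kappa> n) * ((real n + 1) * sqrt q ^ n)"
      using R_pos by (simp add: power_divide)
    ultimately show ?thesis by simp
  qed
  have K: "summable (\<lambda>n. norm (\<kappa> n) * ((real n + 1) * sqrt q ^ n))"
    using R_pos R_less_1 by (intro summable_norm_le[OF summable_poly_geometric[of R 1 C0]]) (use kap in auto)
  have G1: "G t = symbol \<kappa> t" if t: "norm t = 1" for t
  proof -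
    have "t \<noteq> 0" using t by auto
    then obtain z where z: "of_nat q powr (\<i> * z) = t" using q_powr_surj by blast
    have "exp (- Im z * ln q) = exp 0" using norm_q_powr[of z] z t by simp
    then have "Im z = 0" using q_ge_2 by simp
    moreover from this have "z \<in> strip p" by (simp add: strip_def)
    ultimately have "symbol \<kappa> t = \<Psi> (gamma_sym q z)"
      using spherical_transform_eq_symbol[OF _ K, of z] mk z unfolding multiplier_kernel_def by auto
    then show ?thesis by (simp add: G_def gamma_eq_lap_value z)
  qed
  obtain s1 where s1: "s < s1" "s1 < R" using s dense by blast
  have s11: "s1 < 1" using s1 R_less_1 by simp
  obtain C where C: "\<And>n. norm (\<kappa> n) \<le> C * (s1 / sqrt q) ^ n"
    using kernel_inversion[OF K G1 holG s(1) s1(1) s11] by blast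
  have s10: "0 < s1" using s s1 by simp
  have "annulus s1 (1 / s1) \<subseteq> annulus s (1 / s)"
    using s s1 frac_le[of 1 1 s s1] by (auto simp: annulus_def)
  then have holG1: "G holomorphic_on annulus s1 (1 / s1)" using holG holomorphic_on_subset by blast
  have "\<forall>t\<in>annulus s1 (1 / s1). symbol \<kappa> t = \<Psi> (lap_value t)"
    using symbol_eq_on_annulus[OF s10 s11 C G1 holG1] unfolding G_def by blast
  then show ?thesis using s10 s1 C by blast
qed

end

section \<open>The decomposition into eigenfunctions\<close>

context tree_boundary begin

lemma compact_gamma_strip: "compact (gamma_sym q ` strip p)"
  unfolding gamma_strip using R_pos
  by (intro compact_continuous_image continuous_lap_value compact_closed_annulus) auto

text \<open>By the open mapping theorem an interior point of the annulus has an open set of spectral values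
  around it, and the maximum modulus principle applies to \<open>\<Psi>\<close> there.\<close>

lemma maximum_on_boundary:
  assumes D: "open D" "connected D" "gamma_sym q ` strip p \<subseteq> D"
    and hol: "\<Psi> holomorphic_on D" and nc: "\<not> \<Psi> constant_on D"
    and z: "z \<in> strip p" "\<And>w. w \<in> strip p \<Longrightarrow> cmod (\<Psi> (gamma_sym q w)) \<le> cmod (\<Psi> (gamma_sym q z))"
  shows "\<exists>\<alpha>\<in>period. gamma_sym q (spec_param p \<alpha>) = gamma_sym q z"
proof -
  define t where "t = of_nat q powr (\<i> * z)"
  have t: "t \<in> closed_annulus" using z(1) by (simp add: strip_iff t_def)
  have gt: "gamma_sym q z = lap_value t" by (simp add: t_def gamma_eq_lap_value)
  have max: "cmod (\<Psi> (lap_value u)) \<le> cmod (\<Psi> (lap_value t))" if "u \<in> closed_annulus" for u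
  proof -
    have "lap_value u \<in> gamma_sym q ` strip p" using that unfolding gamma_strip by (rule imageI)
    then obtain w where "w \<in> strip p" "lap_value u = gamma_sym q w" by blast
    then show ?thesis using z(2)[of w] by (simp add: gt)
  qed
  let ?A = "annulus R (1 / R)"
  have "t \<notin> ?A"
  proof
    assume tA: "t \<in> ?A"
    have sub: "?A \<subseteq> closed_annulus" by (auto simp: annulus_def)
    have hA: "lap_value holomorphic_on ?A" using R_pos by (intro holomorphic_lap_value zero_notin_annulus) simp
    have "\<not> lap_value constant_on ?A"
    proof
      assume "lap_value constant_on ?A"
      then obtain c where c: "\<And>u. u \<in> ?A \<Longrightarrow> lap_value u = c" unfolding constant_on_def by blast
      have R1: "1 < 1 / R" using one_less_inverse[OF R_pos R_less_1] by (simp only: inverse_eq_divide)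
      have "(1::complex) \<in> ?A" "\<i> \<in> ?A" using R1 R_less_1 by (simp_all add: annulus_def)
      then have "lap_value 1 = lap_value \<i>" using c by simp
      moreover have "of_nat (q + 1) \<noteq> (0::complex)" unfolding of_nat_eq_0_iff by simp
      ultimately have "joukowski (1::complex) = joukowski \<i>"
        unfolding lap_value_def by (simp del: of_nat_add of_nat_Suc)
      then show False using q_ge_2 by (simp add: joukowski_def)
    qed
    then have "open (lap_value ` ?A)"
      using hA by (intro open_mapping_thm[of _ ?A]) (auto simp: connected_annulus0)
    moreover have "lap_value ` ?A \<subseteq> D" using sub D(3) unfolding gamma_strip by blast
    ultimately have "\<Psi> constant_on D"
      using tA max sub
      by (intro maximum_modulus_principle[OF hol D(1,2), of "lap_value ` ?A" "lap_value t"]) auto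
    then show False using nc by simp
  qed
  then have "norm t = R \<or> norm t = 1 / R" using t unfolding annulus_def mem_Collect_eq by linarith
  then have "norm t = R \<or> norm (inverse t) = R" unfolding norm_inverse by auto
  then obtain u where u: "norm u = R" "lap_value u = lap_value t" using lap_value_inverse by metis
  then obtain \<alpha> where "\<alpha> \<in> period" "u = tpar \<alpha>" using tpar_surj by blast
  then show ?thesis using u gt lap_value_tpar by auto
qed

text \<open>The finitely many values of modulus \<open>a\<close> are each taken at finitely many points of a compact
  set, and a parameter in one period is determined by its eigenvalue.\<close>

lemma finite_maximum_parameters:
  assumes D: "open D" "connected D" "gamma_sym q ` strip p \<subseteq> D"
    and hol: "\<Psi> holomorphic_on D" and nc: "\<not> \<Psi> constant_on D"
    and fin: "finite ((\<lambda>z. \<Psi> (gamma_sym q z)) ` strip p \<inter> {w. cmod w = a})"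
  shows "finite {\<alpha>\<in>period. cmod (\<Psi> (gamma_sym q (spec_param p \<alpha>))) = a}"
proof -
  let ?S = "{\<alpha>\<in>period. cmod (\<Psi> (gamma_sym q (spec_param p \<alpha>))) = a}"
  let ?K = "gamma_sym q ` strip p"
  let ?W = "(\<lambda>z. \<Psi> (gamma_sym q z)) ` strip p \<inter> {w. cmod w = a}"
  have spec: "spec_param p \<alpha> \<in> strip p" for \<alpha>
  proof -
    have "\<bar>Im (spec_param p \<alpha>)\<bar> = \<bar>delta (ereal p)\<bar>"
      unfolding spec_param_def delta_r by (simp add: delta_def abs_minus_commute)
    then show ?thesis by (simp add: strip_def)
  qed
  have "finite {l \<in> ?K. \<Psi> l - w = 0}" for w
  proof (rule holomorphic_compact_finite_zeros[OF _ D(1,2) compact_gamma_strip D(3)])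
    show "(\<lambda>l. \<Psi> l - w) holomorphic_on D" by (intro holomorphic_intros hol)
    show "\<not> (\<lambda>l. \<Psi> l - w) constant_on D"
      using nc unfolding constant_on_def by (metis diff_add_cancel)
  qed
  then have "finite (\<Union>w\<in>?W. {l \<in> ?K. \<Psi> l - w = 0})" using fin by blast
  moreover have "(\<lambda>\<alpha>. gamma_sym q (spec_param p \<alpha>)) ` ?S \<subseteq> (\<Union>w\<in>?W. {l \<in> ?K. \<Psi> l - w = 0})"
    using spec by auto
  ultimately have "finite ((\<lambda>\<alpha>. gamma_sym q (spec_param p \<alpha>)) ` ?S)" by (rule rev_finite_subset)
  then show ?thesis
    by (rule finite_imageD) (rule inj_on_subset[OF gamma_spec_inj], blast)
qed

lemma infinite_period: "infinite period"
proof -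
  have "0 < tau q" using q_ge_2 by (simp add: tau_def)
  then have "infinite {- tau q / 2<..tau q / 2}" by simp
  moreover have "period = {- tau q / 2<..tau q / 2}" by auto
  ultimately show ?thesis by simp
qed

text \<open>The summands are \<open>Q\<^sub>\<alpha>(\<L>) f\<^sub>0\<close> for the Lagrange polynomials \<open>Q\<^sub>\<alpha>\<close>. Applying \<open>Q\<^sub>\<alpha>(\<L>)\<close> to any decomposition
  annihilates all summands but the one with parameter \<open>\<alpha>\<close>, which gives uniqueness.\<close>

lemma bounded_orbit_decomposition:
  fixes f :: "int \<Rightarrow> 'a \<Rightarrow> complex"
  assumes D: "open D" "connected D" "gamma_sym q ` strip p \<subseteq> D"
    and hol: "\<Psi> holomorphic_on D" and nc: "\<not> \<Psi> constant_on D"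
    and mk: "multiplier_kernel q E b \<nu> p \<Psi> \<kappa>" and A: "A \<noteq> 0"
    and orbit: "\<And>k. radial_conv E (f k) \<kappa> = (\<lambda>x. A * f (k + 1) x)"
    and M: "0 < M" "\<And>k. weak_norm r (f k) \<le> ennreal M"
    and att: "cmod A \<in> (\<lambda>z. cmod (\<Psi> (gamma_sym q z))) ` strip p"
    and max: "\<And>z. z \<in> strip p \<Longrightarrow> cmod (\<Psi> (gamma_sym q z)) \<le> cmod A"
    and fin: "finite ((\<lambda>z. \<Psi> (gamma_sym q z)) ` strip p \<inter> {w. cmod w = cmod A})"
  shows "\<exists>m \<alpha> g. eigen_decomposition q E p \<Psi> A (f 0) m \<alpha> g \<and>
    (\<forall>m' \<alpha>' g'. eigen_decomposition q E p \<Psi> A (f 0) m' \<alpha>' g' \<longrightarrow>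
      nonzero_summands m' \<alpha>' g' = nonzero_summands m \<alpha> g) \<and>
    (\<forall>l\<in>{1..m}. \<exists>F\<in>boundary_L \<nu> r. g l = poisson_transform q E b \<nu> (spec_param p (\<alpha> l)) F)"
proof -
  define ev where "ev \<alpha> = gamma_sym q (spec_param p \<alpha>)" for \<alpha>
  define S where "S = {\<alpha>\<in>period. cmod (\<Psi> (ev \<alpha>)) = cmod A}"
  have finS: "finite S" unfolding S_def ev_def by (rule finite_maximum_parameters[OF D hol nc fin])
  have neS: "S \<noteq> {}"
  proof -
    obtain z where z: "z \<in> strip p" "cmod A = cmod (\<Psi> (gamma_sym q z))" using att by blast
    then obtain \<alpha> where "\<alpha> \<in> period" "gamma_sym q (spec_param p \<alpha>) = gamma_sym q z"
      using maximum_on_boundary[OF D hol nc z(1)] max by auto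
    then have "\<alpha> \<in> S" using z by (simp add: S_def ev_def)
    then show ?thesis by blast
  qed
  have inj: "inj_on ev S" unfolding ev_def by (rule inj_on_subset[OF gamma_spec_inj]) (auto simp: S_def)
  have ev_t: "ev \<alpha> = lap_value (tpar \<alpha>)" for \<alpha> by (simp add: ev_def lap_value_tpar)
  obtain s C where s: "0 < s" "s < R" and K: "\<And>n. norm (\<kappa> n) \<le> C * (s / sqrt q) ^ n"
    and sym: "\<And>t. t \<in> annulus s (1 / s) \<Longrightarrow> symbol \<kappa> t = \<Psi> (lap_value t)"
    using multiplier_kernel_symbol[OF D(1,3) hol mk] by blast
  have wb: "weak_bound r M (f k)" for k using M weak_norm_le_iff[of M r "f k"] by simp
  have weak: "f k \<in> weak_L r" for k using wb M(1) weak_L_iff less_imp_le by blast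
  have sb: "sphere_bound (4 * M) (f k)" for k using wb M(1) by (intro weak_bound_sphere_bound) auto
  have temp: "tempered (f k)" for k using weak by (rule weak_L_tempered)
  have conv: "conv \<kappa> (f k) = (\<lambda>x. A * f (k + 1) x)" for k
    using conv_eq_radial_conv[OF s K temp] orbit by simp
  have symR: "symbol \<kappa> t = \<Psi> (lap_value t)" if "norm t = R" for t
  proof (rule sym)
    show "t \<in> annulus s (1 / s)" using that s R_less_1 by (intro annulus_below_1) auto
  qed
  define P where "P = (\<Prod>\<alpha>\<in>S. [:- ev \<alpha>, 1:])"
  have circle: "cmod (\<Psi> (lap_value t)) \<le> cmod A" if "norm t = R" for t
  proof -
    have "1 < 1 / R" using one_less_inverse[OF R_pos R_less_1] by (simp only: inverse_eq_divide)
    then have "norm t \<le> 1 / R" using that R_less_1 by linarith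
    then have "t \<in> closed_annulus" using that by (intro CollectI conjI) simp_all
    then have "lap_value t \<in> gamma_sym q ` strip p" unfolding gamma_strip by (rule imageI)
    then show ?thesis using max by auto
  qed
  \<comment> \<open>A boundary point where the symbol is not maximal: otherwise the set of maximal parameters would be infinite.\<close>
  obtain \<alpha>1 where a1: "\<alpha>1 \<in> period" "\<alpha>1 \<notin> S" using infinite_period finS by (metis finite_subset subsetI)
  have "\<exists>N. poly_lap (P ^ N) (f 0) = (\<lambda>x. 0)"
  proof (rule bounded_orbit_annihilated[where f = f and A = A and \<kappa> = \<kappa>, OF s K sb A conv])
    show "norm (symbol \<kappa> t) \<le> norm A" if "norm t = R" for t using circle[OF that] symR[OF that] by simp
    show "norm (tpar \<alpha>1) = R" by (rule norm_tpar)
    show "norm (symbol \<kappa> (tpar \<alpha>1)) < norm A"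
      using circle[OF norm_tpar[of \<alpha>1]] symR[OF norm_tpar[of \<alpha>1]] a1
      by (auto simp: S_def ev_t less_le)
    fix t assume t: "norm t = R" "norm (symbol \<kappa> t) = norm A"
    obtain \<alpha> where al: "\<alpha> \<in> period" "t = tpar \<alpha>" using tpar_surj[OF t(1)] by blast
    then have "\<alpha> \<in> S" using t symR[OF t(1)] by (simp add: S_def ev_t)
    then show "poly P (lap_value t) = 0"
      unfolding P_def poly_prod al(2) ev_t[symmetric] using finS by (intro prod_zero) auto
  qed
  then obtain N where N: "poly_lap (P ^ N) (f 0) = (\<lambda>x. 0)" by blast
  have P0: "poly_lap P (f 0) = (\<lambda>x. 0)"
    using reduce_all_multiplicities[where t = tpar and N = N and Q = 1, OF temp finS norm_tpar] N
    by (simp add: P_def ev_t)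
  define Q where "Q \<alpha> = smult (inverse (\<Prod>\<beta>\<in>S - {\<alpha>}. ev \<alpha> - ev \<beta>)) (\<Prod>\<beta>\<in>S - {\<alpha>}. [:- ev \<beta>, 1:])" for \<alpha>
  define G where "G \<alpha> = poly_lap (Q \<alpha>) (f 0)" for \<alpha>
  note lag = lagrange_partition_of_unity[OF finS neS inj, folded Q_def P_def]
  have sumG: "f 0 x = (\<Sum>\<alpha>\<in>S. G \<alpha> x)" for x
    unfolding G_def poly_lap_sum[symmetric] lag(1) by simp
  have eigG: "L (G \<alpha>) = (\<lambda>x. ev \<alpha> * G \<alpha> x)" if al: "\<alpha> \<in> S" for \<alpha>
  proof -
    obtain c where c: "[:- ev \<alpha>, 1:] * Q \<alpha> = smult c P" using lag(3)[OF al] by blast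
    have "poly_lap [:- ev \<alpha>, 1:] (G \<alpha>) x = 0" for x
      unfolding G_def poly_lap_mult[symmetric] c poly_lap_smult P0 by simp
    then show ?thesis unfolding poly_lap_linear_factor by (simp add: fun_eq_iff)
  qed
  have weakG: "G \<alpha> \<in> weak_L r" for \<alpha> unfolding G_def by (rule weak_L_poly_lap[OF weak])
  have uniq: "nonzero_summands m' \<alpha>' g' = {(\<beta>, G \<beta>) | \<beta>. \<beta> \<in> S \<and> G \<beta> \<noteq> (\<lambda>x. 0)}"
    if dec: "eigen_decomposition q E p \<Psi> A (f 0) m' \<alpha>' g'" for m' \<alpha>' g'
  proof -
    have f0: "f 0 = (\<lambda>x. \<Sum>l = 1..m'. g' l x)" and inj': "inj_on \<alpha>' {1..m'}"
      and S': "\<And>l. l \<in> {1..m'} \<Longrightarrow> \<alpha>' l \<in> S"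
      and eig': "\<And>l. l \<in> {1..m'} \<Longrightarrow> L (g' l) = (\<lambda>x. ev (\<alpha>' l) * g' l x)"
      using dec unfolding eigen_decomposition_def S_def ev_def by auto
    have Gval: "G \<beta> x = (\<Sum>l = 1..m'. (if \<beta> = \<alpha>' l then g' l x else 0))" if be: "\<beta> \<in> S" for \<beta> x
    proof -
      have "G \<beta> x = (\<Sum>l = 1..m'. poly_lap (Q \<beta>) (g' l) x)" unfolding G_def f0 by (rule poly_lap_sum_fun)
      also have "\<dots> = (\<Sum>l = 1..m'. (if \<beta> = \<alpha>' l then g' l x else 0))"
        using lag(2)[OF be S'] poly_lap_eigenfunction[OF eig'] by (intro sum.cong) auto
      finally show ?thesis .
    qed
    have G1: "G (\<alpha>' l) = g' l" if l: "l \<in> {1..m'}" for l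
    proof
      fix x
      have "G (\<alpha>' l) x = (\<Sum>k = 1..m'. (if k = l then g' k x else 0))"
        unfolding Gval[OF S'[OF l]]
      proof (rule sum.cong[OF refl])
        fix k assume k: "k \<in> {1..m'}"
        have "\<alpha>' l = \<alpha>' k \<longleftrightarrow> k = l" using inj_on_eq_iff[OF inj' l k] by (simp only: eq_commute)
        then show "(if \<alpha>' l = \<alpha>' k then g' k x else 0) = (if k = l then g' k x else 0)" by (simp only:)
      qed
      then show "G (\<alpha>' l) x = g' l x" using l by simp
    qed
    have G2: "\<beta> \<in> \<alpha>' ` {1..m'}" if "\<beta> \<in> S" "G \<beta> \<noteq> (\<lambda>x. 0)" for \<beta>
    proof (rule ccontr)
      assume "\<beta> \<notin> \<alpha>' ` {1..m'}"
      then have "G \<beta> x = 0" for x unfolding Gval[OF that(1)] by (intro sum.neutral) auto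
      then show False using that(2) by auto
    qed
    show ?thesis
      unfolding nonzero_summands_def
    proof (intro subset_antisym subsetI)
      fix y assume "y \<in> {(\<alpha>' l, g' l) | l. l \<in> {1..m'} \<and> g' l \<noteq> (\<lambda>x. 0)}"
      then obtain l where l: "y = (\<alpha>' l, g' l)" "l \<in> {1..m'}" "g' l \<noteq> (\<lambda>x. 0)" by blast
      then show "y \<in> {(\<beta>, G \<beta>) | \<beta>. \<beta> \<in> S \<and> G \<beta> \<noteq> (\<lambda>x. 0)}" using l(3) G1[OF l(2)] S'[OF l(2)]
        unfolding l(1) by (intro CollectI exI[of _ "\<alpha>' l"] conjI) (simp_all only: simp_thms)
    next
      fix y assume "y \<in> {(\<beta>, G \<beta>) | \<beta>. \<beta> \<in> S \<and> G \<beta> \<noteq> (\<lambda>x. 0)}"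
      then obtain \<beta> where be: "y = (\<beta>, G \<beta>)" "\<beta> \<in> S" "G \<beta> \<noteq> (\<lambda>x. 0)" by blast
      then obtain l where l: "l \<in> {1..m'}" "\<beta> = \<alpha>' l" using G2 by blast
      then show "y \<in> {(\<alpha>' l, g' l) | l. l \<in> {1..m'} \<and> g' l \<noteq> (\<lambda>x. 0)}" using be G1[OF l(1)] by auto
    qed
  qed
  obtain \<alpha> where bij: "bij_betw \<alpha> {1..card S} S" using ex_bij_betw_nat_finite_1[OF finS] by blast
  have \<alpha>S: "\<alpha> l \<in> S" if "l \<in> {1..card S}" for l using bij that by (auto simp: bij_betw_def)
  define g where "g l = G (\<alpha> l)" for l
  have dec: "eigen_decomposition q E p \<Psi> A (f 0) (card S) \<alpha> g"
    unfolding eigen_decomposition_def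
  proof (intro conjI ballI)
    show "1 \<le> card S" using finS neS by (simp add: Suc_le_eq card_gt_0_iff)
    show "f 0 = (\<lambda>x. \<Sum>l = 1..card S. g l x)"
      using sumG sum.reindex_bij_betw[OF bij, of "\<lambda>\<alpha>. G \<alpha> _"] by (simp add: g_def fun_eq_iff)
    show "inj_on \<alpha> {1..card S}" using bij by (simp add: bij_betw_def)
    fix l assume l: "l \<in> {1..card S}"
    from \<alpha>S[OF l] show "- tau q / 2 < \<alpha> l" "\<alpha> l \<le> tau q / 2"
      "cmod (\<Psi> (gamma_sym q (spec_param p (\<alpha> l)))) = cmod A" by (auto simp: S_def ev_def)
    show "g l \<in> weak_L r" unfolding g_def by (rule weakG)
    show "L (g l) = (\<lambda>x. gamma_sym q (spec_param p (\<alpha> l)) * g l x)"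
      using eigG[OF \<alpha>S[OF l]] by (simp add: g_def ev_def)
  qed
  moreover have "\<forall>m' \<alpha>' g'. eigen_decomposition q E p \<Psi> A (f 0) m' \<alpha>' g' \<longrightarrow>
      nonzero_summands m' \<alpha>' g' = nonzero_summands (card S) \<alpha> g"
    using uniq dec by simp
  moreover have "\<exists>F\<in>boundary_L \<nu> r. g l = poisson_transform q E b \<nu> (spec_param p (\<alpha> l)) F" if l: "l \<in> {1..card S}" for l
    using eigG[OF \<alpha>S[OF l]] weakG[of "\<alpha> l"] unfolding g_def ev_def by (rule eigenfunction_poisson)
  ultimately show ?thesis by blast
qed

end

theorem theorem5p5:
  fixes q :: nat
    and E :: "'a \<Rightarrow> 'a \<Rightarrow> bool"
    and b :: 'a
    and \<nu> :: "(nat \<Rightarrow> 'a) measure"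
    and p M :: real
    and \<Psi> :: "complex \<Rightarrow> complex"
    and D :: "complex set"
    and \<kappa> :: "nat \<Rightarrow> complex"
    and f :: "int \<Rightarrow> 'a \<Rightarrow> complex"
    and A :: complex
  assumes "2 \<le> q"
    and "homogeneous_tree q E"
    and "boundary_measure q E b \<nu>"
    and "1 \<le> p" "p < 2"
    and "open D" "connected D" "gamma_sym q ` strip p \<subseteq> D"
    and "\<Psi> holomorphic_on D" "\<not> \<Psi> constant_on D"
    and "multiplier_kernel q E b \<nu> p \<Psi> \<kappa>"
    and "A \<noteq> 0"
    and "\<And>k. radial_conv E (f k) \<kappa> = (\<lambda>x. A * f (k + 1) x)"
    and "0 < M"
    and "\<And>k. weak_norm (conj_exponent p) (f k) \<le> ennreal M"
    and "cmod A \<in> (\<lambda>z. cmod (\<Psi> (gamma_sym q z))) ` strip p"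
    and "\<And>z. z \<in> strip p \<Longrightarrow> cmod (\<Psi> (gamma_sym q z)) \<le> cmod A"
    and "finite ((\<lambda>z. \<Psi> (gamma_sym q z)) ` strip p \<inter> {w. cmod w = cmod A})"
  shows "\<exists>m \<alpha> g.
           eigen_decomposition q E p \<Psi> A (f 0) m \<alpha> g \<and>
           (\<forall>m' \<alpha>' g'. eigen_decomposition q E p \<Psi> A (f 0) m' \<alpha>' g' \<longrightarrow>
              nonzero_summands m' \<alpha>' g' = nonzero_summands m \<alpha> g) \<and>
           (\<forall>l\<in>{1..m}. \<exists>F\<in>boundary_L \<nu> (conj_exponent p).
              g l = poisson_transform q E b \<nu> (spec_param p (\<alpha> l)) F)"
proof -
  interpret tree_boundary q E p b \<nu>
    using assms(1-5) by unfold_locales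
  show ?thesis
    by (rule bounded_orbit_decomposition[where f = f and \<Psi> = \<Psi>, OF assms(6-18)])
qed

end
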